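(* Let $\widetilde X:=(X,\rho,\mu)$ be a space of homogeneous type such that (a) $\mu$ is a locally finite Borel-regular measure with dense support, (b) $\widetilde X$ is locally compact, and (c) $\widetilde X$ is $\alpha$-regular for some $\alpha>1$. Given $\varepsilon\in(0,1]$, let $\rho_\varepsilon(x,y):=\rho(x,y)^\varepsilon$ for all $x,y\in X$, and let $d_\varepsilon$ be a metric on $X$ which is comparable to $\rho_\varepsilon$. Suppose the metric measure space $\widehat X:=(X,d_\varepsilon,\mu)$ satisfies (d) $\widehat X$ admits a weak $(1,p)$-Poincaré inequality for some $p\in[1,\alpha/\varepsilon)$. Let $f$ be an $\eta$-quasisymmetric map from $\widetilde X$ onto itself. Let $\widetilde J_f$ be the generalised Jacobian of $f$ with respect to the quasimetric $\rho$. Then $\widetilde J_f(x)$ exists and is finite for $\mu$-almost every $x$, and $\log\widetilde J_f\in\mathrm{BMO}(\widetilde X)$.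
   Context: A quasimetric on a set $X$ is a function $\rho:X\times X\to[0,\infty)$ with $\rho(x,y)=0$ iff $x=y$, $\rho(x,y)=\rho(y,x)$, and $\rho(x,z)\le A_0\rho(x,y)+A_0\rho(y,z)$ for all $x,y,z$, with $A_0\ge1$ a constant. Quasiballs are $\widetilde B(x,r)=\{y:\rho(x,y)<r\}$. A set $O\subset X$ is open (w.r.t. $\rho$) if for every $x\in O$ there is $r>0$ with $\widetilde B(x,r)\subset O$. A measure $\mu$ is doubling if quasiballs are $\mu$-measurable and there is $A_1\ge1$ with $0<\mu(\widetilde B(x,2r))\le A_1\mu(\widetilde B(x,r))<\infty$ for all $x\in X$, $r>0$. A space of homogeneous type is a triple $(X,\rho,\mu)$ with $X$ nonempty, $\rho$ a quasimetric and $\mu$ doubling; $\mu$ is defined on a $\sigma$-algebra containing all Borel sets and all quasiballs. A metric measure space is a triple $(X,d,\mu)$ with $d$ a metric and $\mu$ doubling. $\mu$ is Borel regular if for all Borel sets $E$, $\mu(E)=\sup\{\mu(V):V\text{ closed},V\subset E\}=\inf\{\mu(U):U\text{ open},E\subset U\}$. $\widetilde X$ is locally compact if for each $x\in X$ there are an open set $O$ and a compact set $K$ (both w.r.t. $\rho$) with $x\in O\subset K$. $\widetilde X$ is $\alpha$-regular if there is $\kappa\ge1$ with $\kappa^{-1}r^\alpha\le\mu(\widetilde B_r)\le\kappa r^\alpha$ for every quasiball $\widetilde B_r$ of radius $r<\operatorname{diam}X$ (diameter w.r.t. $\rho$). $d_\varepsilon$ is comparable to $\rho_\varepsilon$ if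 there is a constant $C_\varepsilon\ge1$ with $C_\varepsilon^{-1}\rho_\varepsilon(x,y)\le d_\varepsilon(x,y)\le C_\varepsilon\rho_\varepsilon(x,y)$ for all $x,y\in X$. For an open set $U$ in a metric space and a real-valued function $u$ on $U$, a Borel function $\varrho:U\to[0,\infty]$ is a very weak gradient (upper gradient) of $u$ in $U$ if $|u(x)-u(y)|\le\int_{\gamma_{xy}}\varrho\,ds$ for each rectifiable curve $\gamma_{xy}$ joining two points $x,y$ in $U$. For $p\ge1$, a metric measure space admits a weak $(1,p)$-Poincaré inequality if there are constants $C_p,C_0\ge1$ such that for every ball $B$, $$\frac1{\mu(B)}\int_B|u-u_B|\,d\mu\le C_p(\operatorname{diam}B)\Big(\frac1{\mu(C_0B)}\int_{C_0B}\varrho^p\,d\mu\Big)^{1/p}$$ whenever $u$ is a bounded continuous function on the ball $C_0B$ and $\varrho$ is a very weak gradient of $u$ there ($u_B$ is the average of $u$ over $B$); the constants are independent of $B$ and $u$. A homeomorphism $f:(X,\rho)\to(X,\rho)$ is $\eta$-quasisymmetric if $\eta:[0,\infty)\to[0,\infty)$ is an increasing homeomorphism and for all $\theta\ge0$ and all distinct $x,a,b\in X$, $\frac{\rho(x,a)}{\rho(x,b)}\le\theta$ implies $\frac{\rho(f(x),f(a))}{\rho(f(x),f(b))}\le\eta(\theta)$. With $\mu_f(E):=\mu(f(E))$, the generalised Jacobian of $f$ w.r.t. $\rho$ is $$\widetilde J_f(x):=\lim_{r\to0^+}\frac{\mu_f(\overline B_\rho(x,r))}{\mu(\overline B_\rho(x,r))},\qquad\overline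 B_\rho(x,r)=\{y\in X:\rho(x,y)\le r\}.$$ A locally integrable real-valued function $g$ is in $\mathrm{BMO}(\widetilde X)$ if $\sup_{\widetilde B}\frac1{\mu(\widetilde B)}\int_{\widetilde B}|g-g_{\widetilde B}|\,d\mu<\infty$, the supremum over all quasiballs, where $g_{\widetilde B}$ is the $\mu$-average of $g$ over $\widetilde B$.
   Formalization: "Quasiballs are μ-measurable" is taken to mean that each quasiball lies between two Borel sets differing by a μ-null set; if μ may be an arbitrary extension of a Borel measure whose σ-algebra merely contains the quasiballs, the Jacobian can fail to exist almost everywhere. *)

theory Defs
  imports "HOL-Analysis.Analysis"
begin

section \<open>Quasimetric spaces\<close>

definition quasimetric_on :: "'a set \<Rightarrow> ('a \<Rightarrow> 'a \<Rightarrow> real) \<Rightarrow> bool" where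
  "quasimetric_on X \<rho> \<longleftrightarrow>
     (\<forall>x\<in>X. \<forall>y\<in>X. 0 \<le> \<rho> x y \<and> (\<rho> x y = 0 \<longleftrightarrow> x = y) \<and> \<rho> x y = \<rho> y x) \<and>
     (\<exists>A\<^sub>0\<ge>1. \<forall>x\<in>X. \<forall>y\<in>X. \<forall>z\<in>X. \<rho> x z \<le> A\<^sub>0 * \<rho> x y + A\<^sub>0 * \<rho> y z)"

definition qball :: "'a set \<Rightarrow> ('a \<Rightarrow> 'a \<Rightarrow> real) \<Rightarrow> 'a \<Rightarrow> real \<Rightarrow> 'a set" where
  "qball X \<rho> x r = {y \<in> X. \<rho> x y < r}"

definition qcball :: "'a set \<Rightarrow> ('a \<Rightarrow> 'a \<Rightarrow> real) \<Rightarrow> 'a \<Rightarrow> real \<Rightarrow> 'a set" where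
  "qcball X \<rho> x r = {y \<in> X. \<rho> x y \<le> r}"

text \<open>Quasiballs need not themselves be open (nor Borel) in this topology.\<close>

definition qtopology :: "'a set \<Rightarrow> ('a \<Rightarrow> 'a \<Rightarrow> real) \<Rightarrow> 'a topology" where
  "qtopology X \<rho> = topology (\<lambda>U. U \<subseteq> X \<and> (\<forall>x\<in>U. \<exists>r>0. qball X \<rho> x r \<subseteq> U))"

lemma openin_qtopology:
  "openin (qtopology X \<rho>) U \<longleftrightarrow> U \<subseteq> X \<and> (\<forall>x\<in>U. \<exists>r>0. qball X \<rho> x r \<subseteq> U)"
proof -
  let ?open = "\<lambda>U. U \<subseteq> X \<and> (\<forall>x\<in>U. \<exists>r>0. qball X \<rho> x r \<subseteq> U)"
  have inter: "?open (S \<inter> T)" if S: "?open S" and T: "?open T" for S T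
  proof (intro conjI ballI)
    show "S \<inter> T \<subseteq> X" using S by blast
    fix x assume x: "x \<in> S \<inter> T"
    obtain r where "r > 0" "qball X \<rho> x r \<subseteq> S" using S x by blast
    moreover obtain s where "s > 0" "qball X \<rho> x s \<subseteq> T" using T x by blast
    ultimately have "min r s > 0" "qball X \<rho> x (min r s) \<subseteq> S \<inter> T"
      by (auto simp: qball_def)
    then show "\<exists>r>0. qball X \<rho> x r \<subseteq> S \<inter> T" by blast
  qed
  have union: "?open (\<Union>\<K>)" if "\<forall>K\<in>\<K>. ?open K" for \<K>
  proof (intro conjI ballI)
    show "\<Union>\<K> \<subseteq> X" using that by blast
    fix x assume "x \<in> \<Union>\<K>"
    then obtain K where K: "K \<in> \<K>" "x \<in> K" by blast
    with that obtain r where "r > 0" "qball X \<rho> x r \<subseteq> K" by blast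
    with K show "\<exists>r>0. qball X \<rho> x r \<subseteq> \<Union>\<K>" by blast
  qed
  have "istopology ?open"
    unfolding istopology_def
  proof (rule conjI)
    show "\<forall>S T. ?open S \<longrightarrow> ?open T \<longrightarrow> ?open (S \<inter> T)"
      by (rule allI, rule allI, rule impI, rule impI, rule inter)
    show "\<forall>\<K>. (\<forall>K\<in>\<K>. ?open K) \<longrightarrow> ?open (\<Union>\<K>)"
      by (rule allI, rule impI, rule union)
  qed
  then show ?thesis
    by (simp add: qtopology_def topology_inverse')
qed

lemma topspace_qtopology [simp]: "topspace (qtopology X \<rho>) = X"
proof
  show "topspace (qtopology X \<rho>) \<subseteq> X"
    using openin_topspace[of "qtopology X \<rho>"] unfolding openin_qtopology by (rule conjunct1)
  have "openin (qtopology X \<rho>) X"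
    unfolding openin_qtopology
  proof (intro conjI ballI)
    show "\<exists>r>0. qball X \<rho> x r \<subseteq> X" for x
      by (rule exI[of _ 1]) (simp add: qball_def)
  qed simp
  then show "X \<subseteq> topspace (qtopology X \<rho>)"
    by (rule openin_subset)
qed

lemma (in Metric_space) qball_eq_mball: "x \<in> M \<Longrightarrow> qball M d x r = mball x r"
  by (auto simp: qball_def)

lemma (in Metric_space) qtopology_eq_mtopology: "qtopology M d = mtopology"
proof -
  have "openin (qtopology M d) U \<longleftrightarrow> openin mtopology U" for U
  proof (cases "U \<subseteq> M")
    case True
    then have "qball M d x r = mball x r" if "x \<in> U" for x r
      using that qball_eq_mball by blast
    then show ?thesis
      unfolding openin_qtopology openin_mtopology by (simp add: Ball_def)
  qed (simp add: openin_qtopology openin_mtopology)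
  then show ?thesis
    by (simp add: topology_eq)
qed

definition diam_of :: "('a \<Rightarrow> 'a \<Rightarrow> real) \<Rightarrow> 'a set \<Rightarrow> ennreal" where
  "diam_of \<rho> S = (SUP x\<in>S. SUP y\<in>S. ennreal (\<rho> x y))"

definition comparable_on :: "'a set \<Rightarrow> ('a \<Rightarrow> 'a \<Rightarrow> real) \<Rightarrow> ('a \<Rightarrow> 'a \<Rightarrow> real) \<Rightarrow> bool" where
  "comparable_on X d \<rho> \<longleftrightarrow>
     (\<exists>C\<ge>1. \<forall>x\<in>X. \<forall>y\<in>X. inverse C * \<rho> x y \<le> d x y \<and> d x y \<le> C * \<rho> x y)"


section \<open>Measures on quasimetric spaces\<close>

definition borel_of :: "'a topology \<Rightarrow> 'a measure" where
  "borel_of T = sigma (topspace T) {U. openin T U}"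

text \<open>
  A set is \<open>\<mu>\<close>-measurable when it lies between two Borel sets that differ by a null set, that is,
  when it belongs to the completion of the Borel measure given by \<open>\<mu>\<close>.  For quasiballs it does not
  suffice that they belong to the domain of \<open>\<mu>\<close>: that domain may be any \<open>\<sigma>\<close>-algebra
  containing the Borel sets, and Borel regularity speaks about Borel sets only.
  For example, extend planar Lebesgue measure by giving different weights to a Bernstein set \<open>A\<close>
  with \<open>- A\<close> its complement, and multiply the Euclidean distance by 2 on certain
  scales whenever exactly one of the two points is in \<open>A\<close>; then the volume derivative of
  \<open>x \<mapsto> - x\<close> along closed quasiballs oscillates.
\<close>

definition mu_measurable :: "'a topology \<Rightarrow> 'a measure \<Rightarrow> 'a set \<Rightarrow> bool" where
  "mu_measurable T \<mu> E \<longleftrightarrow>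
     (\<exists>A \<in> sets (borel_of T). \<exists>B \<in> sets (borel_of T). A \<subseteq> E \<and> E \<subseteq> B \<and> emeasure \<mu> (B - A) = 0)"

definition doubling_measure :: "'a set \<Rightarrow> ('a \<Rightarrow> 'a \<Rightarrow> real) \<Rightarrow> 'a measure \<Rightarrow> bool" where
  "doubling_measure X \<rho> \<mu> \<longleftrightarrow>
     space \<mu> = X \<and>
     sets (borel_of (qtopology X \<rho>)) \<subseteq> sets \<mu> \<and>
     (\<forall>x\<in>X. \<forall>r>0. qball X \<rho> x r \<in> sets \<mu> \<and> mu_measurable (qtopology X \<rho>) \<mu> (qball X \<rho> x r)) \<and>
     (\<exists>A\<^sub>1\<ge>1. \<forall>x\<in>X. \<forall>r>0.
        0 < emeasure \<mu> (qball X \<rho> x (2 * r)) \<and>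
        emeasure \<mu> (qball X \<rho> x (2 * r)) \<le> ennreal A\<^sub>1 * emeasure \<mu> (qball X \<rho> x r) \<and>
        ennreal A\<^sub>1 * emeasure \<mu> (qball X \<rho> x r) < \<infinity>)"

definition homogeneous_type :: "'a set \<Rightarrow> ('a \<Rightarrow> 'a \<Rightarrow> real) \<Rightarrow> 'a measure \<Rightarrow> bool" where
  "homogeneous_type X \<rho> \<mu> \<longleftrightarrow> X \<noteq> {} \<and> quasimetric_on X \<rho> \<and> doubling_measure X \<rho> \<mu>"

definition metric_measure_space :: "'a set \<Rightarrow> ('a \<Rightarrow> 'a \<Rightarrow> real) \<Rightarrow> 'a measure \<Rightarrow> bool" where
  "metric_measure_space X d \<mu> \<longleftrightarrow> Metric_space X d \<and> doubling_measure X d \<mu>"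

definition locally_finite_measure :: "'a topology \<Rightarrow> 'a measure \<Rightarrow> bool" where
  "locally_finite_measure T \<mu> \<longleftrightarrow>
     (\<forall>x \<in> topspace T. \<exists>U. openin T U \<and> x \<in> U \<and> emeasure \<mu> U < \<infinity>)"

definition borel_regular :: "'a topology \<Rightarrow> 'a measure \<Rightarrow> bool" where
  "borel_regular T \<mu> \<longleftrightarrow>
     (\<forall>E \<in> sets (borel_of T).
        emeasure \<mu> E = (SUP V\<in>{V. closedin T V \<and> V \<subseteq> E}. emeasure \<mu> V) \<and>
        emeasure \<mu> E = (INF U\<in>{U. openin T U \<and> E \<subseteq> U}. emeasure \<mu> U))"

definition measure_support :: "'a topology \<Rightarrow> 'a measure \<Rightarrow> 'a set" where
  "measure_support T \<mu> = {x \<in> topspace T. \<forall>U. openin T U \<and> x \<in> U \<longrightarrow> 0 < emeasure \<mu> U}"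

definition alpha_regular :: "'a set \<Rightarrow> ('a \<Rightarrow> 'a \<Rightarrow> real) \<Rightarrow> 'a measure \<Rightarrow> real \<Rightarrow> bool" where
  "alpha_regular X \<rho> \<mu> \<alpha> \<longleftrightarrow>
     (\<exists>\<kappa>\<ge>1. \<forall>x\<in>X. \<forall>r>0. ennreal r < diam_of \<rho> X \<longrightarrow>
        ennreal (inverse \<kappa> * r powr \<alpha>) \<le> emeasure \<mu> (qball X \<rho> x r) \<and>
        emeasure \<mu> (qball X \<rho> x r) \<le> ennreal (\<kappa> * r powr \<alpha>))"

definition average :: "'a measure \<Rightarrow> 'a set \<Rightarrow> ('a \<Rightarrow> real) \<Rightarrow> real" where
  "average \<mu> B u = (LINT y:B|\<mu>. u y) / measure \<mu> B"

definition mean_oscillation :: "'a measure \<Rightarrow> 'a set \<Rightarrow> ('a \<Rightarrow> real) \<Rightarrow> real" where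
  "mean_oscillation \<mu> B u = average \<mu> B (\<lambda>y. \<bar>u y - average \<mu> B u\<bar>)"

text \<open>Local integrability is integrability over every quasiball, as the averages require.\<close>

definition in_BMO :: "'a set \<Rightarrow> ('a \<Rightarrow> 'a \<Rightarrow> real) \<Rightarrow> 'a measure \<Rightarrow> ('a \<Rightarrow> real) \<Rightarrow> bool" where
  "in_BMO X \<rho> \<mu> g \<longleftrightarrow>
     g \<in> borel_measurable \<mu> \<and>
     (\<forall>x\<in>X. \<forall>r>0. set_integrable \<mu> (qball X \<rho> x r) g) \<and>
     (\<exists>K. \<forall>x\<in>X. \<forall>r>0. mean_oscillation \<mu> (qball X \<rho> x r) g \<le> K)"


section \<open>Line integrals, very weak gradients and the Poincare inequality\<close>

text \<open>Curves are parametrised by \<open>{0..1}\<close>; the length below is that of the restriction to \<open>{0..t}\<close>.\<close>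

definition curve_length :: "('a \<Rightarrow> 'a \<Rightarrow> real) \<Rightarrow> (real \<Rightarrow> 'a) \<Rightarrow> real \<Rightarrow> ennreal" where
  "curve_length d \<gamma> t =
     (SUP ts\<in>{ts. sorted ts \<and> set ts \<subseteq> {0..t}}.
        ennreal (\<Sum>i<length ts - 1. d (\<gamma> (ts ! i)) (\<gamma> (ts ! Suc i))))"

definition rectifiable_curve :: "('a \<Rightarrow> 'a \<Rightarrow> real) \<Rightarrow> (real \<Rightarrow> 'a) \<Rightarrow> bool" where
  "rectifiable_curve d \<gamma> \<longleftrightarrow> curve_length d \<gamma> 1 < \<infinity>"

text \<open>
  For a rectifiable continuous \<open>\<gamma>\<close> the length function is continuous and increasing, so the infimum
  is the first time at which the length is \<open>l\<close>, for every \<open>l\<close> between 0 and the total length.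
\<close>

definition arc_length_param :: "('a \<Rightarrow> 'a \<Rightarrow> real) \<Rightarrow> (real \<Rightarrow> 'a) \<Rightarrow> real \<Rightarrow> 'a" where
  "arc_length_param d \<gamma> l = \<gamma> (Inf {t \<in> {0..1}. ennreal l \<le> curve_length d \<gamma> t})"

definition line_integral :: "('a \<Rightarrow> 'a \<Rightarrow> real) \<Rightarrow> (real \<Rightarrow> 'a) \<Rightarrow> ('a \<Rightarrow> ennreal) \<Rightarrow> ennreal" where
  "line_integral d \<gamma> g =
     (\<integral>\<^sup>+ l\<in>{0..enn2real (curve_length d \<gamma> 1)}. g (arc_length_param d \<gamma> l) \<partial>lborel)"

definition very_weak_gradient ::
  "'a set \<Rightarrow> ('a \<Rightarrow> 'a \<Rightarrow> real) \<Rightarrow> 'a set \<Rightarrow> ('a \<Rightarrow> real) \<Rightarrow> ('a \<Rightarrow> ennreal) \<Rightarrow> bool" where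
  "very_weak_gradient X d U u g \<longleftrightarrow>
     g \<in> borel_measurable (borel_of (subtopology (Metric_space.mtopology X d) U)) \<and>
     (\<forall>\<gamma>. pathin (subtopology (Metric_space.mtopology X d) U) \<gamma> \<and> rectifiable_curve d \<gamma> \<longrightarrow>
        ennreal \<bar>u (\<gamma> 0) - u (\<gamma> 1)\<bar> \<le> line_integral d \<gamma> g)"

definition ennreal_powr :: "ennreal \<Rightarrow> real \<Rightarrow> ennreal" where
  "ennreal_powr a s = (if a = \<infinity> then \<infinity> else ennreal (enn2real a powr s))"

definition weak_poincare :: "'a set \<Rightarrow> ('a \<Rightarrow> 'a \<Rightarrow> real) \<Rightarrow> 'a measure \<Rightarrow> real \<Rightarrow> bool" where
  "weak_poincare X d \<mu> p \<longleftrightarrow>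
     (\<exists>C\<^sub>p\<ge>1. \<exists>C\<^sub>0\<ge>1. \<forall>x\<in>X. \<forall>r>0. \<forall>u g.
        (let B = Metric_space.mball X d x r; B' = Metric_space.mball X d x (C\<^sub>0 * r) in
         continuous_map (subtopology (Metric_space.mtopology X d) B') euclideanreal u \<and>
         bounded (u ` B') \<and>
         very_weak_gradient X d B' u g \<longrightarrow>
         ennreal (mean_oscillation \<mu> B u) \<le>
           ennreal C\<^sub>p * diam_of d B *
           ennreal_powr ((\<integral>\<^sup>+ y\<in>B'. ennreal_powr (g y) p \<partial>\<mu>) / emeasure \<mu> B') (1 / p)))"


section \<open>Quasisymmetric maps and the generalised Jacobian\<close>

definition quasisymmetric_map ::
  "'a set \<Rightarrow> ('a \<Rightarrow> 'a \<Rightarrow> real) \<Rightarrow> (real \<Rightarrow> real) \<Rightarrow> ('a \<Rightarrow> 'a) \<Rightarrow> bool" where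
  "quasisymmetric_map X \<rho> \<eta> f \<longleftrightarrow>
     homeomorphic_map (qtopology X \<rho>) (qtopology X \<rho>) f \<and>
     strict_mono_on {0..} \<eta> \<and> (\<exists>\<eta>'. homeomorphism {0..} {0..} \<eta> \<eta>') \<and>
     (\<forall>\<theta>\<ge>0. \<forall>x\<in>X. \<forall>a\<in>X. \<forall>b\<in>X. x \<noteq> a \<and> x \<noteq> b \<and> a \<noteq> b \<longrightarrow>
        \<rho> x a / \<rho> x b \<le> \<theta> \<longrightarrow> \<rho> (f x) (f a) / \<rho> (f x) (f b) \<le> \<eta> \<theta>)"

text \<open>
  The image of a closed quasiball need not belong to the domain of \<open>\<mu>\<close>, where \<open>emeasure\<close> would
  return 0; the outer measure agrees with \<open>emeasure\<close> on the domain of \<open>\<mu>\<close>.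
\<close>

definition pullback_measure :: "'a measure \<Rightarrow> ('a \<Rightarrow> 'a) \<Rightarrow> 'a set \<Rightarrow> ennreal" where
  "pullback_measure \<mu> f E = outer_measure_of \<mu> (f ` E)"

definition volume_ratio ::
  "'a set \<Rightarrow> ('a \<Rightarrow> 'a \<Rightarrow> real) \<Rightarrow> 'a measure \<Rightarrow> ('a \<Rightarrow> 'a) \<Rightarrow> 'a \<Rightarrow> real \<Rightarrow> ennreal" where
  "volume_ratio X \<rho> \<mu> f x r =
     pullback_measure \<mu> f (qcball X \<rho> x r) / emeasure \<mu> (qcball X \<rho> x r)"

text \<open>Meaningful only where the limit exists, which has to be stated separately.\<close>

definition gen_jacobian ::
  "'a set \<Rightarrow> ('a \<Rightarrow> 'a \<Rightarrow> real) \<Rightarrow> 'a measure \<Rightarrow> ('a \<Rightarrow> 'a) \<Rightarrow> 'a \<Rightarrow> ennreal" where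
  "gen_jacobian X \<rho> \<mu> f x = Lim (at_right 0) (volume_ratio X \<rho> \<mu> f x)"

text \<open>
  The logarithm of the Jacobian is only defined almost everywhere, so it is in BMO when it coincides
  almost everywhere with a function in BMO; in particular the Jacobian must be almost everywhere
  positive and finite.
\<close>

definition log_in_BMO ::
  "'a set \<Rightarrow> ('a \<Rightarrow> 'a \<Rightarrow> real) \<Rightarrow> 'a measure \<Rightarrow> ('a \<Rightarrow> ennreal) \<Rightarrow> bool" where
  "log_in_BMO X \<rho> \<mu> J \<longleftrightarrow>
     (\<exists>g. in_BMO X \<rho> \<mu> g \<and> (AE x in \<mu>. 0 < J x \<and> J x < \<infinity> \<and> g x = ln (enn2real (J x))))"

end

theory Submission
  imports Defs "HOL-Probability.Conditional_Expectation"
begin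

text \<open>
  The statement is an \<open>A\<^sub>\<infinity>\<close> theorem in the style of Heinonen and Koskela.  Everything is first
  proved in the metric space \<open>(X, d)\<close>, which is Ahlfors regular of dimension \<open>Q = \<alpha> / \<epsilon> > p\<close> and in
  which \<open>f\<close> is still quasisymmetric.  Write \<open>\<nu> E = \<mu> (f ` E)\<close>.  By quasisymmetry \<open>\<nu>\<close> is doubling, and
  by regularity \<open>\<nu> B\<close> is comparable to \<open>(diam (f ` B)) powr Q\<close> for balls \<open>B\<close>.

  The heart is the lemma \<open>small_measure_misses_image\<close>: a set that fills only a small
  proportion of the \<open>\<mu>\<close>-measure of a ball cannot fill almost all of its \<open>\<nu>\<close>-measure.  To see this, smooth
  the function \<open>u x = d (f x0) (f x)\<close> at a tiny scale \<open>t\<close>.  By quasisymmetry the smoothed function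
  has the upper gradient \<open>g y = K1 / t * (\<nu> (B (y, t))) powr (1 / Q)\<close>, while its mean oscillation
  on a ball \<open>B\<close> of radius \<open>R\<close> is at least a constant times \<open>diam (f ` B)\<close>.  The Poincare inequality becomes
  \<open>(\<nu> B / \<mu> B) powr (1 / Q) \<le> C * (average of (\<nu> (B (y, t)) / t powr Q) powr (p / Q)) powr (1 / p)\<close>,
  a reverse Hoelder inequality with the exponent \<open>p / Q < 1\<close> on the right.  If \<open>\<nu>\<close> lived almost
  entirely on a set \<open>F\<close> of small \<open>\<mu>\<close>-measure, then for \<open>t\<close> small so would \<open>y \<mapsto> \<nu> (B (y, t))\<close>, and because the
  exponent is less than one the right-hand side would be too small.

  Such a comparison of two doubling measures improves itself (\<open>A_infinity_decay\<close>): by iterated Vitali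
  coverings a geometrically small proportion for one measure gives a geometrically small
  proportion for the other.  Applied in both directions this gives that \<open>\<mu>\<close> and \<open>\<nu>\<close> have the same null
  sets, and that the density \<open>w\<close> of \<open>\<nu>\<close> satisfies
  \<open>\<mu> {x \<in> B. w x < \<sigma> ^ N * \<nu> B / \<mu> B} \<le> D * c ^ N * \<mu> B\<close>.  Together with the bound of \<open>\<integral> w\<close> over \<open>B\<close> by
  \<open>\<nu> B\<close>, which controls large values, this makes the mean oscillation of \<open>ln w\<close> over balls bounded.

  It remains to identify \<open>w\<close> with the generalised Jacobian.  Lebesgue differentiation holds along all Borel
  sets that fill a fixed proportion of small balls.  Quasiballs of \<open>\<rho>\<close> are such sets up to null
  sets of \<open>\<mu>\<close>, and because \<open>\<nu>\<close> is absolutely continuous these null sets do not affect the outer measure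
  of the image.
\<close>

section \<open>Borel sets of an abstract topology\<close>

lemma space_borel_of [simp]: "space (borel_of T) = topspace T"
  unfolding borel_of_def by (intro space_measure_of) (auto dest: openin_subset)

lemma sets_borel_of: "sets (borel_of T) = sigma_sets (topspace T) {U. openin T U}"
  unfolding borel_of_def by (intro sets_measure_of) (auto dest: openin_subset)

lemma openin_imp_borel: "openin T U \<Longrightarrow> U \<in> sets (borel_of T)"
  by (auto simp: sets_borel_of)

lemma continuous_map_measurable_borel_of:
  assumes "continuous_map S T f"
  shows "f \<in> measurable (borel_of S) (borel_of T)"
  unfolding borel_of_def[of T]
proof (rule measurable_measure_of)
  show "{U. openin T U} \<subseteq> Pow (topspace T)" by (auto dest: openin_subset)
  show "f \<in> space (borel_of S) \<rightarrow> topspace T"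
    using assms by (auto simp: continuous_map_def)
  fix U assume "U \<in> {U. openin T U}"
  then have "openin S {x \<in> topspace S. f x \<in> U}"
    using assms by (auto simp: continuous_map_def)
  moreover have "f -` U \<inter> space (borel_of S) = {x \<in> topspace S. f x \<in> U}" by auto
  ultimately show "f -` U \<inter> space (borel_of S) \<in> sets (borel_of S)"
    by (simp add: openin_imp_borel)
qed

lemma borel_measurable_borel_of_lsc:
  fixes h :: "'a \<Rightarrow> real"
  assumes "\<And>c. openin T {x \<in> topspace T. c < h x}"
  shows "h \<in> borel_measurable (borel_of T)"
  unfolding borel_measurable_iff_greater
  using assms by (auto intro!: openin_imp_borel)

section \<open>Vitali coverings and doubling measures\<close>

context Metric_space
begin

lemma mball_borel [intro, simp]: "mball x r \<in> sets (borel_of mtopology)"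
  by (auto intro: openin_imp_borel)

text \<open>
  Zorn's lemma is applied to those disjoint subfamilies in which every ball that meets some member
  also meets a member of at least half its own radius.  A maximal such subfamily meets every ball:
  otherwise, among the balls that meet no member, one of almost maximal radius could be added.
\<close>

lemma vitali_disjoint_selection:
  fixes r :: "'a \<Rightarrow> real"
  assumes A: "A \<subseteq> M" and r: "\<And>x. x \<in> A \<Longrightarrow> 0 < r x \<and> r x \<le> R"
  shows "\<exists>S\<subseteq>A. disjoint_family_on (\<lambda>x. mball x (r x)) S \<and> A \<subseteq> (\<Union>x\<in>S. mball x (5 * r x))"
proof -
  define meets where "meets x y \<longleftrightarrow> mball x (r x) \<inter> mball y (r y) \<noteq> {}" for x y
  define \<C> where "\<C> = {S. S \<subseteq> A \<and> disjoint_family_on (\<lambda>x. mball x (r x)) S \<and>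
     (\<forall>x\<in>A. (\<exists>y\<in>S. meets x y) \<longrightarrow> (\<exists>y\<in>S. meets x y \<and> r x \<le> 2 * r y))}"
  have self: "meets x x" if "x \<in> A" for x
    using that A r[OF that] unfolding meets_def by fastforce
  have "\<exists>S\<in>\<C>. \<forall>T\<in>\<C>. S \<subseteq> T \<longrightarrow> T = S"
  proof (rule subset_Zorn')
    fix C assume C: "subset.chain \<C> C"
    then have sub: "C \<subseteq> \<C>" and tot: "\<And>S T. S \<in> C \<Longrightarrow> T \<in> C \<Longrightarrow> S \<subseteq> T \<or> T \<subseteq> S"
      unfolding subset_chain_def by auto
    have "\<Union>C \<subseteq> A" using sub unfolding \<C>_def by blast
    moreover have "disjoint_family_on (\<lambda>x. mball x (r x)) (\<Union>C)"
      unfolding disjoint_family_on_def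
    proof (intro ballI impI)
      fix x y assume "x \<in> \<Union>C" "y \<in> \<Union>C" and ne: "x \<noteq> y"
      then obtain S T where "S \<in> C" "T \<in> C" "x \<in> S" "y \<in> T" by blast
      with tot obtain U where U: "U \<in> C" "x \<in> U" "y \<in> U" by (metis subsetD)
      then have "disjoint_family_on (\<lambda>x. mball x (r x)) U" using sub unfolding \<C>_def by blast
      then show "mball x (r x) \<inter> mball y (r y) = {}"
        using U ne unfolding disjoint_family_on_def by blast
    qed
    moreover have "\<forall>x\<in>A. (\<exists>y\<in>\<Union>C. meets x y) \<longrightarrow> (\<exists>y\<in>\<Union>C. meets x y \<and> r x \<le> 2 * r y)"
    proof (intro ballI impI)
      fix x assume "x \<in> A" "\<exists>y\<in>\<Union>C. meets x y"
      then obtain S y where S: "S \<in> C" "y \<in> S" "meets x y" by blast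
      then have "S \<in> \<C>" using sub by blast
      with S \<open>x \<in> A\<close> have "\<exists>y\<in>S. meets x y \<and> r x \<le> 2 * r y" unfolding \<C>_def by blast
      with S show "\<exists>y\<in>\<Union>C. meets x y \<and> r x \<le> 2 * r y" by blast
    qed
    ultimately show "\<Union>C \<in> \<C>" unfolding \<C>_def by blast
  qed
  then obtain S where S: "S \<in> \<C>" and max: "\<And>T. T \<in> \<C> \<Longrightarrow> S \<subseteq> T \<Longrightarrow> T = S" by blast
  have SA: "S \<subseteq> A" and disj: "disjoint_family_on (\<lambda>x. mball x (r x)) S"
    and big: "\<And>x. x \<in> A \<Longrightarrow> \<exists>y\<in>S. meets x y \<Longrightarrow> \<exists>y\<in>S. meets x y \<and> r x \<le> 2 * r y"
    using S unfolding \<C>_def by blast+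
  have meet_all: "\<exists>y\<in>S. meets x y" if xA: "x \<in> A" for x
  proof (rule ccontr)
    assume no: "\<not> (\<exists>y\<in>S. meets x y)"
    define T where "T = {x\<in>A. \<not> (\<exists>y\<in>S. meets x y)}"
    have "x \<in> T" using no xA by (simp add: T_def)
    have bdd: "bdd_above (r ` T)" using r unfolding T_def by (auto intro!: bdd_aboveI[of _ R])
    define s where "s = Sup (r ` T)"
    have le_s: "r z \<le> s" if "z \<in> T" for z
      unfolding s_def using that bdd by (auto intro: cSup_upper)
    have "0 < r x" using r xA by blast
    then have "s > 0" using le_s[OF \<open>x \<in> T\<close>] by linarith
    then have "s / 2 < s" by simp
    then obtain z where z: "z \<in> T" "s / 2 < r z"
      unfolding s_def using less_cSupD[of "r ` T" "Sup (r ` T) / 2"] \<open>x \<in> T\<close> by auto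
    have zA: "z \<in> A" and zS: "\<And>y. y \<in> S \<Longrightarrow> \<not> meets z y" using z unfolding T_def by auto
    have "z \<notin> S" using zS self zA by blast
    have "insert z S \<in> \<C>"
      unfolding \<C>_def
    proof (intro CollectI conjI ballI impI)
      show "insert z S \<subseteq> A" using zA SA by blast
      show "disjoint_family_on (\<lambda>x. mball x (r x)) (insert z S)"
        using disj zS \<open>z \<notin> S\<close> unfolding meets_def
        by (auto simp: disjoint_family_on_insert disjoint_iff)
      fix w assume w: "w \<in> A" and ex: "\<exists>y\<in>insert z S. meets w y"
      show "\<exists>y\<in>insert z S. meets w y \<and> r w \<le> 2 * r y"
      proof (cases "\<exists>y\<in>S. meets w y")
        case True
        then show ?thesis using big[OF w] by blast
      next
        case False
        then have "w \<in> T" using w by (simp add: T_def)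
        then have "r w \<le> 2 * r z" using le_s[of w] z by linarith
        moreover have "meets w z" using ex False by blast
        ultimately show ?thesis by blast
      qed
    qed
    then show False using max[of "insert z S"] \<open>z \<notin> S\<close> by blast
  qed
  have "A \<subseteq> (\<Union>x\<in>S. mball x (5 * r x))"
  proof
    fix x assume x: "x \<in> A"
    obtain y where y: "y \<in> S" "meets x y" "r x \<le> 2 * r y" using big[OF x meet_all[OF x]] by blast
    then obtain z where z: "z \<in> M" "d x z < r x" "d y z < r y" unfolding meets_def by auto
    have "x \<in> M" "y \<in> M" using x y SA A by auto
    then have "d y x \<le> d y z + d z x" using z triangle by blast
    then have "d y x < 5 * r y" using z y commute[of z x] r[of y] y SA by fastforce
    then show "x \<in> (\<Union>x\<in>S. mball x (5 * r x))" using y \<open>x \<in> M\<close> \<open>y \<in> M\<close> by auto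
  qed
  with SA disj show ?thesis by blast
qed

text \<open>
  The constant is a parameter because the arguments below compare two doubling measures and use
  one constant for both of them.
\<close>

definition doubling_borel :: "real \<Rightarrow> 'a measure \<Rightarrow> bool" where
  "doubling_borel C m \<longleftrightarrow> sets m = sets (borel_of mtopology) \<and>
     (\<forall>x\<in>M. \<forall>r>0. 0 < emeasure m (mball x r) \<and> emeasure m (mball x r) < \<infinity> \<and>
        emeasure m (mball x (2 * r)) \<le> ennreal C * emeasure m (mball x r))"

context
  fixes C :: real and m :: "'a measure"
  assumes m: "doubling_borel C m"
begin

lemma doubling_sets: "sets m = sets (borel_of mtopology)"
  using m by (simp add: doubling_borel_def)

lemma doubling_space: "space m = M"
  using sets_eq_imp_space_eq[OF doubling_sets] by simp

lemma doubling_finite_ball: "emeasure m (mball x r) < \<infinity>"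
proof (cases "x \<in> M \<and> 0 < r")
  case True then show ?thesis using m by (simp add: doubling_borel_def)
next
  case False then have "mball x r = {}" by (simp add: mball_eq_empty) linarith
  then show ?thesis by simp
qed

lemma doubling_finite:
  assumes "E \<subseteq> mball x r" shows "emeasure m E < \<infinity>"
  using emeasure_mono[OF assms, of m] doubling_finite_ball[of x r] doubling_sets by auto

lemma doubling_emeasure:
  assumes "E \<subseteq> mball x r" shows "emeasure m E = ennreal (measure m E)"
  using doubling_finite[OF assms] by (intro emeasure_eq_ennreal_measure) auto

lemma doubling_mono:
  assumes "E \<subseteq> F" "F \<subseteq> mball x r" "F \<in> sets m" shows "measure m E \<le> measure m F"
proof -
  have "ennreal (measure m E) \<le> ennreal (measure m F)"
    using emeasure_mono[OF assms(1,3)] doubling_emeasure[OF assms(2)]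
      doubling_emeasure[of E x r] assms by auto
  then show ?thesis by (simp add: ennreal_le_iff)
qed

lemma doubling_pos: "x \<in> M \<Longrightarrow> 0 < r \<Longrightarrow> 0 < measure m (mball x r)"
  using m doubling_emeasure[of "mball x r" x r] unfolding doubling_borel_def
  by (metis ennreal_less_zero_iff subset_refl)

lemma doubling_real:
  assumes "x \<in> M" "0 < r" "0 \<le> C"
  shows "measure m (mball x (2 * r)) \<le> C * measure m (mball x r)"
proof -
  have "ennreal (measure m (mball x (2 * r))) \<le> ennreal C * ennreal (measure m (mball x r))"
    using m assms doubling_emeasure[of "mball x r" x r] doubling_emeasure[of "mball x (2*r)" x "2*r"]
    unfolding doubling_borel_def by (metis subset_refl)
  also have "\<dots> = ennreal (C * measure m (mball x r))" using assms by (simp add: ennreal_mult)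
  finally show ?thesis using assms by (simp add: ennreal_le_iff)
qed

lemma doubling_const_ge_1:
  assumes "x \<in> M" shows "1 \<le> C"
proof -
  have pos: "0 < measure m (mball x 1)" using doubling_pos[of x 1] assms by simp
  have mono: "measure m (mball x 1) \<le> measure m (mball x (2 * 1))"
    by (rule doubling_mono[of _ _ x 2]) (auto simp: doubling_sets)
  have C0: "0 \<le> C"
  proof (rule ccontr)
    assume "\<not> 0 \<le> C"
    then have "ennreal C = 0" by (simp add: ennreal_neg)
    then have "emeasure m (mball x (2 * 1)) = 0"
      using m assms unfolding doubling_borel_def by (metis le_zero_eq mult_zero_left zero_less_one)
    then show False using pos mono by (simp add: measure_def)
  qed
  have "1 * measure m (mball x 1) \<le> C * measure m (mball x 1)"
    using doubling_real[of x 1] mono assms C0 by simp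
  then show ?thesis using pos by (simp only: mult_le_cancel_right_pos)
qed

lemma doubling_power:
  assumes "x \<in> M" "0 < r"
  shows "measure m (mball x (2 ^ k * r)) \<le> C ^ k * measure m (mball x r)"
proof (induction k)
  case 0 then show ?case by simp
next
  case (Suc k)
  have C: "1 \<le> C" using doubling_const_ge_1 assms by blast
  have "measure m (mball x (2 * (2 ^ k * r))) \<le> C * measure m (mball x (2 ^ k * r))"
    using assms C by (intro doubling_real) auto
  also have "\<dots> \<le> C * (C ^ k * measure m (mball x r))"
    using Suc C by (intro mult_left_mono) auto
  finally show ?case by (simp add: mult.assoc)
qed

lemma doubling_engulf:
  assumes "x \<in> M" "0 < s" "E \<subseteq> mball x (2 ^ k * s)"
  shows "measure m E \<le> C ^ k * measure m (mball x s)"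
  using doubling_power[OF assms(1,2), of k] doubling_mono[OF assms(3), of x "2 ^ k * s"]
  by (simp add: doubling_sets)

lemma doubling_sigma_finite: "sigma_finite_measure m"
proof (cases "M = {}")
  case True
  then have "space m = {}" by (simp add: doubling_space)
  then show ?thesis by (intro sigma_finite_measure.intro exI[of _ "{}"]) auto
next
  case False
  then obtain x where x: "x \<in> M" by blast
  show ?thesis
  proof
    have "\<Union>(range (\<lambda>n. mball x (real n))) = M"
    proof
      show "M \<subseteq> \<Union>(range (\<lambda>n. mball x (real n)))"
      proof
        fix y assume "y \<in> M"
        obtain n where "d x y < real n" using reals_Archimedean2 by blast
        then show "y \<in> \<Union>(range (\<lambda>n. mball x (real n)))" using x \<open>y \<in> M\<close> by auto
      qed
    qed auto
    moreover have "\<forall>a\<in>range (\<lambda>n. mball x (real n)). emeasure m a \<noteq> \<infinity>"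
      using doubling_finite_ball by (auto simp: less_top)
    ultimately show "\<exists>A. countable A \<and> A \<subseteq> sets m \<and> \<Union> A = space m \<and> (\<forall>a\<in>A. emeasure m a \<noteq> \<infinity>)"
      by (intro exI[of _ "range (\<lambda>n. mball x (real n))"]) (auto simp: doubling_space doubling_sets)
  qed
qed

text \<open>
  A ball of finite measure contains only finitely many of the disjoint balls with measure above
  \<open>1 / Suc k\<close>, and every ball of the family is counted for some enclosing ball and some \<open>k\<close>.
\<close>

lemma disjoint_balls_countable:
  assumes S: "S \<subseteq> M" and r: "\<And>x. x \<in> S \<Longrightarrow> 0 < r x"
    and disj: "disjoint_family_on (\<lambda>x. mball x (r x)) S"
  shows "countable S"
proof (cases "S = {}")
  case False
  then obtain x0 where x0: "x0 \<in> S" by blast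
  define T where "T n k = {x\<in>S. mball x (r x) \<subseteq> mball x0 (real n) \<and> 1 / real (Suc k) < measure m (mball x (r x))}"
    for n k :: nat
  have fin: "finite (T n k)" for n k
  proof (rule ccontr)
    assume inf: "infinite (T n k)"
    define V where "V = measure m (mball x0 (real n))"
    obtain N where N: "V < real N * (1 / real (Suc k))"
      using reals_Archimedean3[of "1 / real (Suc k)"] by auto
    obtain F where F: "F \<subseteq> T n k" "finite F" "card F = N"
      using inf infinite_arbitrarily_large by blast
    have fm: "mball x (r x) \<in> fmeasurable m" for x
      using doubling_finite_ball by (auto simp: fmeasurable_def doubling_sets)
    have "real N * (1 / real (Suc k)) = (\<Sum>x\<in>F. 1 / real (Suc k))" using F by simp
    also have "\<dots> \<le> (\<Sum>x\<in>F. measure m (mball x (r x)))"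
      using F by (intro sum_mono) (auto simp: T_def intro: less_imp_le)
    also have "\<dots> = measure m (\<Union>x\<in>F. mball x (r x))"
      using F fm disj by (intro measure_UNION'[symmetric])
        (auto simp: pairwise_def disjnt_def disjoint_family_on_def T_def subset_iff)
    also have "\<dots> \<le> V"
      unfolding V_def using F by (intro doubling_mono[of _ _ x0 "real n"]) (auto simp: T_def doubling_sets)
    finally show False using N by linarith
  qed
  have "S \<subseteq> (\<Union>n. \<Union>k. T n k)"
  proof
    fix x assume x: "x \<in> S"
    obtain n where n: "d x0 x + r x < real n" using reals_Archimedean2 by blast
    then have "mball x (r x) \<subseteq> mball x0 (real n)"
      using x x0 S by (intro mball_subset) (auto simp: commute)
    moreover have "0 < measure m (mball x (r x))" using doubling_pos x S r by blast
    then obtain k where "1 / real (Suc k) < measure m (mball x (r x))"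
      using nat_approx_posE by blast
    ultimately show "x \<in> (\<Union>n. \<Union>k. T n k)" using x unfolding T_def by blast
  qed
  moreover have "countable (\<Union>n. \<Union>k. T n k)" using fin by (intro countable_UN countableI_type countable_finite)
  ultimately show ?thesis by (rule countable_subset)
qed simp

end

lemma emeasure_UN_countable_le:
  assumes "countable I" "\<And>i. i \<in> I \<Longrightarrow> X i \<in> sets n"
  shows "emeasure n (\<Union>i\<in>I. X i) \<le> (\<integral>\<^sup>+i. emeasure n (X i) \<partial>count_space I)"
proof (cases "finite I")
  case True
  then show ?thesis
    using emeasure_subadditive_finite[of I X n] assms by (simp add: image_subset_iff nn_integral_count_space_finite)
next
  case False
  then obtain g :: "nat \<Rightarrow> _" where g: "bij_betw g UNIV I"
    using bij_betw_from_nat_into[OF assms(1)] by blast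
  have "emeasure n (\<Union>i\<in>I. X i) = emeasure n (\<Union>k. X (g k))"
    using g by (auto simp: bij_betw_def intro!: arg_cong[where f="emeasure n"])
  also have "\<dots> \<le> (\<Sum>k. emeasure n (X (g k)))"
    using assms g by (intro emeasure_subadditive_countably) (auto simp: bij_betw_def)
  also have "\<dots> = (\<integral>\<^sup>+k. emeasure n (X (g k)) \<partial>count_space UNIV)"
    by (simp add: nn_integral_count_space_nat)
  also have "\<dots> = (\<integral>\<^sup>+i. emeasure n (X i) \<partial>count_space I)"
    using g by (rule nn_integral_bij_count_space)
  finally show ?thesis .
qed

text \<open>
  The way in which coverings are exploited: an inequality on each of the disjoint balls sums up
  to an inequality for the union of the enlarged balls.
\<close>

lemma vitali_compare:
  assumes S: "countable S" and disj: "disjoint_family_on (\<lambda>x. mball x (r x)) S"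
    and m: "sets m = sets (borel_of mtopology)" and n: "sets n = sets (borel_of mtopology)"
    and G: "G \<in> sets n"
    and le: "\<And>x. x \<in> S \<Longrightarrow> emeasure m (mball x (5 * r x)) \<le> K * emeasure n (G \<inter> mball x (r x))"
  shows "emeasure m (\<Union>x\<in>S. mball x (5 * r x)) \<le> K * emeasure n G"
proof -
  have "emeasure m (\<Union>x\<in>S. mball x (5 * r x)) \<le> (\<integral>\<^sup>+x. emeasure m (mball x (5 * r x)) \<partial>count_space S)"
    using S by (intro emeasure_UN_countable_le) (auto simp: m)
  also have "\<dots> \<le> (\<integral>\<^sup>+x. K * emeasure n (G \<inter> mball x (r x)) \<partial>count_space S)"
    using le by (intro nn_integral_mono) auto
  also have "\<dots> = K * (\<integral>\<^sup>+x. emeasure n (G \<inter> mball x (r x)) \<partial>count_space S)"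
    by (rule nn_integral_cmult) simp
  also have "(\<integral>\<^sup>+x. emeasure n (G \<inter> mball x (r x)) \<partial>count_space S) = emeasure n (\<Union>x\<in>S. G \<inter> mball x (r x))"
    using S G disj by (intro emeasure_UN_countable[symmetric])
      (auto simp: n disjoint_family_on_def)
  also have "K * \<dots> \<le> K * emeasure n G"
    using G by (intro mult_left_mono emeasure_mono) auto
  finally show ?thesis .
qed

end

section \<open>Self-improvement of the comparison of two doubling measures\<close>

context Metric_space
begin

definition outer_regular :: "'a measure \<Rightarrow> bool" where
  "outer_regular m \<longleftrightarrow> (\<forall>E\<in>sets (borel_of mtopology).
     emeasure m E = (INF U\<in>{U. openin mtopology U \<and> E \<subseteq> U}. emeasure m U))"

lemma outer_regular_open:
  assumes m: "doubling_borel C m" "outer_regular m"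
    and E: "E \<in> sets (borel_of mtopology)" "E \<subseteq> mball x r" and t: "measure m E < t"
  shows "\<exists>U. openin mtopology U \<and> E \<subseteq> U \<and> U \<subseteq> mball x r \<and> measure m U < t"
proof -
  have "(INF U\<in>{U. openin mtopology U \<and> E \<subseteq> U}. emeasure m U) < ennreal t"
    using m(2) E t doubling_emeasure[OF m(1) E(2)] unfolding outer_regular_def
    by (metis ennreal_less_iff measure_nonneg)
  then obtain U where U: "openin mtopology U" "E \<subseteq> U" "emeasure m U < ennreal t"
    by (auto simp: INF_less_iff)
  have "emeasure m (U \<inter> mball x r) \<le> emeasure m U"
    using U doubling_sets[OF m(1)] by (intro emeasure_mono) (auto intro: openin_imp_borel)
  then have "emeasure m (U \<inter> mball x r) < ennreal t" using U by simp
  then have "measure m (U \<inter> mball x r) < t"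
    using doubling_emeasure[OF m(1), of "U \<inter> mball x r" x r] by (simp add: ennreal_less_iff)
  with U E show ?thesis
    by (intro exI[of _ "U \<inter> mball x r"]) auto
qed

text \<open>
  For \<open>x \<in> E\<close> halve the radius \<open>s\<close> until the density of \<open>E\<close> for \<open>m1\<close> exceeds \<open>a\<close>, and go back one step: on this
  ball the density is at most \<open>a\<close>, but on the ball of half the radius it is more than \<open>a\<close>.
  The first property and the hypothesis show that \<open>E\<close> misses a fixed proportion of the \<open>m2\<close>-measure of
  the ball, the second that the ball is not much larger than \<open>E\<close> for \<open>m1\<close>.  Let \<open>E'\<close> be the union of a
  Vitali covering by such balls.
\<close>

lemma covering_step:
  fixes a b s :: real
  assumes m1: "doubling_borel C m1" and m2: "doubling_borel C m2"
    and a: "0 < a" "a < 1" and b: "b < 1" and s: "0 < s" and x0: "x0 \<in> M"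
    and H: "\<And>x r F. x \<in> M \<Longrightarrow> 0 < r \<Longrightarrow> r \<le> s \<Longrightarrow> openin mtopology F \<Longrightarrow>
       measure m1 (F \<inter> mball x r) \<le> a * measure m1 (mball x r) \<Longrightarrow>
       measure m2 (F \<inter> mball x r) \<le> b * measure m2 (mball x r)"
    and E: "openin mtopology E" "E \<subseteq> mball x0 R"
    and small: "\<And>x. x \<in> E \<Longrightarrow> measure m1 (E \<inter> mball x s) \<le> a * measure m1 (mball x s)"
  shows "\<exists>E'. openin mtopology E' \<and> E' \<subseteq> mball x0 (R + 5 * s) \<and>
     measure m1 E' \<le> C ^ 4 / a * measure m1 E \<and> measure m2 E \<le> (1 - (1 - b) / C ^ 3) * measure m2 E'"
proof -
  have C: "1 \<le> C" using doubling_const_ge_1[OF m1 x0] .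
  note sets1 = doubling_sets[OF m1] and sets2 = doubling_sets[OF m2]
  have EM: "E \<subseteq> M" using E by auto
  have Eb: "E \<in> sets (borel_of mtopology)" using E openin_imp_borel by blast
  have radius: "\<exists>r. 0 < r \<and> r \<le> s \<and> measure m1 (E \<inter> mball x r) \<le> a * measure m1 (mball x r) \<and>
      a * measure m1 (mball x (r / 2)) < measure m1 (E \<inter> mball x (r / 2))" if x: "x \<in> E" for x
  proof -
    define P where "P j \<longleftrightarrow> a * measure m1 (mball x (s / 2 ^ j)) < measure m1 (E \<inter> mball x (s / 2 ^ j))" for j :: nat
    obtain r where r: "r > 0" "mball x r \<subseteq> E" using E(1) x unfolding openin_mtopology by blast
    obtain j where "(1/2) ^ j < r / s"
      using real_arch_pow_inv[of "r / s" "1/2"] r s by auto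
    then have j: "s / 2 ^ j < r" using s by (simp add: field_simps power_divide)
    have xM: "x \<in> M" using x EM by blast
    have "E \<inter> mball x (s / 2 ^ j) = mball x (s / 2 ^ j)"
      using r j mball_subset_concentric[of "s / 2 ^ j" r x] by auto
    moreover have "0 < measure m1 (mball x (s / 2 ^ j))"
      using doubling_pos[OF m1 xM] s by simp
    ultimately have Pj: "P j" unfolding P_def using a by simp
    define k where "k = (LEAST j. P j)"
    have Pk: "P k" unfolding k_def using Pj by (rule LeastI)
    have "\<not> P 0" using small[OF x] by (simp add: P_def)
    then have "k \<noteq> 0" using Pk by metis
    then obtain i where i: "k = Suc i" using not0_implies_Suc by blast
    then have "\<not> P i" using not_less_Least[of i P] unfolding k_def by simp
    then show ?thesis
      using Pk s unfolding P_def i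
      by (intro exI[of _ "s / 2 ^ i"]) (auto simp: field_simps not_less)
  qed
  define r where "r x = (SOME r. 0 < r \<and> r \<le> s \<and> measure m1 (E \<inter> mball x r) \<le> a * measure m1 (mball x r) \<and>
      a * measure m1 (mball x (r / 2)) < measure m1 (E \<inter> mball x (r / 2)))" for x
  have r: "0 < r x" "r x \<le> s" "measure m1 (E \<inter> mball x (r x)) \<le> a * measure m1 (mball x (r x))"
    "a * measure m1 (mball x (r x / 2)) < measure m1 (E \<inter> mball x (r x / 2))" if "x \<in> E" for x
    using someI_ex[OF radius[OF that], folded r_def] by auto
  obtain S where S: "S \<subseteq> E" and disj: "disjoint_family_on (\<lambda>x. mball x (r x)) S"
    and cover: "E \<subseteq> (\<Union>x\<in>S. mball x (5 * r x))"
    using vitali_disjoint_selection[OF EM, of r s] r by blast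
  have cS: "countable S"
    using disjoint_balls_countable[OF m1, of S r] S EM r disj by blast
  define E' where "E' = (\<Union>x\<in>S. mball x (5 * r x))"
  have E'o: "openin mtopology E'" unfolding E'_def by blast
  then have E'b: "E' \<in> sets (borel_of mtopology)" using openin_imp_borel by blast
  have E'sub: "E' \<subseteq> mball x0 (R + 5 * s)"
    unfolding E'_def
  proof (rule UN_least)
    fix x assume "x \<in> S"
    then have "d x0 x < R" "x \<in> M" "r x \<le> s" using S E r by auto
    then show "mball x (5 * r x) \<subseteq> mball x0 (R + 5 * s)"
      using x0 by (intro mball_subset) (auto simp: commute)
  qed
  have Esub: "E \<subseteq> mball x0 (R + 5 * s)" using E s by auto
  have "emeasure m1 E' \<le> ennreal (C ^ 4 / a) * emeasure m1 E"
    unfolding E'_def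
  proof (rule vitali_compare[OF cS disj sets1 sets1])
    show "E \<in> sets m1" using Eb sets1 by simp
    fix x assume "x \<in> S"
    then have x: "x \<in> E" "x \<in> M" using S EM by auto
    have "measure m1 (mball x (5 * r x)) \<le> C ^ 4 * measure m1 (mball x (r x / 2))"
      using r[OF x(1)] x by (intro doubling_engulf[OF m1]) auto
    also have "\<dots> \<le> C ^ 4 * (measure m1 (E \<inter> mball x (r x / 2)) / a)"
      using r[OF x(1)] C a by (intro mult_left_mono) (auto simp: field_simps)
    also have "\<dots> \<le> C ^ 4 * (measure m1 (E \<inter> mball x (r x)) / a)"
    proof (intro mult_left_mono divide_right_mono doubling_mono[OF m1, of _ _ x "r x"])
      show "E \<inter> mball x (r x / 2) \<subseteq> E \<inter> mball x (r x)" using r[OF x(1)] by auto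
    qed (use Eb sets1 a C in auto)
    finally have "ennreal (measure m1 (mball x (5 * r x))) \<le> ennreal (C ^ 4 / a * measure m1 (E \<inter> mball x (r x)))"
      by (intro ennreal_leI) (simp add: mult.assoc)
    then show "emeasure m1 (mball x (5 * r x)) \<le> ennreal (C ^ 4 / a) * emeasure m1 (E \<inter> mball x (r x))"
      using C a by (simp add: doubling_emeasure[OF m1, of _ x "5 * r x"] ennreal_mult[symmetric]
          doubling_emeasure[OF m1, of _ x "r x"])
  qed
  then have 1: "measure m1 E' \<le> C ^ 4 / a * measure m1 E"
    using C a by (simp add: doubling_emeasure[OF m1 E'sub] doubling_emeasure[OF m1 Esub]
        ennreal_mult[symmetric] ennreal_le_iff)
  have "emeasure m2 E' \<le> ennreal (C ^ 3 / (1 - b)) * emeasure m2 (E' - E)"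
    unfolding E'_def
  proof (rule vitali_compare[OF cS disj sets2 sets2])
    show "(\<Union>x\<in>S. mball x (5 * r x)) - E \<in> sets m2" using Eb E'b sets2 unfolding E'_def by auto
    fix x assume xS: "x \<in> S"
    then have x: "x \<in> E" "x \<in> M" using S EM by auto
    have sub: "mball x (r x) \<subseteq> E'" unfolding E'_def using xS r[OF x(1)] mball_subset_concentric[of "r x" "5 * r x" x] by auto
    have "measure m2 (E \<inter> mball x (r x)) \<le> b * measure m2 (mball x (r x))"
      using H x r[OF x(1)] E by blast
    moreover have "measure m2 (mball x (r x) - E \<inter> mball x (r x)) = measure m2 (mball x (r x)) - measure m2 (E \<inter> mball x (r x))"
      using doubling_finite[OF m2, of "mball x (r x)" x "r x"] Eb sets2
      by (intro measure_Diff) (auto simp: less_top)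
    moreover have "mball x (r x) - E \<inter> mball x (r x) = (E' - E) \<inter> mball x (r x)" using sub by auto
    ultimately have "(1 - b) * measure m2 (mball x (r x)) \<le> measure m2 ((E' - E) \<inter> mball x (r x))"
      by (simp add: algebra_simps)
    then have "measure m2 (mball x (r x)) \<le> measure m2 ((E' - E) \<inter> mball x (r x)) / (1 - b)"
      using b by (simp add: field_simps)
    then have "C ^ 3 * measure m2 (mball x (r x)) \<le> C ^ 3 * (measure m2 ((E' - E) \<inter> mball x (r x)) / (1 - b))"
      using C by (intro mult_left_mono) auto
    moreover have "measure m2 (mball x (5 * r x)) \<le> C ^ 3 * measure m2 (mball x (r x))"
      using r[OF x(1)] x by (intro doubling_engulf[OF m2]) auto
    ultimately have "measure m2 (mball x (5 * r x)) \<le> C ^ 3 / (1 - b) * measure m2 ((E' - E) \<inter> mball x (r x))"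
      by simp
    then have "ennreal (measure m2 (mball x (5 * r x))) \<le> ennreal (C ^ 3 / (1 - b) * measure m2 ((E' - E) \<inter> mball x (r x)))"
      by (intro ennreal_leI)
    then show "emeasure m2 (mball x (5 * r x)) \<le> ennreal (C ^ 3 / (1 - b)) *
        emeasure m2 (((\<Union>x\<in>S. mball x (5 * r x)) - E) \<inter> mball x (r x))"
      unfolding E'_def[symmetric]
      using C b by (simp add: doubling_emeasure[OF m2, of _ x "5 * r x"] ennreal_mult[symmetric]
          doubling_emeasure[OF m2, of _ x "r x"])
  qed
  moreover have "E' - E \<subseteq> mball x0 (R + 5 * s)" using E'sub by blast
  ultimately have "measure m2 E' \<le> C ^ 3 / (1 - b) * measure m2 (E' - E)"
    using C b by (simp add: doubling_emeasure[OF m2 E'sub] doubling_emeasure[OF m2, of "E' - E"]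
        ennreal_mult[symmetric] ennreal_le_iff)
  also have "measure m2 (E' - E) = measure m2 E' - measure m2 E"
    using doubling_finite[OF m2 E'sub] Eb E'b sets2 cover
    by (intro measure_Diff) (auto simp: less_top E'_def)
  finally have "(1 - b) * measure m2 E' \<le> C ^ 3 * (measure m2 E' - measure m2 E)"
    using b by (simp add: field_simps)
  then have "(1 - b) / C ^ 3 * measure m2 E' \<le> measure m2 E' - measure m2 E"
    using C by (simp add: field_simps)
  then have "measure m2 E \<le> (1 - (1 - b) / C ^ 3) * measure m2 E'"
    by (simp add: algebra_simps)
  with 1 E'o E'sub show ?thesis by blast
qed

lemma covering_iteration:
  fixes a b s :: real
  assumes m1: "doubling_borel C m1" and m2: "doubling_borel C m2"
    and a: "0 < a" "a < 1" and b: "0 \<le> b" "b < 1" and s: "0 < s" and x0: "x0 \<in> M"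
    and H: "\<And>x r F. x \<in> M \<Longrightarrow> 0 < r \<Longrightarrow> r \<le> s \<Longrightarrow> openin mtopology F \<Longrightarrow>
       measure m1 (F \<inter> mball x r) \<le> a * measure m1 (mball x r) \<Longrightarrow>
       measure m2 (F \<inter> mball x r) \<le> b * measure m2 (mball x r)"
    and E: "openin mtopology E" "E \<subseteq> mball x0 R"
    and N: "real N * (5 * s) \<le> R"
    and small: "\<And>x. x \<in> mball x0 (2 * R) \<Longrightarrow> (C ^ 4 / a) ^ N * measure m1 E \<le> a * measure m1 (mball x s)"
  shows "measure m2 E \<le> (1 - (1 - b) / C ^ 3) ^ N * measure m2 (mball x0 (2 * R))"
proof -
  have C: "1 \<le> C" using doubling_const_ge_1[OF m1 x0] .
  define c where "c = 1 - (1 - b) / C ^ 3"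
  have "1 - b \<le> C ^ 3" using b one_le_power[OF C, of 3] by linarith
  then have c: "0 \<le> c" using C by (simp add: c_def)
  define K where "K = C ^ 4 / a"
  have "a \<le> C ^ 4" using a one_le_power[OF C, of 4] by linarith
  then have K: "1 \<le> K" unfolding K_def using a by simp
  have "k \<le> N \<Longrightarrow> \<exists>E'. openin mtopology E' \<and> E' \<subseteq> mball x0 (R + real k * (5 * s)) \<and>
     measure m1 E' \<le> K ^ k * measure m1 E \<and> measure m2 E \<le> c ^ k * measure m2 E'" for k
  proof (induction k)
    case 0
    then show ?case using E by (intro exI[of _ E]) auto
  next
    case (Suc k)
    then obtain F where F: "openin mtopology F" "F \<subseteq> mball x0 (R + real k * (5 * s))"
      "measure m1 F \<le> K ^ k * measure m1 E" "measure m2 E \<le> c ^ k * measure m2 F" by auto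
    have kN: "real k * (5 * s) \<le> real N * (5 * s)" using Suc s by (intro mult_right_mono) auto
    have "\<exists>E'. openin mtopology E' \<and> E' \<subseteq> mball x0 (R + real k * (5 * s) + 5 * s) \<and>
     measure m1 E' \<le> C ^ 4 / a * measure m1 F \<and> measure m2 F \<le> (1 - (1 - b) / C ^ 3) * measure m2 E'"
    proof (rule covering_step[OF m1 m2 a b(2) s x0 H F(1,2)])
      fix x assume x: "x \<in> F"
      then have xM: "x \<in> mball x0 (2 * R)" using F(2) kN N by auto
      have "measure m1 (F \<inter> mball x s) \<le> measure m1 F"
        using F openin_imp_borel[OF F(1)] by (intro doubling_mono[OF m1 _ F(2)]) (auto simp: doubling_sets[OF m1])
      also have "\<dots> \<le> K ^ k * measure m1 E" by fact
      also have "\<dots> \<le> K ^ N * measure m1 E"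
        using K Suc by (intro mult_right_mono power_increasing) auto
      also have "\<dots> \<le> a * measure m1 (mball x s)" using small[OF xM] by (simp add: K_def)
      finally show "measure m1 (F \<inter> mball x s) \<le> a * measure m1 (mball x s)" .
    qed auto
    then obtain E' where E': "openin mtopology E'" "E' \<subseteq> mball x0 (R + real k * (5 * s) + 5 * s)"
      "measure m1 E' \<le> K * measure m1 F" "measure m2 F \<le> c * measure m2 E'"
      unfolding K_def c_def by blast
    have "K * measure m1 F \<le> K * (K ^ k * measure m1 E)" using F K by (intro mult_left_mono) auto
    moreover have "c ^ k * measure m2 F \<le> c ^ k * (c * measure m2 E')" using E' c by (intro mult_left_mono) auto
    moreover have "R + real k * (5 * s) + 5 * s = R + real (Suc k) * (5 * s)" by (simp add: algebra_simps)
    ultimately show ?case using E' F(4) by (intro exI[of _ E']) (auto simp: algebra_simps)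
  qed
  from this[of N] obtain E' where E': "openin mtopology E'" "E' \<subseteq> mball x0 (R + real N * (5 * s))"
      "measure m2 E \<le> c ^ N * measure m2 E'" by auto
  have "measure m2 E' \<le> measure m2 (mball x0 (2 * R))"
    using E'(2) N by (intro doubling_mono[OF m2, of _ _ x0 "2 * R"]) (auto simp: doubling_sets[OF m2])
  then have "c ^ N * measure m2 E' \<le> c ^ N * measure m2 (mball x0 (2 * R))"
    using c by (intro mult_left_mono) auto
  then show ?thesis using E' unfolding c_def by linarith
qed

text \<open>
  The covering step is applied \<open>N\<close> times at the fixed scale \<open>R / 2 ^ (N + 3)\<close>.  The sets then stay in the ball
  of twice the radius, and the smallness of \<open>E\<close> guarantees that even after \<open>N\<close> enlargements the density is
  at most \<open>a\<close> in each ball of this scale.  Only balls with radius at most \<open>s\<close> occur, so the comparison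
  is required for these balls only.
\<close>

lemma A_infinity_decay:
  fixes a b s :: real
  assumes m1: "doubling_borel C m1" and m2: "doubling_borel C m2" and reg: "outer_regular m1"
    and a: "0 < a" "a < 1" and b: "0 \<le> b" "b < 1" and x0: "x0 \<in> M" and R: "0 < R" "R \<le> 8 * s"
    and H: "\<And>x r F. x \<in> M \<Longrightarrow> 0 < r \<Longrightarrow> r \<le> s \<Longrightarrow> openin mtopology F \<Longrightarrow>
       measure m1 (F \<inter> mball x r) \<le> a * measure m1 (mball x r) \<Longrightarrow>
       measure m2 (F \<inter> mball x r) \<le> b * measure m2 (mball x r)"
    and E: "E \<in> sets (borel_of mtopology)" "E \<subseteq> mball x0 R"
    and small: "measure m1 E < (a / C ^ 5) ^ Suc N * measure m1 (mball x0 R)"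
  shows "measure m2 E \<le> C * (1 - (1 - b) / C ^ 3) ^ N * measure m2 (mball x0 R)"
proof -
  have C: "1 \<le> C" using doubling_const_ge_1[OF m1 x0] .
  have "1 - b \<le> C ^ 3" using b one_le_power[OF C, of 3] by linarith
  then have c: "0 \<le> 1 - (1 - b) / C ^ 3" using C by simp
  obtain U where U: "openin mtopology U" "E \<subseteq> U" "U \<subseteq> mball x0 R"
    and mU: "measure m1 U < (a / C ^ 5) ^ Suc N * measure m1 (mball x0 R)"
    using outer_regular_open[OF m1 reg E small] by blast
  \<comment> \<open>\<open>5 * N * t \<le> R\<close> keeps \<open>N\<close> enlargements by \<open>5 * t\<close> inside the ball of radius \<open>2 * R\<close>, and
    \<open>t \<le> R / 8\<close> makes the comparison available.\<close>
  define t where "t = R / 2 ^ (N + 3)"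
  have t: "0 < t" using R by (simp add: t_def)
  have "R / 2 ^ (N + 3) \<le> R / 2 ^ 3"
    using R by (intro divide_left_mono power_increasing) auto
  moreover have "R / 2 ^ 3 \<le> s" using R by simp
  ultimately have ts: "t \<le> s" unfolding t_def by linarith
  have tR: "2 ^ (N + 5) * t = 4 * R" unfolding t_def by (simp add: power_add)
  have "real N \<le> 2 ^ N" using of_nat_less_two_power[of N, where ?'a=real] by simp
  then have "real N * 5 \<le> 8 * 2 ^ N" using zero_le_power[of "2::real" N] by linarith
  then have "R * (real N * 5) \<le> R * (8 * 2 ^ N)" using R by (intro mult_left_mono) auto
  then have N: "real N * (5 * t) \<le> R"
    unfolding t_def by (simp add: power_add field_simps)
  have "measure m2 U \<le> (1 - (1 - b) / C ^ 3) ^ N * measure m2 (mball x0 (2 * R))"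
  proof (rule covering_iteration[OF m1 m2 a b t x0 _ U(1,3) N])
    fix x assume x: "x \<in> mball x0 (2 * R)"
    have "mball x0 R \<subseteq> mball x (2 ^ (N + 5) * t)"
      unfolding tR using x R by (intro mball_subset) (auto simp: commute)
    then have "measure m1 (mball x0 R) \<le> C ^ (N + 5) * measure m1 (mball x t)"
      using x t by (intro doubling_engulf[OF m1]) auto
    then have "(a / C ^ 5) ^ Suc N * measure m1 (mball x0 R) \<le> (a / C ^ 5) ^ Suc N * (C ^ (N + 5) * measure m1 (mball x t))"
      using a C by (intro mult_left_mono) auto
    then have "(C ^ 4 / a) ^ N * measure m1 U \<le> (C ^ 4 / a) ^ N * ((a / C ^ 5) ^ Suc N * (C ^ (N + 5) * measure m1 (mball x t)))"
      using mU a C by (intro mult_left_mono) auto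
    also have "\<dots> = a * measure m1 (mball x t)"
    proof -
      have "(C ^ 4 / a) ^ N * (a / C ^ 5) ^ N * C ^ N = ((C ^ 4 / a) * (a / C ^ 5) * C) ^ N"
        by (simp only: power_mult_distrib)
      also have "(C ^ 4 / a) * (a / C ^ 5) * C = 1" using a C by (simp add: field_simps eval_nat_numeral)
      finally have "(C ^ 4 / a) ^ N * (a / C ^ 5) ^ N * C ^ N = 1" by simp
      moreover have "(C ^ 4 / a) ^ N * ((a / C ^ 5) ^ Suc N * (C ^ (N + 5) * measure m1 (mball x t)))
        = ((C ^ 4 / a) ^ N * (a / C ^ 5) ^ N * C ^ N) * ((a / C ^ 5) * C ^ 5 * measure m1 (mball x t))"
        by (simp add: power_add algebra_simps)
      moreover have "(a / C ^ 5) * C ^ 5 = a" using C by simp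
      ultimately show ?thesis by simp
    qed
    finally show "(C ^ 4 / a) ^ N * measure m1 U \<le> a * measure m1 (mball x t)" .
  qed (use H ts in auto)
  also have "\<dots> \<le> (1 - (1 - b) / C ^ 3) ^ N * (C * measure m2 (mball x0 R))"
    using c C doubling_real[OF m2 x0 R(1)] by (intro mult_left_mono) auto
  finally have "measure m2 U \<le> C * (1 - (1 - b) / C ^ 3) ^ N * measure m2 (mball x0 R)"
    by (simp add: algebra_simps)
  moreover have "measure m2 E \<le> measure m2 U"
    using U openin_imp_borel[OF U(1)] by (intro doubling_mono[OF m2 U(2,3)]) (auto simp: doubling_sets[OF m2])
  ultimately show ?thesis by linarith
qed

end

section \<open>Arc length parametrisation and very weak gradients\<close>

context Metric_space
begin

text \<open>
  A chain of points up to time \<open>s\<close> extended by the two points at times \<open>s\<close> and \<open>t\<close> is at least longer by the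
  distance between the latter.
\<close>

lemma curve_length_increment:
  assumes "0 \<le> s" "s \<le> t"
  shows "curve_length d \<gamma> s + ennreal (d (\<gamma> s) (\<gamma> t)) \<le> curve_length d \<gamma> t"
proof -
  have "{ts. sorted ts \<and> set ts \<subseteq> {0..s}} \<noteq> {}" by (auto intro: exI[of _ "[]"])
  then have "curve_length d \<gamma> s + ennreal (d (\<gamma> s) (\<gamma> t)) =
    (SUP ts\<in>{ts. sorted ts \<and> set ts \<subseteq> {0..s}}.
        ennreal (\<Sum>i<length ts - 1. d (\<gamma> (ts ! i)) (\<gamma> (ts ! Suc i))) + ennreal (d (\<gamma> s) (\<gamma> t)))"
    unfolding curve_length_def by (rule ennreal_SUP_add_left[symmetric])
  also have "\<dots> \<le> curve_length d \<gamma> t"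
  proof (rule SUP_least)
    fix ts assume "ts \<in> {ts. sorted ts \<and> set ts \<subseteq> {0..s}}"
    then have ts: "sorted ts" "set ts \<subseteq> {0..s}" by auto
    define us where "us = ts @ [s, t]"
    have us: "sorted us" "set us \<subseteq> {0..t}"
      using ts assms unfolding us_def by (auto simp: sorted_append)
    have "(\<Sum>i<length ts - 1. d (\<gamma> (ts ! i)) (\<gamma> (ts ! Suc i))) = (\<Sum>i<length ts - 1. d (\<gamma> (us ! i)) (\<gamma> (us ! Suc i)))"
      by (intro sum.cong) (auto simp: us_def nth_append)
    also have "\<dots> \<le> (\<Sum>i<length ts. d (\<gamma> (us ! i)) (\<gamma> (us ! Suc i)))"
      by (intro sum_mono2) auto
    also have "\<dots> + d (\<gamma> s) (\<gamma> t) = (\<Sum>i<length us - 1. d (\<gamma> (us ! i)) (\<gamma> (us ! Suc i)))"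
      by (simp add: us_def nth_append)
    finally have "ennreal ((\<Sum>i<length ts - 1. d (\<gamma> (ts ! i)) (\<gamma> (ts ! Suc i))) + d (\<gamma> s) (\<gamma> t))
        \<le> ennreal (\<Sum>i<length us - 1. d (\<gamma> (us ! i)) (\<gamma> (us ! Suc i)))" by (intro ennreal_leI) simp
    also have "\<dots> \<le> curve_length d \<gamma> t"
      unfolding curve_length_def using us by (intro SUP_upper) auto
    finally show "ennreal (\<Sum>i<length ts - 1. d (\<gamma> (ts ! i)) (\<gamma> (ts ! Suc i))) + ennreal (d (\<gamma> s) (\<gamma> t)) \<le> curve_length d \<gamma> t"
      by (simp add: sum_nonneg flip: ennreal_plus)
  qed
  finally show ?thesis .
qed

lemma path_continuousD:
  assumes "pathin mtopology \<gamma>" "t \<in> {0..1}" "0 < e"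
  obtains \<delta> where "0 < \<delta>" "\<And>s. s \<in> {0..1} \<Longrightarrow> \<bar>s - t\<bar> < \<delta> \<Longrightarrow> d (\<gamma> t) (\<gamma> s) < e"
proof -
  have "t \<in> topspace (top_of_set {0..1})" using assms by simp
  then obtain U where U: "openin (top_of_set {0..1}) U" "t \<in> U" "\<forall>y\<in>U. \<gamma> y \<in> mball (\<gamma> t) e"
    using assms unfolding pathin_def continuous_map_to_metric by blast
  then obtain \<delta> where "\<delta> > 0" "\<And>s. s \<in> {0..1} \<Longrightarrow> dist s t < \<delta> \<Longrightarrow> s \<in> U"
    unfolding openin_euclidean_subtopology_iff by blast
  with U show ?thesis by (intro that[of \<delta>]) (auto simp: dist_real_def)
qed

context
  fixes \<gamma> :: "real \<Rightarrow> 'a" and L :: real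
  assumes path: "pathin mtopology \<gamma>" and rect: "rectifiable_curve d \<gamma>"
    and L: "L = enn2real (curve_length d \<gamma> 1)"
begin

lemma length_eq: "curve_length d \<gamma> 1 = ennreal L"
  using rect unfolding rectifiable_curve_def L by (simp add: less_top)

lemma path_in_space: "t \<in> {0..1} \<Longrightarrow> \<gamma> t \<in> M"
  using path unfolding pathin_def continuous_map_def by auto

text \<open>
  The parameter at which \<open>arc_length_param\<close> evaluates the curve.
\<close>

definition hit where "hit l = Inf {t \<in> {0..1}. ennreal l \<le> curve_length d \<gamma> t}"

lemma arc_length_param_hit: "arc_length_param d \<gamma> l = \<gamma> (hit l)"
  by (simp add: arc_length_param_def hit_def)

context
  fixes l assumes l: "l \<le> L"
begin

lemma one_reaches: "1 \<in> {t \<in> {0..1}. ennreal l \<le> curve_length d \<gamma> t}"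
  using l by (simp add: length_eq ennreal_leI)

lemma hit_in: "hit l \<in> {0..1}"
  unfolding hit_def using one_reaches
  by (auto intro!: cInf_greatest cInf_lower2[of 1] bdd_belowI[of _ 0])

lemma hit_approx:
  assumes "hit l < t"
  obtains s where "s \<in> {0..1}" "ennreal l \<le> curve_length d \<gamma> s" "hit l \<le> s" "s < t"
proof -
  let ?T = "{t \<in> {0..1}. ennreal l \<le> curve_length d \<gamma> t}"
  have ne: "?T \<noteq> {}" using one_reaches by blast
  obtain s where s: "s \<in> ?T" "s < t" using cInf_lessD[OF ne] assms unfolding hit_def by blast
  moreover have "hit l \<le> s" unfolding hit_def by (rule cInf_lower[OF s(1)]) (auto intro!: bdd_belowI[of _ 0])
  ultimately show ?thesis using that by blast
qed

lemma before_hit: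
  assumes "t \<in> {0..1}" "t < hit l"
  shows "curve_length d \<gamma> t < ennreal l"
proof (rule ccontr)
  assume "\<not> curve_length d \<gamma> t < ennreal l"
  then have "hit l \<le> t" unfolding hit_def using assms
    by (intro cInf_lower) (auto intro!: bdd_belowI[of _ 0])
  then show False using assms by simp
qed

end

lemma arc_length_param_in:
  assumes "l \<le> L" shows "\<exists>t\<in>{0..1}. arc_length_param d \<gamma> l = \<gamma> t"
  using hit_in[OF assms] arc_length_param_hit by blast

text \<open>
  Immediately before the hitting time of \<open>l'\<close> the length is below \<open>l'\<close>, and at times arbitrarily close to the
  hitting time of \<open>l\<close> it is at least \<open>l\<close>.  The chord between two such times is at most \<open>l' - l\<close>, and
  continuity of the curve carries this over to the hitting times.
\<close>

lemma arc_length_param_lipschitz: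
  assumes l: "0 \<le> l" "l \<le> l'" "l' \<le> L"
  shows "d (arc_length_param d \<gamma> l) (arc_length_param d \<gamma> l') \<le> l' - l"
proof -
  have lL: "l \<le> L" using l by simp
  have mono: "hit l \<le> hit l'"
    unfolding hit_def
  proof (rule cInf_superset_mono)
    show "{t \<in> {0..1}. ennreal l' \<le> curve_length d \<gamma> t} \<noteq> {}" using one_reaches[OF l(3)] by blast
    show "{t \<in> {0..1}. ennreal l' \<le> curve_length d \<gamma> t} \<subseteq> {t \<in> {0..1}. ennreal l \<le> curve_length d \<gamma> t}"
      using ennreal_leI[OF l(2)] by (auto intro: order_trans)
  qed (auto intro!: bdd_belowI[of _ 0])
  have M: "\<gamma> (hit l) \<in> M" "\<gamma> (hit l') \<in> M" using path_in_space hit_in l lL by blast+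
  show ?thesis
  proof (cases "hit l = hit l'")
    case True
    then show ?thesis using M l by (simp add: arc_length_param_hit)
  next
    case False
    then have lt: "hit l < hit l'" using mono by simp
    have "d (\<gamma> (hit l)) (\<gamma> (hit l')) \<le> l' - l + e" if e: "e > 0" for e
    proof -
      obtain \<delta>1 where \<delta>1: "0 < \<delta>1" "\<And>s. s \<in> {0..1} \<Longrightarrow> \<bar>s - hit l\<bar> < \<delta>1 \<Longrightarrow> d (\<gamma> (hit l)) (\<gamma> s) < e/2"
        using path_continuousD[OF path hit_in[OF lL], of "e/2"] e by auto
      obtain \<delta>2 where \<delta>2: "0 < \<delta>2" "\<And>s. s \<in> {0..1} \<Longrightarrow> \<bar>s - hit l'\<bar> < \<delta>2 \<Longrightarrow> d (\<gamma> (hit l')) (\<gamma> s) < e/2"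
        using path_continuousD[OF path hit_in[OF l(3)], of "e/2"] e by auto
      have "hit l < min (hit l') (hit l + \<delta>1)" using lt \<delta>1 by simp
      then obtain s where s: "s \<in> {0..1}" "ennreal l \<le> curve_length d \<gamma> s" "hit l \<le> s" "s < hit l'" "s < hit l + \<delta>1"
        using hit_approx[OF lL, of "min (hit l') (hit l + \<delta>1)"] by auto
      define t where "t = max s (hit l' - \<delta>2 / 2)"
      have t: "t \<in> {0..1}" "t < hit l'" "\<bar>t - hit l'\<bar> < \<delta>2" "s \<le> t"
        using s hit_in[OF l(3)] \<delta>2(1) unfolding t_def by auto
      have "ennreal l + ennreal (d (\<gamma> s) (\<gamma> t)) \<le> curve_length d \<gamma> s + ennreal (d (\<gamma> s) (\<gamma> t))"
        using s by (intro add_right_mono)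
      also have "\<dots> \<le> curve_length d \<gamma> t" using s t by (intro curve_length_increment) auto
      also have "\<dots> \<le> ennreal l'" using before_hit[OF l(3) t(1,2)] by simp
      finally have "l + d (\<gamma> s) (\<gamma> t) \<le> l'" using l by (simp add: ennreal_le_iff flip: ennreal_plus)
      moreover have "d (\<gamma> (hit l)) (\<gamma> s) < e/2" using \<delta>1 s by auto
      moreover have "d (\<gamma> (hit l')) (\<gamma> t) < e/2" using \<delta>2 t by auto
      moreover have "\<gamma> s \<in> M" "\<gamma> t \<in> M" using path_in_space s(1) t(1) by auto
      then have "d (\<gamma> (hit l)) (\<gamma> (hit l')) \<le> d (\<gamma> (hit l)) (\<gamma> s) + d (\<gamma> s) (\<gamma> (hit l'))"
        "d (\<gamma> s) (\<gamma> (hit l')) \<le> d (\<gamma> s) (\<gamma> t) + d (\<gamma> (hit l')) (\<gamma> t)"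
        using M by (auto intro: triangle triangle')
      ultimately show ?thesis by linarith
    qed
    then show ?thesis by (simp add: arc_length_param_hit field_le_epsilon)
  qed
qed

lemma arc_length_param_start: "arc_length_param d \<gamma> 0 = \<gamma> 0"
proof -
  have "hit 0 = 0"
    unfolding hit_def by (intro cInf_eq_minimum) auto
  then show ?thesis by (simp add: arc_length_param_hit)
qed

lemma arc_length_param_end: "arc_length_param d \<gamma> L = \<gamma> 1"
proof -
  have h: "hit L \<in> {0..1}" using hit_in by blast
  have M: "\<gamma> (hit L) \<in> M" "\<gamma> 1 \<in> M" using path_in_space h by auto
  have "d (\<gamma> (hit L)) (\<gamma> 1) \<le> 0 + e" if e: "e > 0" for e
  proof -
    obtain \<delta> where \<delta>: "0 < \<delta>" "\<And>s. s \<in> {0..1} \<Longrightarrow> \<bar>s - hit L\<bar> < \<delta> \<Longrightarrow> d (\<gamma> (hit L)) (\<gamma> s) < e"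
      using path_continuousD[OF path h e] by blast
    have "hit L < hit L + \<delta>" using \<delta> by simp
    then obtain s where s: "s \<in> {0..1}" "ennreal L \<le> curve_length d \<gamma> s" "hit L \<le> s" "s < hit L + \<delta>"
      using hit_approx[of L "hit L + \<delta>"] by auto
    have "ennreal L + ennreal (d (\<gamma> s) (\<gamma> 1)) \<le> curve_length d \<gamma> s + ennreal (d (\<gamma> s) (\<gamma> 1))"
      using s by (intro add_right_mono)
    also have "\<dots> \<le> ennreal L" using curve_length_increment[of s 1 \<gamma>] s by (simp add: length_eq)
    finally have "L + d (\<gamma> s) (\<gamma> 1) \<le> L" unfolding L by (simp add: ennreal_le_iff flip: ennreal_plus)
    moreover have "d (\<gamma> (hit L)) (\<gamma> s) < e" using \<delta> s by auto
    moreover have "d (\<gamma> (hit L)) (\<gamma> 1) \<le> d (\<gamma> (hit L)) (\<gamma> s) + d (\<gamma> s) (\<gamma> 1)"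
      using M path_in_space s triangle by blast
    ultimately show ?thesis by simp
  qed
  then have "d (\<gamma> (hit L)) (\<gamma> 1) \<le> 0" by (rule field_le_epsilon)
  then have "\<gamma> (hit L) = \<gamma> 1" using M nonneg[of "\<gamma> (hit L)" "\<gamma> 1"] by (metis order_antisym zero)
  then show ?thesis by (simp add: arc_length_param_hit)
qed

text \<open>
  Cut the arc length interval into pieces shorter than \<open>\<delta>\<close>.  Comparing both ends of a piece with
  an arbitrary point \<open>c\<close> in between bounds the oscillation on the piece by its length times \<open>G\<close> at \<open>c\<close>.  Hence a
  step function whose integral is the sum of the oscillations lies below \<open>G\<close> along the curve.
\<close>

lemma line_integral_ge_oscillation:
  fixes u :: "'a \<Rightarrow> real" and G :: "'a \<Rightarrow> ennreal"
  assumes im: "\<And>t. t \<in> {0..1} \<Longrightarrow> \<gamma> t \<in> U" and \<delta>: "0 < \<delta>"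
    and G: "\<And>x y. x \<in> U \<Longrightarrow> y \<in> U \<Longrightarrow> d x y < \<delta> \<Longrightarrow> ennreal \<bar>u x - u y\<bar> \<le> ennreal (d x y) * G y"
  shows "ennreal \<bar>u (\<gamma> 0) - u (\<gamma> 1)\<bar> \<le> line_integral d \<gamma> G"
proof -
  define g where "g = arc_length_param d \<gamma>"
  have gU: "g l \<in> U" if "l \<le> L" for l using arc_length_param_in[OF that] im unfolding g_def by auto
  have lip: "d (g l) (g l') \<le> l' - l" if "0 \<le> l" "l \<le> l'" "l' \<le> L" for l l'
    using arc_length_param_lipschitz that unfolding g_def by blast
  have L0: "0 \<le> L" unfolding L by simp
  show ?thesis
  proof (cases "L = 0")
    case True
    then have "\<gamma> 0 = \<gamma> 1" using arc_length_param_start arc_length_param_end by simp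
    then show ?thesis by simp
  next
    case False
    with L0 have Lp: "0 < L" by simp
    obtain n :: nat where "L / \<delta> < real n" using reals_Archimedean2 by blast
    then have n0: "0 < real n" using Lp \<delta> by (smt (verit) divide_pos_pos)
    define h where "h = L / real n"
    have h: "0 < h" "h < \<delta>" using \<open>L / \<delta> < real n\<close> Lp n0 \<delta> unfolding h_def by (auto simp: field_simps)
    have hn: "real n * h = L" using n0 by (simp add: h_def)
    define a where "a i = real i * h" for i :: nat
    have a: "0 \<le> a i" "a i \<le> a (Suc i)" "a (Suc i) - a i = h" for i
      using h unfolding a_def by (auto simp: algebra_simps)
    have aL: "a i \<le> L" if "i \<le> n" for i
      unfolding a_def hn[symmetric] using that h by (intro mult_right_mono) auto
    define D where "D i = \<bar>u (g (a i)) - u (g (a (Suc i)))\<bar>" for i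
    have piece: "ennreal (D i / h) \<le> G (g c)" if i: "i < n" and c: "c \<in> {a i..<a (Suc i)}" for i c
    proof -
      have L': "a (Suc i) \<le> L" using aL i by simp
      have d1: "d (g (a i)) (g c) \<le> c - a i" using lip[of "a i" c] a[of i] c L' by simp
      have d2: "d (g (a (Suc i))) (g c) \<le> a (Suc i) - c" using lip[of c "a (Suc i)"] a[of i] c L' by (simp add: commute)
      have "ennreal (D i) \<le> ennreal (\<bar>u (g (a i)) - u (g c)\<bar> + \<bar>u (g (a (Suc i))) - u (g c)\<bar>)"
        unfolding D_def by (intro ennreal_leI) simp
      also have "\<dots> = ennreal \<bar>u (g (a i)) - u (g c)\<bar> + ennreal \<bar>u (g (a (Suc i))) - u (g c)\<bar>"
        by (rule ennreal_plus) auto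
      also have "\<dots> \<le> ennreal (d (g (a i)) (g c)) * G (g c) + ennreal (d (g (a (Suc i))) (g c)) * G (g c)"
        using d1 d2 a[of i] h c L' gU by (intro add_mono G) auto
      also have "\<dots> \<le> ennreal (c - a i) * G (g c) + ennreal (a (Suc i) - c) * G (g c)"
        using d1 d2 by (intro add_mono mult_right_mono ennreal_leI) auto
      also have "\<dots> = ennreal h * G (g c)"
        using c a(3)[of i] by (simp add: distrib_right[symmetric] ennreal_plus[symmetric] del: ennreal_plus)
      finally have "ennreal (1 / h) * ennreal (D i) \<le> ennreal (1 / h) * (ennreal h * G (g c))"
        by (rule mult_left_mono) simp
      then show ?thesis using h by (simp add: mult.assoc[symmetric] ennreal_mult[symmetric] D_def)
    qed
    have "\<bar>u (g (a 0)) - u (g (a k))\<bar> \<le> (\<Sum>i<k. D i)" for k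
      by (induction k) (auto simp: D_def)
    from this[of n] have "\<bar>u (\<gamma> 0) - u (\<gamma> 1)\<bar> \<le> (\<Sum>i<n. D i)"
      using arc_length_param_start arc_length_param_end unfolding g_def by (simp add: a_def hn)
    then have "ennreal \<bar>u (\<gamma> 0) - u (\<gamma> 1)\<bar> \<le> ennreal (\<Sum>i<n. D i)" by (rule ennreal_leI)
    also have "\<dots> = (\<Sum>i<n. ennreal (D i))" by (intro sum_ennreal[symmetric]) (auto simp: D_def)
    also have "\<dots> = (\<Sum>i<n. ennreal (D i / h) * emeasure lborel {a i..<a (Suc i)})"
      using a h by (intro sum.cong) (auto simp: ennreal_mult[symmetric] D_def)
    also have "\<dots> = (\<Sum>i<n. \<integral>\<^sup>+l. ennreal (D i / h) * indicator {a i..<a (Suc i)} l \<partial>lborel)"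
      by (intro sum.cong) (auto simp: nn_integral_cmult_indicator)
    also have "\<dots> = (\<integral>\<^sup>+l. (\<Sum>i<n. ennreal (D i / h) * indicator {a i..<a (Suc i)} l) \<partial>lborel)"
      by (intro nn_integral_sum[symmetric]) auto
    also have "\<dots> \<le> line_integral d \<gamma> G"
      unfolding line_integral_def L[symmetric] g_def[symmetric]
    proof (rule nn_integral_mono)
      fix l
      show "(\<Sum>i<n. ennreal (D i / h) * indicator {a i..<a (Suc i)} l) \<le> G (g l) * indicator {0..L} l"
      proof (cases "\<exists>j<n. l \<in> {a j..<a (Suc j)}")
        case True
        then obtain j where j: "j < n" "l \<in> {a j..<a (Suc j)}" by blast
        have "l \<notin> {a i..<a (Suc i)}" if "i \<noteq> j" for i
        proof
          assume i: "l \<in> {a i..<a (Suc i)}"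
          from that consider "Suc i \<le> j" | "Suc j \<le> i" by linarith
          then show False
          proof cases
            case 1
            then have "a (Suc i) \<le> a j" unfolding a_def using h by (intro mult_right_mono) auto
            then show False using i j by auto
          next
            case 2
            then have "a (Suc j) \<le> a i" unfolding a_def using h by (intro mult_right_mono) auto
            then show False using i j by auto
          qed
        qed
        then have "(\<Sum>i<n. ennreal (D i / h) * indicator {a i..<a (Suc i)} l) = (\<Sum>i<n. if i = j then ennreal (D j / h) else 0)"
          using j by (intro sum.cong) auto
        also have "\<dots> = ennreal (D j / h)" using j by simp
        also have "\<dots> \<le> G (g l)" using piece j by blast
        also have "\<dots> = G (g l) * indicator {0..L} l"
          using j a(1)[of j] aL[of "Suc j"] by (auto simp: indicator_def)
        finally show ?thesis .
      next
        case False
        then have "(\<Sum>i<n. ennreal (D i / h) * indicator {a i..<a (Suc i)} l) = 0"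
          by (intro sum.neutral) (auto simp: indicator_def)
        then show ?thesis by simp
      qed
    qed
    finally show ?thesis .
  qed
qed

end

lemma very_weak_gradientI:
  fixes u :: "'a \<Rightarrow> real" and G :: "'a \<Rightarrow> ennreal"
  assumes "G \<in> borel_measurable (borel_of (subtopology mtopology U))" and \<delta>: "0 < \<delta>"
    and G: "\<And>x y. x \<in> U \<Longrightarrow> y \<in> U \<Longrightarrow> d x y < \<delta> \<Longrightarrow> ennreal \<bar>u x - u y\<bar> \<le> ennreal (d x y) * G y"
  shows "very_weak_gradient M d U u G"
  unfolding very_weak_gradient_def pathin_subtopology
proof (intro conjI allI impI)
  fix \<gamma> assume "(pathin mtopology \<gamma> \<and> (\<forall>x\<in>{0..1}. \<gamma> x \<in> U)) \<and> rectifiable_curve d \<gamma>"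
  then show "ennreal \<bar>u (\<gamma> 0) - u (\<gamma> 1)\<bar> \<le> line_integral d \<gamma> G"
    by (intro line_integral_ge_oscillation[OF _ _ refl _ \<delta> G]) auto
qed (fact assms(1))

end

section \<open>Smoothing at a fixed scale\<close>

context Metric_space
begin

text \<open>
  The average over \<open>s\<close> between \<open>t\<close> and \<open>2 * t\<close> of the suprema of \<open>u\<close> over balls of radius \<open>s\<close>.  Moving the
  centre by \<open>h\<close> changes the supremum no more than changing the radius by \<open>h\<close> does, that is, than shifting the
  interval of integration by \<open>h\<close>.  So the function is Lipschitz near \<open>x\<close> with the oscillation of
  \<open>u\<close> near \<open>x\<close> divided by \<open>t\<close> as a constant.
\<close>

definition smooth_at_scale :: "('a \<Rightarrow> real) \<Rightarrow> real \<Rightarrow> 'a \<Rightarrow> real" where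
  "smooth_at_scale u t x = integral {t..2 * t} (\<lambda>s. Sup (u ` mball x s)) / t"

context
  fixes u :: "'a \<Rightarrow> real" and t :: real
  assumes bdd: "\<And>x s. bdd_above (u ` mball x s)" and t: "0 < t"
begin

lemma ball_sup_mono:
  assumes "x \<in> M" "0 < r" "mball x r \<subseteq> mball y s"
  shows "Sup (u ` mball x r) \<le> Sup (u ` mball y s)"
proof (rule cSup_subset_mono)
  have "x \<in> mball x r" using assms by simp
  then show "u ` mball x r \<noteq> {}" by blast
qed (use assms bdd in auto)

lemma ball_sup_integrable:
  assumes "x \<in> M" "0 < a"
  shows "(\<lambda>s. Sup (u ` mball x s)) integrable_on {a..b}"
  using assms by (intro integrable_on_mono_on mono_onI ball_sup_mono mball_subset_concentric) auto

lemma smooth_between: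
  assumes x: "x \<in> M" and A: "\<And>s. s \<in> {t..2*t} \<Longrightarrow> A \<le> Sup (u ` mball x s) \<and> Sup (u ` mball x s) \<le> B"
  shows "A \<le> smooth_at_scale u t x" "smooth_at_scale u t x \<le> B"
proof -
  have "integral {t..2*t} (\<lambda>s. A) \<le> integral {t..2 * t} (\<lambda>s. Sup (u ` mball x s))"
    using A by (intro integral_le ball_sup_integrable x t) auto
  then show "A \<le> smooth_at_scale u t x" using t by (simp add: smooth_at_scale_def field_simps)
  have "integral {t..2 * t} (\<lambda>s. Sup (u ` mball x s)) \<le> integral {t..2*t} (\<lambda>s. B)"
    using A by (intro integral_le ball_sup_integrable x t) auto
  then show "smooth_at_scale u t x \<le> B" using t by (simp add: smooth_at_scale_def field_simps)
qed

lemma smooth_diff_le: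
  assumes x: "x \<in> M" and y: "y \<in> M" and h: "d x y \<le> t"
  shows "smooth_at_scale u t x - smooth_at_scale u t y
    \<le> d x y / t * (Sup (u ` mball y (3 * t)) - Sup (u ` mball y t))"
proof -
  define S where "S x s = Sup (u ` mball x s)" for x s
  define k where "k = d x y"
  have k: "0 \<le> k" "k \<le> t" using h by (auto simp: k_def)
  have int: "S z integrable_on {a..b}" if "z \<in> M" "0 < a" for z a b
    unfolding S_def using ball_sup_integrable that by blast
  have mono: "S y r \<le> S y s" if "0 < r" "r \<le> s" for r s
    unfolding S_def using that y by (intro ball_sup_mono mball_subset_concentric)
  have "(S y has_integral integral {t + k..2 * t + k} (S y)) {t + k..2 * t + k}"
    using int[OF y, of "t + k"] t k by (intro integrable_integral) auto
  then have shift: "((S y \<circ> (+) k) has_integral integral {t + k..2 * t + k} (S y)) {t..2 * t}"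
    by (simp only: has_integral_shift_Icc_real)
  then have sh: "(S y \<circ> (+) k) integrable_on {t..2 * t} \<and> integral {t..2*t} (S y \<circ> (+) k) = integral {t + k..2*t + k} (S y)"
    using integral_unique[OF shift] by (auto simp: integrable_on_def)
  have "integral {t..2*t} (S x) \<le> integral {t..2*t} (S y \<circ> (+) k)"
  proof (rule integral_le[OF int[OF x t]])
    show "(S y \<circ> (+) k) integrable_on {t..2 * t}" using sh by blast
    fix s assume "s \<in> {t..2*t}"
    then show "S x s \<le> (S y \<circ> (+) k) s"
      unfolding S_def comp_def using x y t
      by (intro ball_sup_mono mball_subset) (auto simp: k_def)
  qed
  also have "\<dots> = integral {t + k..2*t + k} (S y)" using sh by blast
  also have "\<dots> = integral {t..2*t + k} (S y) - integral {t..t+k} (S y)"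
    using Henstock_Kurzweil_Integration.integral_combine[where a=t and c="t+k" and b="2*t+k" and f="S y"] int[OF y t] k t by simp
  also have "\<dots> = integral {t..2*t} (S y) + integral {2*t..2*t + k} (S y) - integral {t..t+k} (S y)"
    using Henstock_Kurzweil_Integration.integral_combine[where a=t and c="2*t" and b="2*t+k" and f="S y"] int[OF y t] k t by simp
  also have "integral {2*t..2*t + k} (S y) \<le> integral {2*t..2*t + k} (\<lambda>s. S y (3*t))"
    using k t by (intro integral_le int[OF y] mono) auto
  also have "\<dots> = k * S y (3*t)" using k by simp
  finally have 1: "integral {t..2*t} (S x) \<le> integral {t..2*t} (S y) + k * S y (3*t) - integral {t..t+k} (S y)" by simp
  have "integral {t..t+k} (\<lambda>s. S y t) \<le> integral {t..t+k} (S y)"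
    using k t by (intro integral_le int[OF y] mono) auto
  then have "k * S y t \<le> integral {t..t+k} (S y)" using k by simp
  with 1 have "integral {t..2*t} (S x) - integral {t..2*t} (S y) \<le> k * (S y (3*t) - S y t)"
    by (simp add: algebra_simps)
  then have "(integral {t..2*t} (S x) - integral {t..2*t} (S y)) / t \<le> k * (S y (3*t) - S y t) / t"
    using t by (intro divide_right_mono) auto
  then show ?thesis
    unfolding smooth_at_scale_def S_def[symmetric] k_def[symmetric] by (simp add: diff_divide_distrib)
qed

lemma smooth_lipschitz:
  assumes x: "x \<in> M" and y: "y \<in> M" and h: "d x y < t"
    and W: "\<And>z. z \<in> mball y (4 * t) \<Longrightarrow> u z - u y \<le> W"
  shows "\<bar>smooth_at_scale u t x - smooth_at_scale u t y\<bar> \<le> d x y / t * W"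
proof -
  have up: "Sup (u ` mball z (3 * t)) \<le> u y + W" if z: "z \<in> M" "mball z (3 * t) \<subseteq> mball y (4 * t)" for z
  proof (rule cSup_least)
    have "z \<in> mball z (3 * t)" using that t by simp
    then show "u ` mball z (3 * t) \<noteq> {}" by blast
    fix v assume "v \<in> u ` mball z (3 * t)"
    then obtain w where "v = u w" "w \<in> mball y (4 * t)" using z(2) by (auto simp del: in_mball)
    then show "v \<le> u y + W" using W[of w] by linarith
  qed
  have lo: "u y \<le> Sup (u ` mball z t)" if "y \<in> mball z t" for z
    using that bdd by (intro cSup_upper) auto
  have sub: "mball x (3 * t) \<subseteq> mball y (4 * t)" "mball y (3 * t) \<subseteq> mball y (4 * t)"
    using mball_subset[of x y "3 * t" "4 * t"] mball_subset_concentric[of "3 * t" "4 * t" y] h y t by simp_all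
  have "smooth_at_scale u t x - smooth_at_scale u t y \<le> d x y / t * (Sup (u ` mball y (3 * t)) - Sup (u ` mball y t))"
    using smooth_diff_le[OF x y] h by simp
  also have "\<dots> \<le> d x y / t * W"
    using up[OF y sub(2)] lo[of y] t y by (intro mult_left_mono) auto
  finally have 1: "smooth_at_scale u t x - smooth_at_scale u t y \<le> d x y / t * W" .
  have "smooth_at_scale u t y - smooth_at_scale u t x \<le> d y x / t * (Sup (u ` mball x (3 * t)) - Sup (u ` mball x t))"
    using smooth_diff_le[OF y x] h by (simp add: commute)
  also have "\<dots> \<le> d y x / t * W"
    using up[OF x sub(1)] lo[of x] t x y h by (intro mult_left_mono) auto
  finally show ?thesis using 1 by (simp add: commute)
qed

lemma smooth_continuous:
  shows "continuous_map mtopology euclideanreal (smooth_at_scale u t)"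
  unfolding continuous_map_from_metric
proof (intro conjI ballI allI impI)
  fix y U assume y: "y \<in> M" and U: "openin euclideanreal U \<and> smooth_at_scale u t y \<in> U"
  then have "open U" "smooth_at_scale u t y \<in> U" by simp_all
  then have "\<exists>e>0. \<forall>z. dist z (smooth_at_scale u t y) < e \<longrightarrow> z \<in> U" by (simp add: open_dist)
  then obtain e where e: "e > 0" "\<And>z. \<bar>z - smooth_at_scale u t y\<bar> < e \<Longrightarrow> z \<in> U"
    by (auto simp: dist_real_def)
  define W where "W = \<bar>Sup (u ` mball y (4 * t)) - u y\<bar> + 1"
  have W: "0 < W" "u z - u y \<le> W" if "z \<in> mball y (4 * t)" for z
    using cSup_upper[of "u z" "u ` mball y (4*t)"] bdd that unfolding W_def by auto
  have Wp: "0 < W" unfolding W_def by simp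
  define r where "r = min t (t * e / W)"
  have r: "0 < r" using t e Wp by (simp add: r_def)
  have "smooth_at_scale u t x \<in> U" if x: "x \<in> M" "d y x < r" for x
  proof (rule e(2))
    have "\<bar>smooth_at_scale u t x - smooth_at_scale u t y\<bar> \<le> d x y / t * W"
      using x y W by (intro smooth_lipschitz) (auto simp: r_def commute)
    also have "\<dots> < e" using x Wp t by (auto simp: r_def commute field_simps)
    finally show "\<bar>smooth_at_scale u t x - smooth_at_scale u t y\<bar> < e" .
  qed
  with r show "\<exists>r>0. \<forall>x. x \<in> M \<and> d y x < r \<longrightarrow> smooth_at_scale u t x \<in> U" by blast
qed auto

end

end

section \<open>Density points\<close>

context Metric_space
begin

text \<open>
  The points of \<open>E\<close> with large \<open>n\<close>-density at arbitrarily small scales are covered by balls inside an open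
  neighbourhood of \<open>E\<close> with tiny \<open>n\<close>-measure; by the Vitali covering theorem the \<open>m\<close>-measure of these
  points is at most a constant times this \<open>n\<close>-measure.
\<close>

lemma AE_density_zero:
  fixes C :: real
  assumes m: "doubling_borel C m" and n: "sets n = sets (borel_of mtopology)"
    and small: "\<And>x R e. 0 < e \<Longrightarrow>
       \<exists>U. openin mtopology U \<and> E \<inter> mball x R \<subseteq> U \<and> emeasure n U \<le> ennreal e"
  shows "AE x in m. x \<in> E \<longrightarrow> (\<forall>c>0. \<exists>\<delta>>0. \<forall>r. 0 < r \<and> r < \<delta> \<longrightarrow>
           emeasure n (mball x r) \<le> ennreal c * emeasure m (mball x r))"
proof (cases "M = {}")
  case True
  then show ?thesis using doubling_space[OF m] by (intro AE_I2) auto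
next
  case False
  then obtain x0 where x0: "x0 \<in> M" by blast
  have C: "1 \<le> C" using doubling_const_ge_1[OF m x0] .
  define bad where "bad c x \<longleftrightarrow> (\<forall>\<delta>>0. \<exists>r. 0 < r \<and> r < \<delta> \<and>
     ennreal c * emeasure m (mball x r) < emeasure n (mball x r))" for c x
  have ae: "AE x in m. x \<in> E \<inter> mball x0 R \<longrightarrow> \<not> bad c x" if c: "0 < c" for c R
  proof -
    have V: "\<exists>V\<in>sets m. {x \<in> E \<inter> mball x0 R. bad c x} \<subseteq> V \<and> emeasure m V \<le> ennreal e" if e: "0 < e" for e
    proof -
      define A where "A = {x \<in> E \<inter> mball x0 R. bad c x}"
      have AM: "A \<subseteq> M" unfolding A_def by auto
      have "0 < e * c / C ^ 3" using e c C by simp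
      then obtain U where U: "openin mtopology U" "E \<inter> mball x0 R \<subseteq> U" "emeasure n U \<le> ennreal (e * c / C ^ 3)"
        using small[of "e * c / C ^ 3" x0 R] by blast
      have "\<exists>r. 0 < r \<and> r \<le> 1 \<and> mball x r \<subseteq> U \<and> ennreal c * emeasure m (mball x r) < emeasure n (mball x r)"
        if x: "x \<in> A" for x
      proof -
        have "x \<in> U" using x U unfolding A_def by auto
        then obtain \<delta> where \<delta>: "0 < \<delta>" "mball x \<delta> \<subseteq> U" using U(1) unfolding openin_mtopology by blast
        have "bad c x" "0 < min \<delta> 1" using x \<delta> unfolding A_def by auto
        then obtain r where r: "0 < r" "r < min \<delta> 1" "ennreal c * emeasure m (mball x r) < emeasure n (mball x r)"
          unfolding bad_def by blast
        then have "mball x r \<subseteq> U" using \<delta>(2) mball_subset_concentric[of r \<delta> x] by simp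
        with r show ?thesis by auto
      qed
      then have "\<forall>x\<in>A. \<exists>r. 0 < r \<and> r \<le> 1 \<and> mball x r \<subseteq> U \<and> ennreal c * emeasure m (mball x r) < emeasure n (mball x r)"
        by blast
      then obtain r where r: "\<And>x. x \<in> A \<Longrightarrow> 0 < r x \<and> r x \<le> 1 \<and> mball x (r x) \<subseteq> U \<and>
          ennreal c * emeasure m (mball x (r x)) < emeasure n (mball x (r x))"
        unfolding bchoice_iff by blast
      obtain S where S: "S \<subseteq> A" and disj: "disjoint_family_on (\<lambda>x. mball x (r x)) S"
        and cover: "A \<subseteq> (\<Union>x\<in>S. mball x (5 * r x))"
        using vitali_disjoint_selection[OF AM, of r 1] r by blast
      have cS: "countable S"
        using disjoint_balls_countable[OF m, of S r] S AM r disj by blast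
      have "emeasure m (\<Union>x\<in>S. mball x (5 * r x)) \<le> ennreal (C ^ 3 / c) * emeasure n U"
      proof (rule vitali_compare[OF cS disj doubling_sets[OF m] n])
        show "U \<in> sets n" using U n openin_imp_borel by blast
        fix x assume "x \<in> S"
        then have x: "x \<in> A" "x \<in> M" using S AM by auto
        have "measure m (mball x (5 * r x)) \<le> C ^ 3 * measure m (mball x (r x))"
          using r[OF x(1)] x by (intro doubling_engulf[OF m]) auto
        then have "emeasure m (mball x (5 * r x)) \<le> ennreal (C ^ 3) * emeasure m (mball x (r x))"
          using C by (simp add: doubling_emeasure[OF m, of _ x "5 * r x"] ennreal_mult[symmetric]
            doubling_emeasure[OF m, of _ x "r x"] ennreal_leI)
        also have "\<dots> = ennreal (C ^ 3 / c) * (ennreal c * emeasure m (mball x (r x)))"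
          using c C by (simp add: mult.assoc[symmetric] ennreal_mult[symmetric])
        also have "\<dots> \<le> ennreal (C ^ 3 / c) * emeasure n (U \<inter> mball x (r x))"
          using r[OF x(1)] by (intro mult_left_mono) (auto simp: Int_absorb1 less_imp_le)
        finally show "emeasure m (mball x (5 * r x)) \<le> ennreal (C ^ 3 / c) * emeasure n (U \<inter> mball x (r x))" .
      qed
      also have "\<dots> \<le> ennreal (C ^ 3 / c) * ennreal (e * c / C ^ 3)" using U by (intro mult_left_mono) auto
      also have "\<dots> = ennreal e" using c C e by (simp add: ennreal_mult[symmetric])
      finally show ?thesis using cover cS doubling_sets[OF m] unfolding A_def
        by (intro bexI[of _ "\<Union>x\<in>S. mball x (5 * r x)"]) auto
    qed
    have "\<forall>k. \<exists>V\<in>sets m. {x \<in> E \<inter> mball x0 R. bad c x} \<subseteq> V \<and> emeasure m V \<le> ennreal (1 / real (Suc k))"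
      using V by simp
    then obtain V where "\<forall>k. V k \<in> sets m \<and> {x \<in> E \<inter> mball x0 R. bad c x} \<subseteq> V k \<and>
      emeasure m (V k) \<le> ennreal (1 / real (Suc k))" unfolding Bex_def by (rule choice[THEN exE])
    then have V: "\<And>k. V k \<in> sets m" "\<And>k. {x \<in> E \<inter> mball x0 R. bad c x} \<subseteq> V k"
      "\<And>k. emeasure m (V k) \<le> ennreal (1 / real (Suc k))" by blast+
    have "emeasure m (\<Inter>k. V k) \<le> ennreal (1 / real (Suc k))" for k
      using V by (intro order_trans[OF emeasure_mono V(3)[of k]]) auto
    moreover have "(\<lambda>k. ennreal (1 / real (Suc k))) \<longlonglongrightarrow> ennreal 0"
      by (intro tendsto_ennrealI) (rule LIMSEQ_Suc[OF lim_1_over_n])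
    ultimately have "emeasure m (\<Inter>k. V k) \<le> 0"
      by (intro LIMSEQ_le_const[of _ 0]) auto
    then have "(\<Inter>k. V k) \<in> null_sets m" using V by (auto intro: null_setsI)
    then show ?thesis by (rule AE_I') (use V in auto)
  qed
  have "AE x in m. \<forall>k i. x \<in> E \<inter> mball x0 (real i) \<longrightarrow> \<not> bad (1 / real (Suc k)) x"
    unfolding AE_all_countable by (intro allI ae) simp
  then show ?thesis
  proof (rule AE_mp, intro AE_I2 impI allI)
    fix x and c :: real assume x: "x \<in> space m" "x \<in> E" and good: "\<forall>k i. x \<in> E \<inter> mball x0 (real i) \<longrightarrow> \<not> bad (1 / real (Suc k)) x"
      and c: "0 < c"
    obtain i where "d x0 x < real i" using reals_Archimedean2 by blast
    then have i: "x \<in> mball x0 (real i)" using x x0 doubling_space[OF m] by auto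
    obtain k where k: "1 / real (Suc k) < c" using nat_approx_posE[OF c] .
    have "\<not> bad (1 / real (Suc k)) x" using good i x by blast
    then have "\<exists>\<delta>>0. \<forall>r. 0 < r \<longrightarrow> r < \<delta> \<longrightarrow>
        emeasure n (mball x r) \<le> ennreal (1 / real (Suc k)) * emeasure m (mball x r)"
      unfolding bad_def by (meson not_less)
    then obtain \<delta> where \<delta>: "0 < \<delta>" "\<And>r. 0 < r \<Longrightarrow> r < \<delta> \<Longrightarrow>
        emeasure n (mball x r) \<le> ennreal (1 / real (Suc k)) * emeasure m (mball x r)"
      by blast
    have "ennreal (1 / real (Suc k)) * emeasure m (mball x r) \<le> ennreal c * emeasure m (mball x r)" for r
      using k by (intro mult_right_mono ennreal_leI) auto
    with \<delta>(2) have "0 < r \<Longrightarrow> r < \<delta> \<Longrightarrow> emeasure n (mball x r) \<le> ennreal c * emeasure m (mball x r)" for r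
      using order_trans by blast
    with \<delta>(1) show "\<exists>\<delta>>0. \<forall>r. 0 < r \<and> r < \<delta> \<longrightarrow> emeasure n (mball x r) \<le> ennreal c * emeasure m (mball x r)"
      by blast
  qed
qed

end

section \<open>Powers below the exponent one\<close>

text \<open>
  Used with a free parameter \<open>l\<close> in place of the Hoelder inequality: for \<open>h \<le> l\<close> the first term
  dominates, and for \<open>h > l\<close> the second.
\<close>

lemma powr_truncation:
  fixes h l s :: real
  assumes "0 < s" "s < 1" "0 < l" "0 \<le> h"
  shows "h powr s \<le> l powr s + l powr (s - 1) * h"
proof (cases "h \<le> l")
  case True
  then have "h powr s \<le> l powr s" using assms by (intro powr_mono2) auto
  moreover have "0 \<le> l powr (s - 1) * h" using assms by simp
  ultimately show ?thesis by linarith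
next
  case False
  then have "h powr (s - 1) \<le> l powr (s - 1)" using assms by (intro powr_mono2') auto
  then have "h powr (s - 1) * h \<le> l powr (s - 1) * h" using assms by (intro mult_right_mono) auto
  moreover have "h powr (s - 1) * h = h powr s" using False assms powr_add[of h "s - 1" 1] by simp
  moreover have "0 \<le> l powr s" by simp
  ultimately show ?thesis by linarith
qed

lemma powr_add_le:
  fixes x y s :: real
  assumes "0 \<le> x" "0 \<le> y" "0 < s" "s < 1"
  shows "(x + y) powr s \<le> 2 * (x powr s + y powr s)"
proof -
  have "(x + y) powr s \<le> (2 * max x y) powr s" using assms by (intro powr_mono2) auto
  also have "\<dots> = 2 powr s * max x y powr s" using assms by (simp add: powr_mult)
  also have "\<dots> \<le> 2 * (x powr s + y powr s)"
  proof (rule mult_mono)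
    show "2 powr s \<le> (2::real)" using powr_mono[of s 1 "2::real"] assms by simp
  qed (auto simp: max_def)
  finally show ?thesis .
qed

section \<open>Measures of balls as functions of the centre\<close>

context Metric_space
begin

text \<open>
  If the ball of radius \<open>t\<close> around \<open>y\<close> has measure above \<open>c\<close>, then so has a slightly smaller ball around \<open>y\<close>, which
  is contained in the balls of radius \<open>t\<close> around all nearby points.
\<close>

lemma ball_measure_lsc:
  assumes n: "doubling_borel C n"
  shows "openin mtopology {y \<in> M. c < measure n (mball y t)}"
  unfolding openin_mtopology
proof (intro conjI allI impI)
  fix y assume "y \<in> {y \<in> M. c < measure n (mball y t)}"
  then have y: "y \<in> M" "c < measure n (mball y t)" by auto
  define A where "A k = mball y (t - 1 / real (Suc k))" for k
  have un: "(\<Union>k. A k) = mball y t"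
  proof (intro equalityI subsetI)
    fix z assume z: "z \<in> mball y t"
    then have "0 < t - d y z" by simp
    then obtain k where "1 / real (Suc k) < t - d y z" using nat_approx_posE by blast
    then show "z \<in> (\<Union>k. A k)" using z unfolding A_def by (auto intro!: exI[of _ k])
  next
    fix z assume "z \<in> (\<Union>k. A k)"
    then obtain k where k: "z \<in> A k" by blast
    moreover have "0 < 1 / real (Suc k)" by simp
    ultimately show "z \<in> mball y t" unfolding A_def in_mball by linarith
  qed
  have "incseq A"
    unfolding A_def incseq_def by (intro allI impI mball_subset_concentric) (auto intro!: divide_left_mono)
  then have "(\<lambda>k. measure n (A k)) \<longlonglongrightarrow> measure n (mball y t)"
    using Lim_measure_incseq[of A n] un doubling_finite_ball[OF n, of y t] doubling_sets[OF n]
    by (auto simp: A_def less_top)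
  then obtain k where k: "c < measure n (A k)"
    using order_tendstoD(1)[OF _ y(2)] eventually_happens'[OF sequentially_bot] by blast
  have "c < measure n (mball z t)" if z: "z \<in> mball y (1 / real (Suc k))" for z
  proof -
    have "A k \<subseteq> mball z t" unfolding A_def using z by (intro mball_subset) auto
    then have "measure n (A k) \<le> measure n (mball z t)"
      by (intro doubling_mono[OF n, of _ _ z t]) (auto simp: doubling_sets[OF n])
    with k show ?thesis by simp
  qed
  then show "\<exists>r>0. mball y r \<subseteq> {y \<in> M. c < measure n (mball y t)}"
    by (intro exI[of _ "1 / real (Suc k)"]) auto
qed auto

text \<open>
  The centres of Vitali coverings by balls of radius \<open>1 / Suc k\<close> form a countable dense set.
\<close>

lemma doubling_separable:
  assumes m: "doubling_borel C m"
  obtains D where "countable D" "D \<subseteq> M" "\<And>x e. x \<in> M \<Longrightarrow> 0 < e \<Longrightarrow> \<exists>q\<in>D. d q x < e"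
proof -
  have "\<exists>S. countable S \<and> S \<subseteq> M \<and> M \<subseteq> (\<Union>x\<in>S. mball x (5 * (1 / real (Suc k))))" for k
  proof -
    obtain S where S: "S \<subseteq> M" "disjoint_family_on (\<lambda>x. mball x (1 / real (Suc k))) S"
      "M \<subseteq> (\<Union>x\<in>S. mball x (5 * (1 / real (Suc k))))"
      using vitali_disjoint_selection[of M "\<lambda>x. 1 / real (Suc k)" "1 / real (Suc k)"] by auto
    have "countable S" using disjoint_balls_countable[OF m S(1) _ S(2)] by simp
    with S show ?thesis by blast
  qed
  then obtain S where S: "\<And>k. countable (S k)" "\<And>k. S k \<subseteq> M"
    "\<And>k. M \<subseteq> (\<Union>x\<in>S k. mball x (5 * (1 / real (Suc k))))" by metis
  show ?thesis
  proof (rule that[of "\<Union>k. S k"])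
    fix x and e :: real assume x: "x \<in> M" and e: "0 < e"
    obtain k where k: "1 / real (Suc k) < e / 5" using nat_approx_posE[of "e / 5"] e by auto
    obtain q where q: "q \<in> S k" "x \<in> mball q (5 * (1 / real (Suc k)))" using S(3)[of k] x by blast
    have "d q x < e" using q(2) k by (simp only: in_mball) linarith
    with q show "\<exists>q\<in>\<Union>k. S k. d q x < e" by blast
  qed (use S in auto)
qed

text \<open>
  By separability the set is a countable union of products of balls.
\<close>

lemma pair_near_measurable:
  assumes m: "doubling_borel C m"
  shows "{(y, z) \<in> M \<times> M. d y z < t} \<in> sets (borel_of mtopology \<Otimes>\<^sub>M borel_of mtopology)"
proof -
  obtain D where D: "countable D" "D \<subseteq> M" "\<And>x e. x \<in> M \<Longrightarrow> 0 < e \<Longrightarrow> \<exists>q\<in>D. d q x < e"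
    using doubling_separable[OF m] by metis
  have "{(y, z) \<in> M \<times> M. d y z < t} = (\<Union>q\<in>D. \<Union>a\<in>\<rat>. mball q a \<times> mball q (t - a))"
  proof (intro equalityI subsetI)
    fix w assume "w \<in> {(y, z) \<in> M \<times> M. d y z < t}"
    then obtain y z where w: "w = (y, z)" "y \<in> M" "z \<in> M" "d y z < t" by auto
    then have "0 < (t - d y z) / 2" by simp
    then obtain q where q: "q \<in> D" "d q y < (t - d y z) / 2" using D(3)[OF w(2)] by blast
    obtain a where a: "a \<in> \<rat>" "d q y < a" "a < (t - d y z) / 2" using Rats_dense_in_real[OF q(2)] by blast
    have "d q z \<le> d q y + d y z" using q w D by (intro triangle) auto
    then have "d q z < t - a" using a by (simp add: field_simps)
    then have "w \<in> mball q a \<times> mball q (t - a)" using w q a D by auto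
    then show "w \<in> (\<Union>q\<in>D. \<Union>a\<in>\<rat>. mball q a \<times> mball q (t - a))" using q a by blast
  next
    fix w assume "w \<in> (\<Union>q\<in>D. \<Union>a\<in>\<rat>. mball q a \<times> mball q (t - a))"
    then obtain q a y z where w: "w = (y, z)" "q \<in> D" "y \<in> mball q a" "z \<in> mball q (t - a)" by auto
    then have "d y z \<le> d q y + d q z" by (auto intro: triangle'')
    with w show "w \<in> {(y, z) \<in> M \<times> M. d y z < t}" by auto
  qed
  also have "\<dots> \<in> sets (borel_of mtopology \<Otimes>\<^sub>M borel_of mtopology)"
    using D by (intro sets.countable_UN'' countable_rat pair_measureI) auto
  finally show ?thesis .
qed

text \<open>
  Exchanging the integrals turns the measure of balls under \<open>n\<close>, centred at the variable of
  integration for \<open>m\<close>, into the measure of balls under \<open>m\<close> integrated over \<open>Z\<close> for \<open>n\<close>.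
\<close>

lemma integral_ball_measure_le:
  assumes m: "doubling_borel C m" and n: "doubling_borel C' n"
    and Z: "Z \<in> sets (borel_of mtopology)"
    and upper: "\<And>x. x \<in> M \<Longrightarrow> emeasure m (mball x t) \<le> V"
  shows "(\<integral>\<^sup>+y. emeasure n (mball y t \<inter> Z) \<partial>m) \<le> V * emeasure n Z"
proof -
  interpret pair_sigma_finite m n
    by (intro pair_sigma_finite.intro doubling_sigma_finite[OF m] doubling_sigma_finite[OF n])
  note sm = doubling_sets[OF m] and sn = doubling_sets[OF n]
  have ZM: "Z \<subseteq> M" using sets.sets_into_space[OF Z] by simp
  define P where "P = {(y, z) \<in> M \<times> M. d y z < t} \<inter> M \<times> Z"
  have "M \<in> sets (borel_of mtopology)" using sets.top[of "borel_of mtopology"] by simp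
  then have "P \<in> sets (borel_of mtopology \<Otimes>\<^sub>M borel_of mtopology)"
    unfolding P_def using Z by (intro sets.Int pair_near_measurable[OF m] pair_measureI)
  moreover have "sets (m \<Otimes>\<^sub>M n) = sets (borel_of mtopology \<Otimes>\<^sub>M borel_of mtopology)"
    by (rule sets_pair_measure_cong[OF sm sn])
  ultimately have P: "P \<in> sets (m \<Otimes>\<^sub>M n)" by simp
  have "(\<integral>\<^sup>+y. emeasure n (mball y t \<inter> Z) \<partial>m) = (\<integral>\<^sup>+y. (\<integral>\<^sup>+z. indicator P (y, z) \<partial>n) \<partial>m)"
  proof (rule nn_integral_cong)
    fix y assume "y \<in> space m"
    then have "y \<in> M" by (simp add: doubling_space[OF m])
    then have "indicator P (y, z) = (indicator (mball y t \<inter> Z) z :: ennreal)" for z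
      using ZM by (auto simp: P_def indicator_def)
    then show "emeasure n (mball y t \<inter> Z) = (\<integral>\<^sup>+z. indicator P (y, z) \<partial>n)"
      using sets.Int[OF mball_borel Z, of y t] by (simp add: sn)
  qed
  also have "\<dots> = (\<integral>\<^sup>+z. (\<integral>\<^sup>+y. indicator P (y, z) \<partial>m) \<partial>n)"
    using P by (intro Fubini'[symmetric]) auto
  also have "\<dots> \<le> (\<integral>\<^sup>+z. V * indicator Z z \<partial>n)"
  proof (rule nn_integral_mono)
    fix z assume z: "z \<in> space n"
    then have zM: "z \<in> M" by (simp add: doubling_space[OF n])
    have "(\<integral>\<^sup>+y. indicator P (y, z) \<partial>m) \<le> (\<integral>\<^sup>+y. indicator (mball z t) y * indicator Z z \<partial>m)"
      by (intro nn_integral_mono) (auto simp: P_def indicator_def commute)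
    also have "\<dots> = emeasure m (mball z t) * indicator Z z"
      by (subst nn_integral_multc) (auto intro!: borel_measurable_indicator simp: sm)
    also have "\<dots> \<le> V * indicator Z z" using upper[OF zM] by (rule mult_right_mono) simp
    finally show "(\<integral>\<^sup>+y. indicator P (y, z) \<partial>m) \<le> V * indicator Z z" .
  qed
  also have "\<dots> = V * emeasure n Z" using Z by (simp add: nn_integral_cmult_indicator sn)
  finally show ?thesis .
qed

end

section \<open>Quasisymmetric maps and their pullback measure\<close>

text \<open>
  The metric setting.  Distances between pairs of points serve as bounds for radii in the lower
  regularity, which expresses that the radius is at most of the order of the diameter without speaking of
  suprema.  The quasisymmetry is stated as a product instead of a quotient, so that it includes coinciding
  points; of \<open>\<eta>\<close> it keeps only that it takes small values.
\<close>

locale qs_poincare_space = Metric_space +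
  fixes m :: "'a measure" and C K Q p :: real and f f' :: "'a \<Rightarrow> 'a" and \<eta> :: "real \<Rightarrow> real"
  assumes doubling: "doubling_borel C m"
    and outer: "outer_regular m"
    and K: "1 \<le> K" and p: "1 \<le> p" "p < Q"
    and upper: "\<And>x r. x \<in> M \<Longrightarrow> 0 < r \<Longrightarrow> measure m (mball x r) \<le> K * r powr Q"
    and lower: "\<And>x y z r. x \<in> M \<Longrightarrow> y \<in> M \<Longrightarrow> z \<in> M \<Longrightarrow> 0 < r \<Longrightarrow> r \<le> d y z \<Longrightarrow>
       r powr Q \<le> K * measure m (mball x r)"
    and poincare: "weak_poincare M d m p"
    and homeo: "homeomorphic_maps mtopology mtopology f f'"
    and eta_small: "\<And>e. 0 < e \<Longrightarrow> \<exists>\<theta>>0. \<eta> \<theta> \<le> e"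
    and qs: "\<And>x a b \<theta>. x \<in> M \<Longrightarrow> a \<in> M \<Longrightarrow> b \<in> M \<Longrightarrow> 0 < \<theta> \<Longrightarrow> d x a \<le> \<theta> * d x b \<Longrightarrow>
       d (f x) (f a) \<le> \<eta> \<theta> * d (f x) (f b)"
    and two_points: "\<exists>y\<in>M. \<exists>z\<in>M. y \<noteq> z"
begin

lemma f_in [simp]: "x \<in> M \<Longrightarrow> f x \<in> M" and f'_in [simp]: "x \<in> M \<Longrightarrow> f' x \<in> M"
  using homeo unfolding homeomorphic_maps_def continuous_map_def by auto

lemma f_f' [simp]: "x \<in> M \<Longrightarrow> f (f' x) = x" and f'_f [simp]: "x \<in> M \<Longrightarrow> f' (f x) = x"
  using homeo unfolding homeomorphic_maps_def by auto

lemma C_ge_1: "1 \<le> C"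
  using two_points doubling_const_ge_1[OF doubling] by blast

text \<open>
  The pullback of \<open>m\<close> under \<open>f\<close>, that is \<open>E \<mapsto> m (f ` E)\<close>.
\<close>

definition \<nu> :: "'a measure" where "\<nu> = distr m (borel_of mtopology) f'"

lemma sets_nu [simp]: "sets \<nu> = sets (borel_of mtopology)"
  by (simp add: \<nu>_def)

lemma f'_measurable: "f' \<in> measurable m (borel_of mtopology)" 
  using continuous_map_measurable_borel_of[of mtopology mtopology f'] homeo
  unfolding homeomorphic_maps_def by (simp add: measurable_cong_sets[OF doubling_sets[OF doubling] refl])

lemma image_eq_vimage: "E \<subseteq> M \<Longrightarrow> f ` E = f' -` E \<inter> M"
  by (auto simp: image_iff) (metis f_f' in_mono)+

lemma image_borel: "E \<in> sets (borel_of mtopology) \<Longrightarrow> f ` E \<in> sets (borel_of mtopology)"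
  using measurable_sets[OF f'_measurable, of E] sets.sets_into_space[of E "borel_of mtopology"]
  by (simp add: image_eq_vimage doubling_space[OF doubling] doubling_sets[OF doubling])

lemma emeasure_nu: "E \<in> sets (borel_of mtopology) \<Longrightarrow> emeasure \<nu> E = emeasure m (f ` E)"
  unfolding \<nu>_def using f'_measurable sets.sets_into_space[of E "borel_of mtopology"]
  by (simp add: emeasure_distr image_eq_vimage doubling_space[OF doubling])

text \<open>
  A point outside the ball of radius \<open>r\<close> is further from \<open>x\<close> than \<open>y\<close> is, up to the factor \<open>L\<close>; hence its image
  is not much closer to the image of \<open>x\<close> than that of \<open>y\<close> is.  By surjectivity the image of
  the ball contains everything that is closer.
\<close>

lemma image_ball_contains:
  assumes x: "x \<in> M" and y: "y \<in> M" and r: "0 < r" and L: "0 < L" "d x y \<le> L * r" and E: "0 < E" "\<eta> L \<le> E"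
  shows "mball (f x) (d (f x) (f y) / E) \<subseteq> f ` mball x r"
proof
  fix w assume w: "w \<in> mball (f x) (d (f x) (f y) / E)"
  then have wM: "w \<in> M" and dw: "d (f x) w < d (f x) (f y) / E" by auto
  have "f' w \<in> mball x r"
  proof (rule ccontr)
    assume "f' w \<notin> mball x r"
    then have "r \<le> d x (f' w)" using x wM by auto
    then have "L * r \<le> L * d x (f' w)" using L by (intro mult_left_mono) auto
    then have "d x y \<le> L * d x (f' w)" using L by linarith
    then have "d (f x) (f y) \<le> \<eta> L * d (f x) (f (f' w))" using x y wM L by (intro qs) auto
    also have "\<dots> \<le> E * d (f x) w" using E wM by (simp add: mult_right_mono)
    finally show False using dw E by (simp add: field_simps)
  qed
  then show "w \<in> f ` mball x r" using wM by (metis f_f' image_eqI)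
qed

lemma image_ball_bounded:
  assumes x: "x \<in> M" and y: "y \<in> M" and L: "0 < L" "r \<le> L * d x y" and D: "\<eta> L * d (f x) (f y) < D"
  shows "f ` mball x r \<subseteq> mball (f x) D"
proof
  fix w assume "w \<in> f ` mball x r"
  then obtain z where z: "w = f z" "z \<in> M" "d x z < r" by auto
  then have "d x z \<le> L * d x y" using L by linarith
  then have "d (f x) (f z) \<le> \<eta> L * d (f x) (f y)" using x y z L by (intro qs) auto
  then show "w \<in> mball (f x) D" using x z D by auto
qed

lemma f_inj: "x \<in> M \<Longrightarrow> y \<in> M \<Longrightarrow> f x = f y \<longleftrightarrow> x = y"
  by (metis f'_f)

lemma other_point: "x \<in> M \<Longrightarrow> \<exists>y\<in>M. x \<noteq> y"
  using two_points by metis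

lemma image_ball_in_ball: "x \<in> M \<Longrightarrow> \<exists>D. f ` mball x r \<subseteq> mball (f x) D"
proof -
  assume x: "x \<in> M"
  obtain y where y: "y \<in> M" "x \<noteq> y" using other_point[OF x] by blast
  define L where "L = max 1 (r / d x y)"
  have "0 < L" "r \<le> L * d x y" using x y unfolding L_def by (simp_all add: pos_divide_le_eq[symmetric])
  moreover have "\<eta> L * d (f x) (f y) < \<eta> L * d (f x) (f y) + 1" by linarith
  ultimately have "f ` mball x r \<subseteq> mball (f x) (\<eta> L * d (f x) (f y) + 1)"
    by (rule image_ball_bounded[OF x y(1)])
  then show ?thesis by blast
qed

text \<open>
  Choose \<open>y\<close> in the ball of radius \<open>2 * r\<close> whose image is almost furthest from the image of \<open>x\<close>.  The image of the
  large ball is contained in the ball of radius \<open>2 * d (f x) (f y)\<close>, the image of the small one contains a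
  ball of a comparable radius, and \<open>m\<close> is doubling.
\<close>

lemma nu_doubling: "\<exists>C'. doubling_borel C' \<nu>"
proof -
  define E where "E = max 1 (\<eta> 2)"
  have E: "1 \<le> E" "\<eta> 2 \<le> E" by (auto simp: E_def)
  obtain k :: nat where k: "2 * E \<le> 2 ^ k"
    using real_arch_pow[of 2 "2 * E"] by (auto intro: less_imp_le)
  have pos: "0 < emeasure \<nu> (mball x r) \<and> emeasure \<nu> (mball x r) < \<infinity>" if x: "x \<in> M" and r: "0 < r" for x r
  proof
    obtain D where "f ` mball x r \<subseteq> mball (f x) D" using image_ball_in_ball[OF x] by blast
    then show "emeasure \<nu> (mball x r) < \<infinity>"
      using doubling_finite[OF doubling] by (simp add: emeasure_nu)
    have "openin mtopology (f ` mball x r)"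
      using homeomorphic_imp_open_map[OF homeomorphic_maps_imp_map[OF homeo]] unfolding open_map_def by blast
    moreover have "f x \<in> f ` mball x r" using x r by auto
    ultimately obtain e where e: "0 < e" "mball (f x) e \<subseteq> f ` mball x r" unfolding openin_mtopology by blast
    have "0 < emeasure m (mball (f x) e)" using doubling x e unfolding doubling_borel_def by simp
    also have "\<dots> \<le> emeasure m (f ` mball x r)"
      using e by (intro emeasure_mono) (auto simp: doubling_sets[OF doubling] intro!: image_borel)
    finally show "0 < emeasure \<nu> (mball x r)" by (simp add: emeasure_nu)
  qed
  have dbl: "emeasure \<nu> (mball x (2 * r)) \<le> ennreal (C ^ k) * emeasure \<nu> (mball x r)" if x: "x \<in> M" and r: "0 < r" for x r
  proof (cases "mball x (2 * r) \<subseteq> {x}")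
    case True
    then have "mball x (2 * r) = mball x r" using x r by (auto simp del: in_mball) auto
    moreover have "1 * emeasure \<nu> (mball x r) \<le> ennreal (C ^ k) * emeasure \<nu> (mball x r)"
      using C_ge_1 by (intro mult_right_mono) (auto simp: one_le_power ennreal_leI simp flip: ennreal_1)
    ultimately show ?thesis by simp
  next
    case False
    define T where "T = (\<lambda>y. d (f x) (f y)) ` mball x (2 * r)"
    obtain D where "f ` mball x (2 * r) \<subseteq> mball (f x) D" using image_ball_in_ball[OF x] by blast
    then have bdd: "bdd_above T" unfolding T_def by (intro bdd_aboveI[of _ D]) (auto simp: less_imp_le)
    obtain y0 where y0: "y0 \<in> mball x (2 * r)" "y0 \<noteq> x" using False by blast
    have "0 < d (f x) (f y0)" using y0 x f_inj by auto
    moreover have "d (f x) (f y0) \<le> Sup T" using y0 bdd unfolding T_def by (intro cSup_upper) auto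
    ultimately have "Sup T / 2 < Sup T" by simp
    moreover have "T \<noteq> {}" using y0 unfolding T_def by blast
    ultimately obtain v where "v \<in> T" "Sup T / 2 < v" using less_cSupD[of T "Sup T / 2"] by blast
    then obtain y where y: "y \<in> mball x (2 * r)" "Sup T / 2 < d (f x) (f y)"
      unfolding T_def by blast
    define s where "s = d (f x) (f y) / E"
    have s: "0 < s" using y \<open>0 < d (f x) (f y0)\<close> \<open>d (f x) (f y0) \<le> Sup T\<close> E unfolding s_def by (auto intro!: divide_pos_pos)
    have in_im: "mball (f x) s \<subseteq> f ` mball x r"
      unfolding s_def using y x r E by (intro image_ball_contains[where L=2]) auto
    have "f ` mball x (2 * r) \<subseteq> mball (f x) (2 ^ k * s)"
    proof
      fix w assume "w \<in> f ` mball x (2 * r)"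
      then obtain z where z: "w = f z" "z \<in> mball x (2 * r)" by blast
      then have "d (f x) (f z) \<le> Sup T" using bdd unfolding T_def by (intro cSup_upper) auto
      also have "\<dots> < 2 * d (f x) (f y)" using y by simp
      also have "\<dots> = 2 * E * s" unfolding s_def using E by simp
      also have "\<dots> \<le> 2 ^ k * s" using k s by (intro mult_right_mono) auto
      finally show "w \<in> mball (f x) (2 ^ k * s)" using x z by auto
    qed
    then have "measure m (f ` mball x (2 * r)) \<le> C ^ k * measure m (mball (f x) s)"
      using x s by (intro doubling_engulf[OF doubling]) auto
    also obtain D' where D': "f ` mball x r \<subseteq> mball (f x) D'" using image_ball_in_ball[OF x] by blast
    have "measure m (mball (f x) s) \<le> measure m (f ` mball x r)"
      by (rule doubling_mono[OF doubling in_im D']) (auto simp: doubling_sets[OF doubling] intro!: image_borel)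
    then have "C ^ k * measure m (mball (f x) s) \<le> C ^ k * measure m (f ` mball x r)"
      using C_ge_1 by (intro mult_left_mono) auto
    finally have "ennreal (measure m (f ` mball x (2 * r))) \<le> ennreal (C ^ k * measure m (f ` mball x r))"
      by (rule ennreal_leI)
    then show ?thesis
      using C_ge_1 by (simp add: emeasure_nu doubling_emeasure[OF doubling D'] ennreal_mult
        doubling_emeasure[OF doubling \<open>f ` mball x (2 * r) \<subseteq> mball (f x) D\<close>])
  qed
  show ?thesis
    unfolding doubling_borel_def using pos dbl by (intro exI[of _ "C ^ k"]) auto
qed

definition C\<nu> where "C\<nu> = (SOME C'. doubling_borel C' \<nu>)"

lemma nu: "doubling_borel C\<nu> \<nu>"
  unfolding C\<nu>_def using nu_doubling by (rule someI_ex)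

lemma measure_nu: "E \<in> sets (borel_of mtopology) \<Longrightarrow> measure \<nu> E = measure m (f ` E)"
  by (simp add: measure_def emeasure_nu)

lemma nu_outer: "outer_regular \<nu>"
  unfolding outer_regular_def
proof
  fix E assume E: "E \<in> sets (borel_of mtopology)"
  have EM: "E \<subseteq> M" using sets.sets_into_space[OF E] by simp
  show "emeasure \<nu> E = (INF U\<in>{U. openin mtopology U \<and> E \<subseteq> U}. emeasure \<nu> U)"
  proof (rule antisym)
    show "emeasure \<nu> E \<le> (INF U\<in>{U. openin mtopology U \<and> E \<subseteq> U}. emeasure \<nu> U)"
      by (intro INF_greatest emeasure_mono) (auto intro: openin_imp_borel)
    have "emeasure \<nu> E = (INF U\<in>{U. openin mtopology U \<and> f ` E \<subseteq> U}. emeasure m U)"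
      using outer image_borel[OF E] unfolding outer_regular_def by (simp add: emeasure_nu[OF E])
    also have "(INF U\<in>{U. openin mtopology U \<and> E \<subseteq> U}. emeasure \<nu> U) \<le> \<dots>"
    proof (rule INF_mono)
      fix U assume "U \<in> {U. openin mtopology U \<and> f ` E \<subseteq> U}"
      then have U: "openin mtopology U" "f ` E \<subseteq> U" "U \<subseteq> M"
        using openin_subset[of mtopology U] by auto
      have "openin mtopology {x \<in> M. f x \<in> U}"
        using homeo U unfolding homeomorphic_maps_def continuous_map_def by auto
      moreover have "f ` {x \<in> M. f x \<in> U} = U" using U(3) by (auto simp: image_iff) (metis f'_in f_f' subsetD)
      ultimately show "\<exists>V\<in>{U. openin mtopology U \<and> E \<subseteq> U}. emeasure \<nu> V \<le> emeasure m U"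
        using U EM by (intro bexI[of _ "{x \<in> M. f x \<in> U}"]) (auto simp: emeasure_nu openin_imp_borel)
    qed
    finally show "(INF U\<in>{U. openin mtopology U \<and> E \<subseteq> U}. emeasure \<nu> U) \<le> emeasure \<nu> E" .
  qed
qed

text \<open>
  The image of the ball of radius \<open>t\<close> contains a ball of radius comparable to \<open>d (f x) (f y)\<close>, whose measure is
  bounded from below by regularity.
\<close>

lemma distortion_le_nu:
  obtains K1 where "0 < K1" "\<And>x y t. x \<in> M \<Longrightarrow> y \<in> M \<Longrightarrow> 0 < t \<Longrightarrow> d x y \<le> 4 * t \<Longrightarrow>
     d (f x) (f y) \<le> K1 * measure \<nu> (mball x t) powr (1 / Q)"
proof -
  define E where "E = max 1 (\<eta> 4)"
  have E: "1 \<le> E" "\<eta> 4 \<le> E" by (auto simp: E_def)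
  have Q: "0 < Q" using p by simp
  show ?thesis
  proof (rule that[of "E * K powr (1 / Q)"])
    show "0 < E * K powr (1 / Q)" using E K by simp
    fix x y and t :: real assume x: "x \<in> M" and y: "y \<in> M" and t: "0 < t" "d x y \<le> 4 * t"
    show "d (f x) (f y) \<le> E * K powr (1 / Q) * measure \<nu> (mball x t) powr (1 / Q)"
    proof (cases "f x = f y")
      case True
      then have "d (f x) (f y) = 0" using y mdist_zero[of "f y"] by simp
      then show ?thesis using E by simp
    next
      case False
      define r where "r = d (f x) (f y) / E"
      have r: "0 < r" "r \<le> d (f x) (f y)" using False x y E unfolding r_def by (auto simp: field_simps)
      have sub: "mball (f x) r \<subseteq> f ` mball x t"
        unfolding r_def using x y t E by (intro image_ball_contains[where L=4]) auto
      obtain D where D: "f ` mball x t \<subseteq> mball (f x) D" using image_ball_in_ball[OF x] by blast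
      have "r powr Q \<le> K * measure m (mball (f x) r)"
        using lower[of "f x" "f x" "f y" r] x y r by auto
      also have "\<dots> \<le> K * measure \<nu> (mball x t)"
        using K doubling_mono[OF doubling sub D] by (simp add: measure_nu image_borel doubling_sets[OF doubling])
      finally have "(r powr Q) powr (1 / Q) \<le> (K * measure \<nu> (mball x t)) powr (1 / Q)"
        using Q by (intro powr_mono2) auto
      then have "r \<le> K powr (1 / Q) * measure \<nu> (mball x t) powr (1 / Q)"
        using r Q K by (simp add: powr_powr powr_mult)
      then show ?thesis using E unfolding r_def by (simp add: field_simps)
    qed
  qed
qed

end

section \<open>Oscillation of the distance to the image of the centre\<close>

lemma continuous_map_borel_measurable:
  assumes "continuous_map T euclideanreal u" "sets m = sets (borel_of T)"
  shows "u \<in> borel_measurable m"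
proof -
  have "borel_of euclideanreal = (borel :: real measure)"
    by (simp add: borel_of_def borel_def)
  then show ?thesis
    using continuous_map_measurable_borel_of[OF assms(1)] by (simp add: measurable_cong_sets[OF assms(2) refl])
qed

text \<open>
  The average of \<open>g\<close> is far from the values on \<open>A1\<close> or far from those on \<open>A2\<close>.
\<close>

lemma mean_oscillation_ge:
  assumes B: "B \<in> sets m" "emeasure m B < \<infinity>" "0 < measure m B"
    and g: "set_integrable m B g"
    and A: "A1 \<in> sets m" "A1 \<subseteq> B" "A2 \<in> sets m" "A2 \<subseteq> B"
    and big: "\<And>x. x \<in> A1 \<Longrightarrow> M0 \<le> g x" and small: "\<And>x. x \<in> A2 \<Longrightarrow> g x \<le> M0 / 4"
    and M0: "0 < M0" and meas: "k * measure m B \<le> measure m A1" "k * measure m B \<le> measure m A2"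
  shows "k * M0 / 4 \<le> mean_oscillation m B g"
proof -
  define a where "a = average m B g"
  have const: "set_integrable m B (\<lambda>_. a)"
    using B unfolding set_integrable_def by (simp add: less_top)
  have int: "set_integrable m B (\<lambda>x. \<bar>g x - a\<bar>)"
    using set_integral_diff(1)[OF g const] by (rule set_integrable_abs)
  have ge: "M0 / 4 * measure m A \<le> (LINT x:B|m. \<bar>g x - a\<bar>)"
    if A: "A \<in> sets m" "A \<subseteq> B" and le: "\<And>x. x \<in> A \<Longrightarrow> M0 / 4 \<le> \<bar>g x - a\<bar>" for A
  proof -
    have fin: "emeasure m A < \<infinity>" using emeasure_mono[OF A(2) B(1)] B(2) by simp
    have "M0 / 4 * measure m A = (LINT x|m. indicator A x * (M0 / 4))"
      using fin A by (simp add: less_top)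
    also have "\<dots> \<le> (LINT x|m. indicator B x *\<^sub>R \<bar>g x - a\<bar>)"
    proof (rule integral_mono)
      show "integrable m (\<lambda>x. indicator A x * (M0 / 4))" using fin A by (simp add: less_top)
      show "integrable m (\<lambda>x. indicator B x *\<^sub>R \<bar>g x - a\<bar>)" using int by (simp add: set_integrable_def)
      show "indicator A x * (M0 / 4) \<le> indicator B x *\<^sub>R \<bar>g x - a\<bar>" for x
        using le[of x] A M0 by (auto simp: indicator_def)
    qed
    finally show ?thesis by (simp add: set_lebesgue_integral_def)
  qed
  have "M0 / 4 * (k * measure m B) \<le> (LINT x:B|m. \<bar>g x - a\<bar>)"
  proof (cases "M0 / 2 \<le> a")
    case True
    have "M0 / 4 * measure m A2 \<le> (LINT x:B|m. \<bar>g x - a\<bar>)"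
    proof (rule ge[OF A(3,4)])
      fix x assume "x \<in> A2" then show "M0 / 4 \<le> \<bar>g x - a\<bar>" using small[of x] True M0 by linarith
    qed
    moreover have "M0 / 4 * (k * measure m B) \<le> M0 / 4 * measure m A2"
      using meas M0 by (intro mult_left_mono) auto
    ultimately show ?thesis by linarith
  next
    case False
    have "M0 / 4 * measure m A1 \<le> (LINT x:B|m. \<bar>g x - a\<bar>)"
    proof (rule ge[OF A(1,2)])
      fix x assume "x \<in> A1" then show "M0 / 4 \<le> \<bar>g x - a\<bar>" using big[of x] False M0 by linarith
    qed
    moreover have "M0 / 4 * (k * measure m B) \<le> M0 / 4 * measure m A1"
      using meas M0 by (intro mult_left_mono) auto
    ultimately show ?thesis by linarith
  qed
  then have "k * M0 / 4 * measure m B \<le> (LINT x:B|m. \<bar>g x - a\<bar>)" by (simp add: algebra_simps)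
  then show ?thesis
    unfolding mean_oscillation_def a_def[symmetric] average_def[of m B "\<lambda>y. \<bar>g y - a\<bar>"]
    using B(3) by (simp add: pos_le_divide_eq)
qed

context Metric_space
begin

lemma ball_measure_measurable:
  assumes m: "doubling_borel C m" and n: "doubling_borel C' n" and Z: "Z \<in> sets (borel_of mtopology)"
  shows "(\<lambda>y. emeasure n (mball y t \<inter> Z)) \<in> borel_measurable m"
proof -
  interpret sigma_finite_measure n by (rule doubling_sigma_finite[OF n])
  have ZM: "Z \<subseteq> M" using sets.sets_into_space[OF Z] by simp
  define P where "P = {(y, z) \<in> M \<times> M. d y z < t} \<inter> M \<times> Z"
  have "M \<in> sets (borel_of mtopology)" using sets.top[of "borel_of mtopology"] by simp
  then have "P \<in> sets (borel_of mtopology \<Otimes>\<^sub>M borel_of mtopology)"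
    unfolding P_def using Z by (intro sets.Int pair_near_measurable[OF m] pair_measureI)
  moreover have "sets (m \<Otimes>\<^sub>M n) = sets (borel_of mtopology \<Otimes>\<^sub>M borel_of mtopology)"
    by (rule sets_pair_measure_cong[OF doubling_sets[OF m] doubling_sets[OF n]])
  ultimately have "P \<in> sets (m \<Otimes>\<^sub>M n)" by simp
  then have "(\<lambda>y. emeasure n (Pair y -` P)) \<in> borel_measurable m" by (rule measurable_emeasure_Pair)
  moreover have "emeasure n (Pair y -` P) = emeasure n (mball y t \<inter> Z)" if "y \<in> space m" for y
    using that ZM by (intro arg_cong[where f="emeasure n"]) (auto simp: P_def doubling_space[OF m])
  ultimately show ?thesis by (simp cong: measurable_cong)
qed

end

context qs_poincare_space
begin

lemma image_distance_bounded: "bdd_above ((\<lambda>y. d (f x0) (f y)) ` mball x s)" if x0: "x0 \<in> M"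
proof (cases "x \<in> M")
  case True
  obtain D where D: "f ` mball x s \<subseteq> mball (f x) D" using image_ball_in_ball[OF True] by blast
  show ?thesis
  proof (rule bdd_aboveI[of _ "d (f x0) (f x) + D"])
    fix v assume "v \<in> (\<lambda>y. d (f x0) (f y)) ` mball x s"
    then obtain y where y: "v = d (f x0) (f y)" "y \<in> mball x s" by blast
    then have "f y \<in> mball (f x) D" using D by blast
    then have "d (f x) (f y) < D" by simp
    moreover have "d (f x0) (f y) \<le> d (f x0) (f x) + d (f x) (f y)" using x0 True y by (intro triangle) auto
    ultimately show "v \<le> d (f x0) (f x) + D" using y by simp
  qed
next
  case False
  then have "mball x s = {}" by auto
  then show ?thesis by simp
qed

text \<open>
  By regularity with a positive exponent some smaller concentric ball carries at most half of the measure.  On the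
  remaining annulus the distance \<open>u\<close> to the image of the centre is, by quasisymmetry, comparable to its value at any
  fixed point \<open>w\<close> of the annulus.  On a much smaller concentric ball \<open>u\<close> is at most a quarter of that,
  because \<open>\<eta>\<close> takes small values.  Finally \<open>u w\<close> is comparable to the radius of the image of the large ball, and upper regularity
  bounds the measure of this image.
\<close>

lemma oscillation_ge_nu:
  assumes C0: "1 \<le> C0"
  obtains c \<tau> where "0 < c" "0 < \<tau>"
    "\<And>x0 R y z t. x0 \<in> M \<Longrightarrow> y \<in> M \<Longrightarrow> z \<in> M \<Longrightarrow> 0 < R \<Longrightarrow> R \<le> d y z \<Longrightarrow> 0 < t \<Longrightarrow> t \<le> \<tau> * R \<Longrightarrow>
      c * measure \<nu> (mball x0 R) powr (1 / Q)
        \<le> mean_oscillation m (mball x0 (R / (2 * C0))) (smooth_at_scale (\<lambda>x. d (f x0) (f x)) t)"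
proof -
  have Q: "0 < Q" using p by simp
  \<comment> \<open>\<open>\<sigma>\<close>: the concentric ball of radius \<open>\<sigma> * R1\<close> has at most half of the measure.  \<open>E1\<close>: comparability
    of \<open>u\<close> on the annulus.  \<open>\<theta>\<close>: smallness of \<open>u\<close> near the centre.  \<open>E2\<close>: comparison with the ball of radius
    \<open>R\<close>.  \<open>\<rho>\<close>: the inner ball, shrunk so that smoothing does not leave the region where \<open>u\<close> is small.\<close>
  define \<sigma> where "\<sigma> = (1 / (2 * K ^ 2)) powr (1 / Q)"
  have \<sigma>0: "0 < \<sigma>" unfolding \<sigma>_def using K by simp
  have \<sigma>Q: "\<sigma> powr Q = 1 / (2 * K ^ 2)" unfolding \<sigma>_def using K Q by (simp add: powr_powr)
  define E1 where "E1 = max 1 (\<eta> (1 / \<sigma>))"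
  have E1: "1 \<le> E1" "\<eta> (1 / \<sigma>) \<le> E1" by (auto simp: E1_def)
  obtain \<theta> where \<theta>: "0 < \<theta>" "\<eta> \<theta> \<le> 1 / (4 * E1)" using eta_small[of "1 / (4 * E1)"] E1 by auto
  define E2 where "E2 = max 1 (\<eta> (2 * C0 / \<sigma>))"
  have E2: "1 \<le> E2" "\<eta> (2 * C0 / \<sigma>) \<le> E2" by (auto simp: E2_def)
  define \<rho> where "\<rho> = min 1 (\<theta> * \<sigma>) / 2"
  have \<rho>: "0 < \<rho>" "\<rho> \<le> 1 / 2" "\<rho> \<le> \<theta> * \<sigma> / 2" using \<theta> \<sigma>0 by (auto simp: \<rho>_def)
  obtain k :: nat where "1 / \<rho> < 2 ^ k" using real_arch_pow[of 2 "1 / \<rho>"] by auto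
  then have k: "1 \<le> 2 ^ k * \<rho>" using \<rho> by (simp add: field_simps)
  define \<kappa> where "\<kappa> = min (1/2) (1 / C ^ k)"
  have \<kappa>: "0 < \<kappa>" "\<kappa> \<le> 1 / 2" "\<kappa> \<le> 1 / C ^ k" using C_ge_1 by (auto simp: \<kappa>_def)
  define c where "c = \<kappa> / (8 * K powr (1 / Q) * E1 * E2)"
  define \<tau> where "\<tau> = \<theta> * \<sigma> / (8 * C0)"
  show ?thesis
  proof (rule that[of c \<tau>])
    show "0 < c" unfolding c_def using \<kappa> K E1 E2 by simp
    show "0 < \<tau>" unfolding \<tau>_def using \<theta> \<sigma>0 C0 by simp
    fix x0 y z :: 'a and R t :: real
    assume x0: "x0 \<in> M" and yz: "y \<in> M" "z \<in> M" and R: "0 < R" "R \<le> d y z" and t: "0 < t" "t \<le> \<tau> * R"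
    define u where "u x = d (f x0) (f x)" for x
    define R1 where "R1 = R / (2 * C0)"
    have R1: "0 < R1" "R1 \<le> R" "R = 2 * C0 * R1"
      using R C0 unfolding R1_def by (auto simp: divide_le_eq mult_le_cancel_left1 intro: order_trans[of _ 2])
    have t1: "4 * t \<le> \<theta> * \<sigma> * R1" using t C0 unfolding \<tau>_def R1_def by (simp add: field_simps)
    define B1 where "B1 = mball x0 R1"
    define A1 where "A1 = B1 - mball x0 (\<sigma> * R1)"
    define A2 where "A2 = mball x0 (\<rho> * R1)"
    have B1: "B1 \<in> sets m" "emeasure m B1 < \<infinity>" "0 < measure m B1"
      unfolding B1_def using doubling_finite_ball[OF doubling] doubling_pos[OF doubling x0 R1(1)]
      by (auto simp: doubling_sets[OF doubling])
    have A1: "A1 \<in> sets m" "A1 \<subseteq> B1" unfolding A1_def B1_def by (auto simp: doubling_sets[OF doubling])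
    have "\<rho> * R1 \<le> 1 * R1" using \<rho> R1 by (intro mult_right_mono) auto
    then have A2: "A2 \<in> sets m" "A2 \<subseteq> B1" unfolding A2_def B1_def
      using mball_subset_concentric[of "\<rho> * R1" R1 x0] by (simp_all add: doubling_sets[OF doubling])
    have "measure m (mball x0 (\<sigma> * R1)) \<le> K * (\<sigma> * R1) powr Q" using x0 \<sigma>0 R1 by (intro upper) auto
    also have "\<dots> = R1 powr Q / (2 * K)"
      using \<sigma>0 R1 K by (simp add: powr_mult \<sigma>Q power2_eq_square)
    also have "\<dots> \<le> K * measure m B1 / (2 * K)"
      unfolding B1_def using lower[OF x0 yz R1(1)] R1(2) R(2) K by (intro divide_right_mono) auto
    finally have half: "measure m (mball x0 (\<sigma> * R1)) \<le> measure m B1 / 2" using K by simp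
    have "measure m B1 \<le> measure m (A1 \<union> mball x0 (\<sigma> * R1))"
      using A1 unfolding A1_def B1_def
      by (intro doubling_mono[OF doubling, of _ _ x0 "max R1 (\<sigma> * R1)"]) (auto simp: doubling_sets[OF doubling])
    also have "\<dots> \<le> measure m A1 + measure m (mball x0 (\<sigma> * R1))"
      using A1 by (intro measure_Un_le) (auto simp: doubling_sets[OF doubling])
    finally have mA1: "measure m B1 / 2 \<le> measure m A1" using half by linarith
    then have "A1 \<noteq> {}" using B1(3) by (metis half_gt_zero measure_empty not_less)
    then obtain w where w: "w \<in> A1" by blast
    have wM: "w \<in> M" and dw: "\<sigma> * R1 \<le> d x0 w" using w x0 unfolding A1_def B1_def by auto
    have dwp: "0 < d x0 w" using dw \<sigma>0 R1 by (smt (verit) mult_pos_pos)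
    then have uw: "0 < u w" using x0 wM f_inj unfolding u_def by auto
    define M0 where "M0 = u w / E1"
    have M0: "0 < M0" using uw E1 unfolding M0_def by simp
    have bdd: "bdd_above (u ` mball x s)" for x s unfolding u_def using image_distance_bounded[OF x0] .
    have u0: "0 \<le> u x" for x unfolding u_def by simp
    have bigA1: "M0 \<le> u x" if x: "x \<in> A1" for x
    proof -
      have xM: "x \<in> M" "\<sigma> * R1 \<le> d x0 x" using x x0 unfolding A1_def B1_def by auto
      have "d x0 w \<le> R1" using w unfolding A1_def B1_def by auto
      also have "R1 \<le> 1 / \<sigma> * d x0 x" using xM(2) \<sigma>0 by (simp add: field_simps)
      finally have "u w \<le> \<eta> (1 / \<sigma>) * u x" unfolding u_def using x0 wM xM \<sigma>0 by (intro qs) auto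
      also have "\<dots> \<le> E1 * u x" using E1 u0 by (intro mult_right_mono) auto
      finally show ?thesis unfolding M0_def using E1 by (simp add: field_simps)
    qed
    have smallball: "u x \<le> M0 / 4" if x: "x \<in> mball x0 (\<theta> * \<sigma> * R1)" for x
    proof -
      have "d x0 x \<le> \<theta> * (\<sigma> * R1)" using x by (simp add: mult.assoc)
      also have "\<dots> \<le> \<theta> * d x0 w" using dw \<theta> by (intro mult_left_mono) auto
      finally have "u x \<le> \<eta> \<theta> * u w" unfolding u_def using x0 wM x \<theta> by (intro qs) auto
      also have "\<dots> \<le> 1 / (4 * E1) * u w" using \<theta> u0 by (intro mult_right_mono) auto
      finally show ?thesis by (simp add: M0_def)
    qed
    define g where "g = smooth_at_scale u t"
    have gA1: "M0 \<le> g x" if x: "x \<in> A1" for x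
    proof -
      have xM: "x \<in> M" using x unfolding A1_def B1_def by auto
      show ?thesis unfolding g_def
      proof (rule smooth_between(1)[OF bdd t(1) xM, of _ "Sup (u ` mball x (2 * t))"])
        fix s assume s: "s \<in> {t..2*t}"
        have "M0 \<le> Sup (u ` mball x s)"
          using s t xM by (intro cSup_upper2[OF _ bigA1[OF x] bdd]) auto
        moreover have "Sup (u ` mball x s) \<le> Sup (u ` mball x (2*t))"
          using s t xM by (intro ball_sup_mono[OF bdd t(1)] mball_subset_concentric) auto
        ultimately show "M0 \<le> Sup (u ` mball x s) \<and> Sup (u ` mball x s) \<le> Sup (u ` mball x (2*t))" ..
      qed
    qed
    have gA2: "g x \<le> M0 / 4" if x: "x \<in> A2" for x
    proof -
      have xM: "x \<in> M" using x unfolding A2_def by auto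
      show ?thesis unfolding g_def
      proof (rule smooth_between(2)[OF bdd t(1) xM, of 0])
        fix s assume s: "s \<in> {t..2*t}"
        have "x \<in> mball x s" using s t xM by simp
        then have ne: "u ` mball x s \<noteq> {}" and ux: "u x \<in> u ` mball x s" by blast+
        have "\<rho> * R1 \<le> \<theta> * \<sigma> / 2 * R1" using \<rho> R1 by (intro mult_right_mono) auto
        then have "d x0 x + s \<le> \<theta> * \<sigma> * R1" using x s t1 unfolding A2_def by auto
        then have sub: "mball x s \<subseteq> mball x0 (\<theta> * \<sigma> * R1)"
          using x0 by (intro mball_subset) (auto simp: commute)
        have "0 \<le> Sup (u ` mball x s)" by (rule cSup_upper2[OF ux u0 bdd])
        moreover have "Sup (u ` mball x s) \<le> M0 / 4"
          using ne sub smallball by (intro cSup_least) (auto simp del: in_mball)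
        ultimately show "0 \<le> Sup (u ` mball x s) \<and> Sup (u ` mball x s) \<le> M0 / 4" ..
      qed
    qed
    have gbound: "\<bar>g x\<bar> \<le> Sup (u ` mball x0 (R1 + 2 * t))" if x: "x \<in> B1" for x
    proof -
      have xM: "x \<in> M" using x unfolding B1_def by auto
      have *: "0 \<le> Sup (u ` mball x s) \<and> Sup (u ` mball x s) \<le> Sup (u ` mball x0 (R1 + 2 * t))"
        if s: "s \<in> {t..2*t}" for s
      proof
        have "u x \<in> u ` mball x s" using s t xM by auto
        then show "0 \<le> Sup (u ` mball x s)" by (rule cSup_upper2[OF _ u0 bdd])
        have "mball x s \<subseteq> mball x0 (R1 + 2 * t)"
          using x0 x s unfolding B1_def by (intro mball_subset) (auto simp: commute)
        then show "Sup (u ` mball x s) \<le> Sup (u ` mball x0 (R1 + 2 * t))"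
          using s t xM by (intro ball_sup_mono[OF bdd t(1)]) auto
      qed
      show ?thesis
        using smooth_between[OF bdd t(1) xM *] unfolding g_def by simp
    qed
    have bddb: "bdd_below (u ` S)" for S using u0 by (intro bdd_belowI[of _ 0]) auto
    have gm: "g \<in> borel_measurable m"
      unfolding g_def by (rule continuous_map_borel_measurable[OF smooth_continuous[OF bdd t(1)] doubling_sets[OF doubling]])
    have gint: "set_integrable m B1 g"
      unfolding set_integrable_def using B1 gm gbound
      by (intro integrableI_bounded_set_indicator[where B="Sup (u ` mball x0 (R1 + 2 * t))"] AE_I2) auto
    have "B1 \<subseteq> mball x0 (2 ^ k * (\<rho> * R1))"
      unfolding B1_def using k R1 mult_right_mono[of 1 "2 ^ k * \<rho>" R1] by (intro mball_subset_concentric) (simp add: mult.assoc)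
    then have "measure m B1 \<le> C ^ k * measure m A2"
      unfolding A2_def using x0 \<rho> R1 by (intro doubling_engulf[OF doubling]) auto
    then have "1 / C ^ k * measure m B1 \<le> measure m A2" using C_ge_1 by (simp add: field_simps)
    moreover have "\<kappa> * measure m B1 \<le> 1 / C ^ k * measure m B1" using \<kappa> by (intro mult_right_mono) auto
    moreover have "\<kappa> * measure m B1 \<le> 1 / 2 * measure m B1" using \<kappa> by (intro mult_right_mono) auto
    ultimately have osc: "\<kappa> * M0 / 4 \<le> mean_oscillation m B1 g"
      using mA1 by (intro mean_oscillation_ge[OF B1 gint A1 A2 gA1 gA2 M0]) auto
    have "f ` mball x0 R \<subseteq> mball (f x0) (2 * E2 * u w)"
    proof (rule image_ball_bounded[OF x0 wM])
      have "R \<le> 2 * C0 / \<sigma> * (\<sigma> * R1)" using R1 \<sigma>0 by simp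
      also have "\<dots> \<le> 2 * C0 / \<sigma> * d x0 w" using dw \<sigma>0 C0 by (intro mult_left_mono) auto
      finally show "R \<le> 2 * C0 / \<sigma> * d x0 w" .
      show "0 < 2 * C0 / \<sigma>" using C0 \<sigma>0 by simp
      have "\<eta> (2 * C0 / \<sigma>) * u w \<le> E2 * u w" using E2 uw by (intro mult_right_mono) auto
      also have "\<dots> < 2 * E2 * u w" using E2 uw by simp
      finally show "\<eta> (2 * C0 / \<sigma>) * d (f x0) (f w) < 2 * E2 * u w" unfolding u_def .
    qed
    then have "measure \<nu> (mball x0 R) \<le> measure m (mball (f x0) (2 * E2 * u w))"
      by (simp add: measure_nu doubling_mono[OF doubling, of _ _ "f x0" "2 * E2 * u w"] doubling_sets[OF doubling])
    also have "\<dots> \<le> K * (2 * E2 * u w) powr Q" using x0 E2 uw by (intro upper) auto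
    finally have "measure \<nu> (mball x0 R) powr (1 / Q) \<le> (K * (2 * E2 * u w) powr Q) powr (1 / Q)"
      using Q by (intro powr_mono2) auto
    also have "\<dots> = K powr (1 / Q) * (2 * E2 * u w)"
      using Q K E2 uw by (simp add: powr_mult powr_powr)
    finally have "c * measure \<nu> (mball x0 R) powr (1 / Q) \<le> c * (K powr (1 / Q) * (2 * E2 * u w))"
      using \<open>0 < c\<close> by (intro mult_left_mono) auto
    also have "\<dots> = \<kappa> * M0 / 4"
      unfolding c_def M0_def using K E1 E2 by (simp add: field_simps)
    finally show "c * measure \<nu> (mball x0 R) powr (1 / Q)
        \<le> mean_oscillation m (mball x0 (R / (2 * C0))) (smooth_at_scale (\<lambda>x. d (f x0) (f x)) t)"
      using osc unfolding g_def B1_def R1_def u_def[abs_def] by linarith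
  qed
qed

end

section \<open>The Poincare inequality at a small scale\<close>

lemma ennreal_powr_le:
  assumes "x \<le> ennreal r" "0 \<le> r" "0 \<le> s"
  shows "ennreal_powr x s \<le> ennreal (r powr s)"
proof -
  have "x \<noteq> \<infinity>" using assms(1) by (metis ennreal_neq_top infinity_ennreal_def top_unique)
  moreover have "enn2real x \<le> r" using enn2real_mono[OF assms(1)] assms(2) by simp
  ultimately show ?thesis using assms unfolding ennreal_powr_def by (auto intro!: ennreal_leI powr_mono2)
qed

lemma exists_small_powr_sum:
  fixes s e :: real
  assumes "0 < s" "s < 1" "0 < e"
  obtains a where "0 < a" "a < 1" "a powr (1 - s) + a powr s < e"
proof -
  define e' where "e' = e / 4"
  define a where "a = min (1/2) (min (e' powr (1 / s)) (e' powr (1 / (1 - s))))"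
  have e': "0 < e'" using assms by (simp add: e'_def)
  have a: "0 < a" "a \<le> 1/2" "a \<le> e' powr (1 / s)" "a \<le> e' powr (1 / (1 - s))"
    using e' by (auto simp: a_def)
  have "a powr s \<le> (e' powr (1 / s)) powr s" using a assms by (intro powr_mono2) auto
  moreover have "a powr (1 - s) \<le> (e' powr (1 / (1 - s))) powr (1 - s)" using a assms by (intro powr_mono2) auto
  ultimately have "a powr (1 - s) + a powr s \<le> 2 * e'" using e' assms by (simp add: powr_powr)
  also have "\<dots> < e" using assms by (simp add: e'_def)
  finally show ?thesis using a by (intro that[of a]) auto
qed

context qs_poincare_space
begin

lemma nu_ball_measurable: "(\<lambda>y. measure \<nu> (mball y t \<inter> Z)) \<in> borel_measurable m"
  if "Z \<in> sets (borel_of mtopology)"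
  unfolding measure_def using ball_measure_measurable[OF doubling nu that] by measurable

text \<open>
  By \<open>smooth_lipschitz\<close> and \<open>distortion_le_nu\<close> the function
  \<open>y \<mapsto> K1 / t * measure \<nu> (mball y t) powr (1 / Q)\<close> is a very weak gradient of the smoothed distance.
\<close>

lemma smooth_poincare:
  obtains Cp C0 K1 where "1 \<le> Cp" "1 \<le> C0" "0 < K1"
    "\<And>x0 R t. x0 \<in> M \<Longrightarrow> 0 < R \<Longrightarrow> 0 < t \<Longrightarrow>
      ennreal (mean_oscillation m (mball x0 (R / (2 * C0))) (smooth_at_scale (\<lambda>x. d (f x0) (f x)) t)) \<le>
      ennreal (Cp * R) * ennreal_powr ((ennreal ((K1 / t) powr p) *
        (\<integral>\<^sup>+y\<in>mball x0 (R / 2). ennreal (measure \<nu> (mball y t) powr (p / Q)) \<partial>m)) / emeasure m (mball x0 (R / 2))) (1 / p)"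
proof -
  obtain Cp C0 where Cp: "1 \<le> Cp" and C0: "1 \<le> C0" and
    PI0: "\<forall>x\<in>M. \<forall>r>0. \<forall>u g.
         continuous_map (subtopology mtopology (mball x (C0 * r))) euclideanreal u \<and>
         bounded (u ` mball x (C0 * r)) \<and> very_weak_gradient M d (mball x (C0 * r)) u g \<longrightarrow>
         ennreal (mean_oscillation m (mball x r) u) \<le>
           ennreal Cp * diam_of d (mball x r) *
           ennreal_powr ((\<integral>\<^sup>+ y\<in>mball x (C0 * r). ennreal_powr (g y) p \<partial>m) / emeasure m (mball x (C0 * r))) (1 / p)"
    using poincare unfolding weak_poincare_def Let_def by (elim exE conjE) (rule that)
  have PI: "ennreal (mean_oscillation m (mball x r) u) \<le>
           ennreal Cp * diam_of d (mball x r) *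
           ennreal_powr ((\<integral>\<^sup>+ y\<in>mball x (C0 * r). ennreal_powr (g y) p \<partial>m) / emeasure m (mball x (C0 * r))) (1 / p)"
    if "x \<in> M" "0 < r" "continuous_map (subtopology mtopology (mball x (C0 * r))) euclideanreal u"
      "bounded (u ` mball x (C0 * r))" "very_weak_gradient M d (mball x (C0 * r)) u g" for x r u g
    by (rule PI0[rule_format]) (use that in auto)
  obtain K1 where K1: "0 < K1" and dist: "\<And>x y t. x \<in> M \<Longrightarrow> y \<in> M \<Longrightarrow> 0 < t \<Longrightarrow> d x y \<le> 4 * t \<Longrightarrow>
     d (f x) (f y) \<le> K1 * measure \<nu> (mball x t) powr (1 / Q)"
    by (rule distortion_le_nu) (rule that)
  show ?thesis
  proof (rule that[OF Cp C0 K1])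
    fix x0 and R t :: real assume x0: "x0 \<in> M" and R: "0 < R" and t: "0 < t"
    define u where "u x = d (f x0) (f x)" for x
    define G where "G y = ennreal (K1 / t * measure \<nu> (mball y t) powr (1 / Q))" for y
    define r where "r = R / (2 * C0)"
    have r: "0 < r" "C0 * r = R / 2" "2 * r \<le> R" using R C0 unfolding r_def by (auto simp: field_simps)
    have bdd: "bdd_above (u ` mball x s)" for x s unfolding u_def using image_distance_bounded[OF x0] .
    have u0: "0 \<le> u x" for x unfolding u_def by simp
    have bound: "\<bar>smooth_at_scale u t x\<bar> \<le> Sup (u ` mball x0 (R/2 + 2 * t))" if x: "x \<in> mball x0 (R/2)" for x
    proof -
      have xM: "x \<in> M" using x by auto
      have *: "0 \<le> Sup (u ` mball x s) \<and> Sup (u ` mball x s) \<le> Sup (u ` mball x0 (R/2 + 2 * t))"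
        if s: "s \<in> {t..2*t}" for s
      proof
        have "u x \<in> u ` mball x s" using s t xM by auto
        then show "0 \<le> Sup (u ` mball x s)" by (rule cSup_upper2[OF _ u0 bdd])
        have "mball x s \<subseteq> mball x0 (R/2 + 2 * t)"
          using x0 x s by (intro mball_subset) (auto simp: commute)
        then show "Sup (u ` mball x s) \<le> Sup (u ` mball x0 (R/2 + 2 * t))"
          using s t xM by (intro ball_sup_mono[OF bdd t]) auto
      qed
      show ?thesis using smooth_between[OF bdd t xM *] by simp
    qed
    have "ennreal (mean_oscillation m (mball x0 r) (smooth_at_scale u t)) \<le>
       ennreal Cp * diam_of d (mball x0 r) *
       ennreal_powr ((\<integral>\<^sup>+ y\<in>mball x0 (C0 * r). ennreal_powr (G y) p \<partial>m) / emeasure m (mball x0 (C0 * r))) (1 / p)"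
    proof (rule PI[OF x0 r(1)])
      show "continuous_map (subtopology mtopology (mball x0 (C0 * r))) euclideanreal (smooth_at_scale u t)"
        using smooth_continuous[OF bdd t] by (rule continuous_map_from_subtopology)
      show "bounded (smooth_at_scale u t ` mball x0 (C0 * r))"
        unfolding bounded_iff r(2) using bound by (intro exI[of _ "Sup (u ` mball x0 (R/2 + 2 * t))"]) auto
      show "very_weak_gradient M d (mball x0 (C0 * r)) (smooth_at_scale u t) G"
      proof (rule very_weak_gradientI[OF _ t])
        have "(\<lambda>y. measure \<nu> (mball y t)) \<in> borel_measurable (borel_of (subtopology mtopology (mball x0 (C0 * r))))"
        proof (rule borel_measurable_borel_of_lsc)
          fix c
          have "{x \<in> topspace (subtopology mtopology (mball x0 (C0 * r))). c < measure \<nu> (mball x t)}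
            = mball x0 (C0 * r) \<inter> {y \<in> M. c < measure \<nu> (mball y t)}" by auto
          then show "openin (subtopology mtopology (mball x0 (C0 * r)))
             {x \<in> topspace (subtopology mtopology (mball x0 (C0 * r))). c < measure \<nu> (mball x t)}"
            using ball_measure_lsc[OF nu, of c t] by (simp add: openin_subtopology_Int2)
        qed
        then show "G \<in> borel_measurable (borel_of (subtopology mtopology (mball x0 (C0 * r))))"
          unfolding G_def by measurable
        fix x y assume xy: "x \<in> mball x0 (C0 * r)" "y \<in> mball x0 (C0 * r)" "d x y < t"
        have "\<bar>smooth_at_scale u t x - smooth_at_scale u t y\<bar> \<le> d x y / t * (K1 * measure \<nu> (mball y t) powr (1 / Q))"
        proof (rule smooth_lipschitz[OF bdd t])
          fix z assume z: "z \<in> mball y (4 * t)"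
          have "u z \<le> u y + d (f y) (f z)" unfolding u_def using x0 xy z by (intro triangle) auto
          moreover have "d (f y) (f z) \<le> K1 * measure \<nu> (mball y t) powr (1 / Q)"
            using z t by (intro dist) auto
          ultimately show "u z - u y \<le> K1 * measure \<nu> (mball y t) powr (1 / Q)" by linarith
        qed (use xy in auto)
        then have "ennreal \<bar>smooth_at_scale u t x - smooth_at_scale u t y\<bar>
          \<le> ennreal (d x y * (K1 / t * measure \<nu> (mball y t) powr (1 / Q)))" by (intro ennreal_leI) simp
        also have "\<dots> = ennreal (d x y) * G y" unfolding G_def using K1 t by (intro ennreal_mult) auto
        finally show "ennreal \<bar>smooth_at_scale u t x - smooth_at_scale u t y\<bar> \<le> ennreal (d x y) * G y" .
      qed
    qed
    also have "(\<integral>\<^sup>+ y\<in>mball x0 (C0 * r). ennreal_powr (G y) p \<partial>m)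
       = (\<integral>\<^sup>+ y. ennreal ((K1 / t) powr p) * (ennreal (measure \<nu> (mball y t) powr (p / Q)) * indicator (mball x0 (R/2)) y) \<partial>m)"
    proof (rule nn_integral_cong)
      fix y
      have "ennreal_powr (G y) p = ennreal ((K1 / t) powr p * measure \<nu> (mball y t) powr (p / Q))"
        unfolding ennreal_powr_def G_def
        using K1 t powr_mult[of "K1 / t" "measure \<nu> (mball y t) powr (1 / Q)" p]
        by (simp only: enn2real_ennreal mult_nonneg_nonneg divide_nonneg_nonneg powr_ge_zero less_imp_le)
          (simp add: powr_powr)
      also have "\<dots> = ennreal ((K1 / t) powr p) * ennreal (measure \<nu> (mball y t) powr (p / Q))" by (intro ennreal_mult) auto
      finally show "ennreal_powr (G y) p * indicator (mball x0 (C0 * r)) y =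
         ennreal ((K1 / t) powr p) * (ennreal (measure \<nu> (mball y t) powr (p / Q)) * indicator (mball x0 (R/2)) y)"
        by (simp add: r(2) mult.assoc)
    qed
    also have "\<dots> = ennreal ((K1 / t) powr p) * (\<integral>\<^sup>+y\<in>mball x0 (R / 2). ennreal (measure \<nu> (mball y t) powr (p / Q)) \<partial>m)"
    proof (rule nn_integral_cmult)
      have "M \<in> sets (borel_of mtopology)" using sets.top[of "borel_of mtopology"] by simp
      from nu_ball_measurable[OF this, of t] have "(\<lambda>y. measure \<nu> (mball y t)) \<in> borel_measurable m"
        by (simp add: Int_absorb2 mball_subset_mspace)
      moreover have "mball x0 (R/2) \<in> sets m" by (simp add: doubling_sets[OF doubling])
      ultimately show "(\<lambda>y. ennreal (measure \<nu> (mball y t) powr (p / Q)) * indicator (mball x0 (R/2)) y) \<in> borel_measurable m"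
        by measurable
    qed
    also have "ennreal Cp * diam_of d (mball x0 r) \<le> ennreal (Cp * R)"
    proof -
      have "diam_of d (mball x0 r) \<le> ennreal R"
        unfolding diam_of_def
      proof (intro SUP_least ennreal_leI)
        fix x y assume xy: "x \<in> mball x0 r" "y \<in> mball x0 r"
        then have "d x y \<le> d x0 x + d x0 y" by (auto intro: triangle'')
        then show "d x y \<le> R" using xy r by auto
      qed
      then have "ennreal Cp * diam_of d (mball x0 r) \<le> ennreal Cp * ennreal R" by (rule mult_left_mono) simp
      then show ?thesis using Cp R by (simp add: ennreal_mult)
    qed
    finally show "ennreal (mean_oscillation m (mball x0 (R / (2 * C0))) (smooth_at_scale (\<lambda>x. d (f x0) (f x)) t)) \<le>
      ennreal (Cp * R) * ennreal_powr ((ennreal ((K1 / t) powr p) *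
        (\<integral>\<^sup>+y\<in>mball x0 (R / 2). ennreal (measure \<nu> (mball y t) powr (p / Q)) \<partial>m)) / emeasure m (mball x0 (R / 2))) (1 / p)"
      unfolding r(2) by (simp add: u_def[abs_def] r_def mult_right_mono)
  qed
qed

lemma truncated_integral:
  assumes A: "A \<in> sets (borel_of mtopology)" "A \<subseteq> mball x0 R"
    and Z: "Z \<in> sets (borel_of mtopology)" "Z \<subseteq> mball x0 R"
    and s: "0 < s" "s < 1" and l: "0 < l" and t: "0 < t"
  shows "(\<integral>\<^sup>+y\<in>A. ennreal (measure \<nu> (mball y t \<inter> Z) powr s) \<partial>m)
    \<le> ennreal (l powr s * measure m A + l powr (s - 1) * (K * t powr Q * measure \<nu> Z))"
proof -
  have Am: "A \<in> sets m" using A doubling_sets[OF doubling] by simp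
  have meas: "(\<lambda>y. emeasure \<nu> (mball y t \<inter> Z)) \<in> borel_measurable m"
    using ball_measure_measurable[OF doubling nu Z(1)] .
  have "(\<integral>\<^sup>+y\<in>A. ennreal (measure \<nu> (mball y t \<inter> Z) powr s) \<partial>m)
    \<le> (\<integral>\<^sup>+y. ennreal (l powr s) * indicator A y + ennreal (l powr (s - 1)) * emeasure \<nu> (mball y t \<inter> Z) \<partial>m)"
  proof (rule nn_integral_mono)
    fix y
    have "ennreal (measure \<nu> (mball y t \<inter> Z) powr s) \<le> ennreal (l powr s + l powr (s - 1) * measure \<nu> (mball y t \<inter> Z))"
      using s l by (intro ennreal_leI powr_truncation) auto
    also have "\<dots> = ennreal (l powr s) + ennreal (l powr (s - 1)) * emeasure \<nu> (mball y t \<inter> Z)"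
      using l doubling_emeasure[OF nu, of "mball y t \<inter> Z" y t] by (simp add: ennreal_plus ennreal_mult)
    finally show "ennreal (measure \<nu> (mball y t \<inter> Z) powr s) * indicator A y
       \<le> ennreal (l powr s) * indicator A y + ennreal (l powr (s - 1)) * emeasure \<nu> (mball y t \<inter> Z)"
      by (auto simp: indicator_def)
  qed
  also have "\<dots> = ennreal (l powr s) * emeasure m A + ennreal (l powr (s - 1)) * (\<integral>\<^sup>+y. emeasure \<nu> (mball y t \<inter> Z) \<partial>m)"
    using Am meas by (subst nn_integral_add) (auto simp: nn_integral_cmult nn_integral_cmult_indicator)
  also have "\<dots> \<le> ennreal (l powr s) * emeasure m A + ennreal (l powr (s - 1)) * (ennreal (K * t powr Q) * emeasure \<nu> Z)"
  proof (intro add_left_mono mult_left_mono integral_ball_measure_le[OF doubling nu Z(1)])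
    fix x assume "x \<in> M"
    then show "emeasure m (mball x t) \<le> ennreal (K * t powr Q)"
      using upper[of x t] t doubling_emeasure[OF doubling, of "mball x t" x t] by (simp add: ennreal_leI)
  qed simp
  also have "\<dots> = ennreal (l powr s * measure m A + l powr (s - 1) * (K * t powr Q * measure \<nu> Z))"
    using K l by (simp add: doubling_emeasure[OF doubling A(2)] doubling_emeasure[OF nu Z(2)] ennreal_mult ennreal_plus)
  finally show ?thesis .
qed

text \<open>
  The sets of points whose distance to the complement of \<open>F\<close> is at least \<open>1 / Suc k\<close> increase to the open set \<open>F\<close>.
\<close>

lemma far_from_boundary:
  assumes F: "openin mtopology F" "F \<subseteq> mball x0 R" and v: "v < measure \<nu> F"
  obtains e Z where "0 < e" "Z \<in> sets (borel_of mtopology)" "Z \<subseteq> F" "v < measure \<nu> Z"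
    "\<And>y z. z \<in> Z \<Longrightarrow> y \<in> M \<Longrightarrow> d y z < e \<Longrightarrow> y \<in> F"
proof -
  define Z where "Z k = M - (\<Union>w\<in>M - F. mball w (1 / real (Suc k)))" for k
  have FM: "F \<subseteq> M" using F by auto
  have Zb: "Z k \<in> sets (borel_of mtopology)" for k
  proof -
    have "openin mtopology (\<Union>w\<in>M - F. mball w (1 / real (Suc k)))" by blast
    then show ?thesis using sets.compl_sets[OF openin_imp_borel, of mtopology] unfolding Z_def by simp
  qed
  have near: "y \<in> F" if "z \<in> Z k" "y \<in> M" "d y z < 1 / real (Suc k)" for y z k
    using that unfolding Z_def by auto
  have ZF: "Z k \<subseteq> F" for k
  proof
    fix z assume z: "z \<in> Z k"
    then have "z \<in> M" by (simp add: Z_def)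
    then show "z \<in> F" using near[OF z, of z] by simp
  qed
  have un: "(\<Union>k. Z k) = F"
  proof (intro equalityI subsetI)
    fix x assume x: "x \<in> F"
    then obtain r where r: "0 < r" "mball x r \<subseteq> F" using F(1) unfolding openin_mtopology by blast
    obtain k where k: "1 / real (Suc k) < r" using nat_approx_posE[OF r(1)] .
    have "x \<notin> mball w (1 / real (Suc k))" if w: "w \<in> M - F" for w
    proof
      assume "x \<in> mball w (1 / real (Suc k))"
      then have "w \<in> mball x r" using k w by (auto simp: commute)
      then show False using r w by blast
    qed
    then show "x \<in> (\<Union>k. Z k)" using x FM unfolding Z_def by blast
  qed (use ZF in blast)
  have "incseq Z"
  proof (rule incseq_SucI, rule subsetI)
    fix k x assume x: "x \<in> Z k"
    have "mball w (1 / real (Suc (Suc k))) \<subseteq> mball w (1 / real (Suc k))" for w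
      by (intro mball_subset_concentric divide_left_mono) auto
    then show "x \<in> Z (Suc k)" using x unfolding Z_def by blast
  qed
  then have "(\<lambda>k. measure \<nu> (Z k)) \<longlonglongrightarrow> measure \<nu> F"
    using Lim_measure_incseq[of Z \<nu>] un doubling_finite[OF nu F(2)] Zb by (auto simp: less_top)
  then obtain k where "v < measure \<nu> (Z k)"
    using order_tendstoD(1)[OF _ v] eventually_happens'[OF sequentially_bot] by blast
  then show ?thesis using near Zb ZF by (intro that[of "1 / real (Suc k)" "Z k"]) auto
qed

text \<open>
  Split \<open>\<nu>\<close> on the ball into its parts on \<open>Z\<close> and off \<open>Z\<close>.  The measure of balls under the first part vanishes for
  centres outside \<open>F\<close>, a set with small \<open>m\<close>-measure, and the second part has small total mass.  Each part is
  estimated by \<open>truncated_integral\<close>, with truncation at \<open>1 / a\<close> times and at \<open>a\<close> times the average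
  \<open>t powr Q * \<nu> B / m B\<close>; both estimates tend to zero with \<open>a\<close> because \<open>0 < p / Q < 1\<close>.
\<close>

lemma nu_integral_bound:
  assumes x0: "x0 \<in> M" and R: "0 < R" and t: "0 < t" "t \<le> R / 2" and a: "0 < a"
    and F: "F \<in> sets (borel_of mtopology)" "F \<subseteq> mball x0 R" "measure m F \<le> a * measure m (mball x0 R)"
    and Z: "Z \<in> sets (borel_of mtopology)" "Z \<subseteq> F" "\<And>y z. z \<in> Z \<Longrightarrow> y \<in> M \<Longrightarrow> d y z < t \<Longrightarrow> y \<in> F"
    and rest: "measure \<nu> (mball x0 R - Z) \<le> a * measure \<nu> (mball x0 R)"
  shows "(\<integral>\<^sup>+y\<in>mball x0 (R / 2). ennreal (measure \<nu> (mball y t) powr (p / Q)) \<partial>m)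
    \<le> ennreal (2 * (1 + K) * (a powr (1 - p / Q) + a powr (p / Q)) *
        (t powr p * (measure \<nu> (mball x0 R) / measure m (mball x0 R)) powr (p / Q)) * measure m (mball x0 R))"
proof -
  define s where "s = p / Q"
  have s: "0 < s" "s < 1" "Q * s = p" using p by (auto simp: s_def)
  define B where "B = mball x0 R"
  define V where "V = measure \<nu> B"
  define b where "b = measure m B"
  have V: "0 < V" unfolding V_def B_def using doubling_pos[OF nu x0 R] .
  have b: "0 < b" unfolding b_def B_def using doubling_pos[OF doubling x0 R] .
  define \<Lambda> where "\<Lambda> = t powr Q * V / b"
  have \<Lambda>: "0 < \<Lambda>" using t V b by (simp add: \<Lambda>_def)
  have \<Lambda>s: "\<Lambda> powr s = t powr p * (V / b) powr s"
    unfolding \<Lambda>_def using t V b s powr_mult[of "t powr Q" "V / b" s] by (simp add: powr_powr)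
  have Bb: "B \<in> sets (borel_of mtopology)" unfolding B_def by simp
  have ZB: "Z \<subseteq> B" using Z F unfolding B_def by blast
  have W: "B - Z \<in> sets (borel_of mtopology)" using Z Bb by blast
  define h1 where "h1 y = measure \<nu> (mball y t \<inter> Z)" for y
  define h2 where "h2 y = measure \<nu> (mball y t \<inter> (B - Z))" for y
  have m1: "h1 \<in> borel_measurable m" "h2 \<in> borel_measurable m"
    unfolding h1_def h2_def using nu_ball_measurable Z(1) W by auto
  have Bm: "B \<in> sets m" "F \<in> sets m" using Bb F doubling_sets[OF doubling] by auto
  have split: "ennreal (measure \<nu> (mball y t) powr s) * indicator (mball x0 (R / 2)) y
    \<le> 2 * (ennreal (h1 y powr s) * indicator F y) + 2 * (ennreal (h2 y powr s) * indicator B y)" for y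
  proof (cases "y \<in> mball x0 (R / 2)")
    case True
    then have yB: "y \<in> B" unfolding B_def using R by auto
    have sub: "mball y t \<subseteq> B" unfolding B_def using True t x0 by (intro mball_subset) (auto simp: commute)
    then have "mball y t = (mball y t \<inter> Z) \<union> (mball y t \<inter> (B - Z))" by blast
    then have "measure \<nu> (mball y t) \<le> h1 y + h2 y"
      unfolding h1_def h2_def using Z W by (metis measure_Un_le mball_borel sets.Int sets_nu)
    then have "measure \<nu> (mball y t) powr s \<le> (h1 y + h2 y) powr s" using s by (intro powr_mono2) auto
    also have "\<dots> \<le> 2 * (h1 y powr s + h2 y powr s)"
      using s by (intro powr_add_le) (auto simp: h1_def h2_def)
    finally have le: "measure \<nu> (mball y t) powr s \<le> 2 * (h1 y powr s + h2 y powr s)" .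
    have zero: "h1 y = 0" if "y \<notin> F"
    proof -
      have "mball y t \<inter> Z = {}" using Z(3) that by auto
      then show ?thesis by (simp add: h1_def)
    qed
    have "ennreal (measure \<nu> (mball y t) powr s) \<le> ennreal (2 * (h1 y powr s) + 2 * (h2 y powr s))"
      using le by (intro ennreal_leI) simp
    also have "\<dots> = 2 * ennreal (h1 y powr s) + 2 * ennreal (h2 y powr s)"
      by (simp add: ennreal_plus ennreal_mult)
    also have "\<dots> = 2 * (ennreal (h1 y powr s) * indicator F y) + 2 * (ennreal (h2 y powr s) * indicator B y)"
      using zero yB by (auto simp: indicator_def)
    finally show ?thesis using True by simp
  qed simp
  have "(\<integral>\<^sup>+y\<in>mball x0 (R / 2). ennreal (measure \<nu> (mball y t) powr s) \<partial>m)
    \<le> (\<integral>\<^sup>+y. 2 * (ennreal (h1 y powr s) * indicator F y) + 2 * (ennreal (h2 y powr s) * indicator B y) \<partial>m)"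
    using split by (rule nn_integral_mono)
  also have "\<dots> = 2 * (\<integral>\<^sup>+y\<in>F. ennreal (h1 y powr s) \<partial>m) + 2 * (\<integral>\<^sup>+y\<in>B. ennreal (h2 y powr s) \<partial>m)"
    using m1 Bm by (subst nn_integral_add) (auto simp: nn_integral_cmult)
  also have "\<dots> \<le> 2 * ennreal ((1 + K) * a powr (1 - s) * \<Lambda> powr s * b) + 2 * ennreal ((1 + K) * a powr s * \<Lambda> powr s * b)"
  proof (intro add_mono mult_left_mono)
    have "(\<integral>\<^sup>+y\<in>F. ennreal (h1 y powr s) \<partial>m)
      \<le> ennreal ((\<Lambda> / a) powr s * measure m F + (\<Lambda> / a) powr (s - 1) * (K * t powr Q * measure \<nu> Z))"
      unfolding h1_def using F Z ZB s \<Lambda> a t unfolding B_def by (intro truncated_integral) auto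
    also have "\<dots> \<le> ennreal ((\<Lambda> / a) powr s * (a * b) + (\<Lambda> / a) powr (s - 1) * (K * t powr Q * V))"
    proof (intro ennreal_leI add_mono mult_left_mono)
      show "measure \<nu> Z \<le> V" unfolding V_def using ZB Bb
        by (intro doubling_mono[OF nu, of _ _ x0 R]) (auto simp: B_def)
      show "measure m F \<le> a * b" using F(3) by (simp add: b_def B_def)
    qed (use K in auto)
    also have "(\<Lambda> / a) powr s * (a * b) + (\<Lambda> / a) powr (s - 1) * (K * t powr Q * V) = (1 + K) * a powr (1 - s) * \<Lambda> powr s * b"
    proof -
      have "t powr Q * V = \<Lambda> * b" using b by (simp add: \<Lambda>_def)
      then have 1: "K * t powr Q * V = K * (\<Lambda> / a) * (a * b)" using a by (simp add: field_simps)
      have "(\<Lambda> / a) powr (s - 1) * (\<Lambda> / a) = (\<Lambda> / a) powr s"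
        using \<Lambda> a powr_add[of "\<Lambda> / a" "s - 1" 1] by simp
      then have 2: "(\<Lambda> / a) powr (s - 1) * (K * t powr Q * V) = K * ((\<Lambda> / a) powr s * (a * b))"
        unfolding 1 by (metis mult.assoc mult.commute)
      have "(\<Lambda> / a) powr s * a = \<Lambda> powr s * a powr (1 - s)"
        using \<Lambda> a by (simp add: powr_divide powr_diff)
      then have 3: "(\<Lambda> / a) powr s * (a * b) = \<Lambda> powr s * a powr (1 - s) * b" by (metis mult.assoc)
      show ?thesis unfolding 2 3 by (simp add: algebra_simps)
    qed
    finally show "(\<integral>\<^sup>+y\<in>F. ennreal (h1 y powr s) \<partial>m) \<le> ennreal ((1 + K) * a powr (1 - s) * \<Lambda> powr s * b)" .
    have "(\<integral>\<^sup>+y\<in>B. ennreal (h2 y powr s) \<partial>m)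
      \<le> ennreal ((a * \<Lambda>) powr s * measure m B + (a * \<Lambda>) powr (s - 1) * (K * t powr Q * measure \<nu> (B - Z)))"
      unfolding h2_def using Bb W s \<Lambda> a t unfolding B_def by (intro truncated_integral) auto
    also have "\<dots> \<le> ennreal ((a * \<Lambda>) powr s * b + (a * \<Lambda>) powr (s - 1) * (K * t powr Q * (a * V)))"
      unfolding b_def using rest K by (intro ennreal_leI add_mono mult_left_mono) (auto simp: B_def V_def)
    also have "(a * \<Lambda>) powr s * b + (a * \<Lambda>) powr (s - 1) * (K * t powr Q * (a * V)) = (1 + K) * a powr s * \<Lambda> powr s * b"
    proof -
      have "t powr Q * V = \<Lambda> * b" using b by (simp add: \<Lambda>_def)
      then have 1: "K * t powr Q * (a * V) = K * (a * \<Lambda>) * b" by (simp add: field_simps)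
      have "(a * \<Lambda>) powr (s - 1) * (a * \<Lambda>) = (a * \<Lambda>) powr s"
        using \<Lambda> a powr_add[of "a * \<Lambda>" "s - 1" 1] by simp
      then have 2: "(a * \<Lambda>) powr (s - 1) * (K * t powr Q * (a * V)) = K * (a * \<Lambda>) powr s * b"
        unfolding 1 by (simp add: algebra_simps)
      show ?thesis unfolding 2 using a \<Lambda> by (simp add: powr_mult algebra_simps)
    qed
    finally show "(\<integral>\<^sup>+y\<in>B. ennreal (h2 y powr s) \<partial>m) \<le> ennreal ((1 + K) * a powr s * \<Lambda> powr s * b)" .
  qed auto
  also have "\<dots> = ennreal (2 * ((1 + K) * a powr (1 - s) * \<Lambda> powr s * b) + 2 * ((1 + K) * a powr s * \<Lambda> powr s * b))"
    using K b by (simp add: ennreal_plus ennreal_mult)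
  also have "2 * ((1 + K) * a powr (1 - s) * \<Lambda> powr s * b) + 2 * ((1 + K) * a powr s * \<Lambda> powr s * b)
     = 2 * (1 + K) * (a powr (1 - s) + a powr s) * (t powr p * (V / b) powr s) * b"
    unfolding \<Lambda>s by (simp add: algebra_simps)
  finally show ?thesis unfolding s_def V_def b_def B_def .
qed

text \<open>
  The key estimate.  If \<open>F\<close> had small measure but carried almost all of \<open>\<nu>\<close>, then the right-hand side of the
  Poincare inequality for the distance function, smoothed at a scale much smaller than the distance of most of
  \<open>F\<close> to its boundary, would be small by \<open>nu_integral_bound\<close>, contradicting \<open>oscillation_ge_nu\<close>.
\<close>

lemma small_measure_misses_image:
  obtains a where "0 < a" "a < 1"
    "\<And>x0 R y z F. x0 \<in> M \<Longrightarrow> y \<in> M \<Longrightarrow> z \<in> M \<Longrightarrow> 0 < R \<Longrightarrow> R \<le> d y z \<Longrightarrow> openin mtopology F \<Longrightarrow>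
       measure m (F \<inter> mball x0 R) \<le> a * measure m (mball x0 R) \<Longrightarrow>
       measure \<nu> (F \<inter> mball x0 R) \<le> (1 - a) * measure \<nu> (mball x0 R)"
proof -
  obtain Cp C0 K1 where Cp: "1 \<le> Cp" and C0: "1 \<le> C0" and K1: "0 < K1" and PI:
    "\<And>x0 R t. x0 \<in> M \<Longrightarrow> 0 < R \<Longrightarrow> 0 < t \<Longrightarrow>
      ennreal (mean_oscillation m (mball x0 (R / (2 * C0))) (smooth_at_scale (\<lambda>x. d (f x0) (f x)) t)) \<le>
      ennreal (Cp * R) * ennreal_powr ((ennreal ((K1 / t) powr p) *
        (\<integral>\<^sup>+y\<in>mball x0 (R / 2). ennreal (measure \<nu> (mball y t) powr (p / Q)) \<partial>m)) / emeasure m (mball x0 (R / 2))) (1 / p)"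
    by (rule smooth_poincare) (rule that)
  obtain c \<tau> where c: "0 < c" and \<tau>: "0 < \<tau>" and osc:
    "\<And>x0 R y z t. x0 \<in> M \<Longrightarrow> y \<in> M \<Longrightarrow> z \<in> M \<Longrightarrow> 0 < R \<Longrightarrow> R \<le> d y z \<Longrightarrow> 0 < t \<Longrightarrow> t \<le> \<tau> * R \<Longrightarrow>
      c * measure \<nu> (mball x0 R) powr (1 / Q)
        \<le> mean_oscillation m (mball x0 (R / (2 * C0))) (smooth_at_scale (\<lambda>x. d (f x0) (f x)) t)"
    by (rule oscillation_ge_nu[OF C0]) (rule that)
  define s where "s = p / Q"
  have s: "0 < s" "s < 1" "s * (1 / p) = 1 / Q" using p by (auto simp: s_def)
  \<comment> \<open>\<open>e\<close> is the value of \<open>a powr (1 - s) + a powr s\<close> at which the upper bound from the Poincare inequality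
    equals the lower bound for the oscillation.\<close>
  define e where "e = (c / (Cp * K powr (1 / Q))) powr p / (K1 powr p * 2 * (1 + K) * C)"
  have e: "0 < e" unfolding e_def using c Cp K K1 C_ge_1 by simp
  obtain a where a: "0 < a" "a < 1" "a powr (1 - s) + a powr s < e"
    using exists_small_powr_sum[OF s(1,2) e] .
  show ?thesis
  proof (rule that[OF a(1,2)])
    fix x0 y z F and R :: real
    assume x0: "x0 \<in> M" and yz: "y \<in> M" "z \<in> M" and R: "0 < R" "R \<le> d y z" and F: "openin mtopology F"
      and mF: "measure m (F \<inter> mball x0 R) \<le> a * measure m (mball x0 R)"
    define B where "B = mball x0 R"
    define V where "V = measure \<nu> B"
    define b where "b = measure m B"
    define b' where "b' = measure m (mball x0 (R / 2))"
    have V: "0 < V" unfolding V_def B_def using doubling_pos[OF nu x0 R(1)] .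
    have b: "0 < b" unfolding b_def B_def using doubling_pos[OF doubling x0 R(1)] .
    have b': "0 < b'" unfolding b'_def using doubling_pos[OF doubling x0, of "R/2"] R by simp
    have bb': "b \<le> C * b'"
      unfolding b_def b'_def B_def using doubling_real[OF doubling x0, of "R/2"] R C_ge_1 by simp
    have bR: "R powr Q \<le> K * b" unfolding b_def B_def by (rule lower[OF x0 yz R])
    show "measure \<nu> (F \<inter> mball x0 R) \<le> (1 - a) * measure \<nu> (mball x0 R)"
    proof (rule ccontr)
      assume "\<not> ?thesis"
      then have "(1 - a) * V < measure \<nu> (F \<inter> B)" by (simp add: V_def B_def)
      moreover have "openin mtopology (F \<inter> B)" unfolding B_def using F by auto
      ultimately obtain r Z where r: "0 < r" and Z: "Z \<in> sets (borel_of mtopology)" "Z \<subseteq> F \<inter> B"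
        "(1 - a) * V < measure \<nu> Z" "\<And>y z. z \<in> Z \<Longrightarrow> y \<in> M \<Longrightarrow> d y z < r \<Longrightarrow> y \<in> F \<inter> B"
        using far_from_boundary[of "F \<inter> B" x0 R "(1 - a) * V"] by (auto simp: B_def)
      have "measure \<nu> (B - Z) = V - measure \<nu> Z"
        unfolding V_def using Z doubling_finite[OF nu, of B x0 R]
        by (intro measure_Diff) (auto simp: B_def less_top)
      then have rest: "measure \<nu> (mball x0 R - Z) \<le> a * measure \<nu> (mball x0 R)"
        using Z(3) by (simp add: B_def V_def algebra_simps)
      \<comment> \<open>At this scale balls centred outside \<open>F\<close> miss \<open>Z\<close>, smoothing preserves the oscillation, and balls centred in
        the ball of radius \<open>R / 2\<close> stay in \<open>B\<close>.\<close>
      define t where "t = min r (min (\<tau> * R) (R / 2))"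
      have t: "0 < t" "t \<le> r" "t \<le> \<tau> * R" "t \<le> R / 2" using r \<tau> R by (auto simp: t_def)
      define W where "W = 2 * (1 + K) * (a powr (1 - s) + a powr s)"
      have W: "0 < W" unfolding W_def using K a by (intro mult_pos_pos add_pos_pos) auto
      have I: "(\<integral>\<^sup>+y\<in>mball x0 (R / 2). ennreal (measure \<nu> (mball y t) powr (p / Q)) \<partial>m)
         \<le> ennreal (W * (t powr p * (V / b) powr s) * b)"
        unfolding W_def s_def V_def b_def B_def
        using mF Z t F by (intro nu_integral_bound[OF x0 R(1) t(1,4) a(1) _ _ _ _ _ _ rest, of "F \<inter> mball x0 R"])
          (auto simp: B_def intro: openin_imp_borel)
      define Y where "Y = (K1 powr p * W * C) * (V / b) powr s"
      have Y0: "0 \<le> Y" unfolding Y_def using W C_ge_1 by simp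
      have "(ennreal ((K1 / t) powr p) * (\<integral>\<^sup>+y\<in>mball x0 (R / 2). ennreal (measure \<nu> (mball y t) powr (p / Q)) \<partial>m))
          / emeasure m (mball x0 (R / 2))
        \<le> (ennreal ((K1 / t) powr p) * ennreal (W * (t powr p * (V / b) powr s) * b)) / emeasure m (mball x0 (R / 2))"
        using I by (intro divide_right_mono_ennreal mult_left_mono) auto
      also have "\<dots> = ennreal ((K1 / t) powr p * (W * (t powr p * (V / b) powr s) * b) / b')"
        using W b b' by (simp add: doubling_emeasure[OF doubling, of _ x0 "R / 2"] b'_def[symmetric]
          ennreal_mult[symmetric] divide_ennreal)
      also have "\<dots> \<le> ennreal Y"
      proof (rule ennreal_leI)
        have "(K1 / t) powr p * t powr p = K1 powr p" using K1 t by (simp add: powr_divide)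
        then have "(K1 / t) powr p * (W * (t powr p * (V / b) powr s) * b) / b' = K1 powr p * W * (V / b) powr s * (b / b')"
          by (simp add: algebra_simps)
        also have "\<dots> \<le> K1 powr p * W * (V / b) powr s * C"
          using bb' b' W by (intro mult_left_mono) (auto simp: field_simps)
        finally show "(K1 / t) powr p * (W * (t powr p * (V / b) powr s) * b) / b' \<le> Y" by (simp add: Y_def algebra_simps)
      qed
      finally have "ennreal_powr ((ennreal ((K1 / t) powr p) * (\<integral>\<^sup>+y\<in>mball x0 (R / 2). ennreal (measure \<nu> (mball y t) powr (p / Q)) \<partial>m))
          / emeasure m (mball x0 (R / 2))) (1 / p) \<le> ennreal (Y powr (1 / p))"
        using Y0 p by (intro ennreal_powr_le) auto
      then have "ennreal (Cp * R) * ennreal_powr ((ennreal ((K1 / t) powr p) * (\<integral>\<^sup>+y\<in>mball x0 (R / 2). ennreal (measure \<nu> (mball y t) powr (p / Q)) \<partial>m))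
          / emeasure m (mball x0 (R / 2))) (1 / p) \<le> ennreal (Cp * R) * ennreal (Y powr (1 / p))" by (rule mult_left_mono) simp
      then have "ennreal (mean_oscillation m (mball x0 (R / (2 * C0))) (smooth_at_scale (\<lambda>x. d (f x0) (f x)) t))
         \<le> ennreal (Cp * R) * ennreal (Y powr (1 / p))"
        using PI[OF x0 R(1) t(1)] by (rule order_trans[rotated])
      also have "\<dots> = ennreal (Cp * R * Y powr (1 / p))" using Cp R by (simp add: ennreal_mult)
      finally have "mean_oscillation m (mball x0 (R / (2 * C0))) (smooth_at_scale (\<lambda>x. d (f x0) (f x)) t) \<le> Cp * R * Y powr (1 / p)"
        using Cp R by (simp add: ennreal_le_iff)
      then have "c * V powr (1 / Q) \<le> Cp * R * Y powr (1 / p)"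
        using osc[OF x0 yz R t(1,3)] by (simp add: V_def B_def)
      also have "Y powr (1 / p) = (K1 powr p * W * C) powr (1 / p) * (V / b) powr (1 / Q)"
        unfolding Y_def using K1 W C_ge_1 s(3) by (simp add: powr_mult powr_powr)
      also have "(V / b) powr (1 / Q) \<le> (K * V / R powr Q) powr (1 / Q)"
        using V b bR R p K by (intro powr_mono2) (auto simp: field_simps)
      also have "\<dots> = K powr (1 / Q) * V powr (1 / Q) / R"
        using K V R p by (simp add: powr_divide powr_mult powr_powr)
      finally have "c * V powr (1 / Q) \<le> Cp * R * ((K1 powr p * W * C) powr (1 / p) * (K powr (1 / Q) * V powr (1 / Q) / R))"
        using Cp R by (simp add: mult_left_mono)
      also have "\<dots> = (Cp * K powr (1 / Q) * (K1 powr p * W * C) powr (1 / p)) * V powr (1 / Q)"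
        using R by (simp add: field_simps)
      finally have "c \<le> Cp * K powr (1 / Q) * (K1 powr p * W * C) powr (1 / p)" using V by simp
      then have "c / (Cp * K powr (1 / Q)) \<le> (K1 powr p * W * C) powr (1 / p)"
        using Cp K by (simp add: pos_divide_le_eq mult.commute)
      then have "(c / (Cp * K powr (1 / Q))) powr p \<le> ((K1 powr p * W * C) powr (1 / p)) powr p"
        using c Cp K p by (intro powr_mono2) auto
      also have "\<dots> = K1 powr p * W * C" using K1 W C_ge_1 p by (simp add: powr_powr)
      also have "\<dots> = (K1 powr p * 2 * (1 + K) * C) * (a powr (1 - s) + a powr s)" by (simp add: W_def)
      finally have "e \<le> a powr (1 - s) + a powr s"
        unfolding e_def using K1 K C_ge_1 by (simp add: pos_divide_le_eq mult.commute)
      then show False using a(3) by simp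
    qed
  qed
qed

end

section \<open>Mutual absolute continuity and the oscillation of the logarithm\<close>

context Metric_space
begin

lemma doubling_borel_mono: "doubling_borel C m \<Longrightarrow> C \<le> C' \<Longrightarrow> doubling_borel C' m"
  unfolding doubling_borel_def by (meson ennreal_leI mult_right_mono order_trans zero_le)

text \<open>
  In a bounded space large balls are the whole space, and their radius can be decreased to a multiple of a
  distance between two points.
\<close>

lemma ball_with_comparable_distance:
  assumes two: "\<exists>y\<in>M. \<exists>z\<in>M. y \<noteq> z" and R: "0 < R" and x0: "x0 \<in> M"
  obtains R' y z where "0 < R'" "y \<in> M" "z \<in> M" "R' \<le> 8 * d y z" "mball x0 R' = mball x0 R"
proof (cases "\<exists>y\<in>M. \<exists>z\<in>M. R \<le> 8 * d y z")
  case True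
  then show ?thesis using R that by blast
next
  case False
  then have small: "\<And>y z. y \<in> M \<Longrightarrow> z \<in> M \<Longrightarrow> 8 * d y z < R" by force
  define T where "T = (\<lambda>(y, z). d y z) ` (M \<times> M)"
  have bdd: "bdd_above T" unfolding T_def using small by (intro bdd_aboveI[of _ "R / 8"]) fastforce
  obtain y0 z0 where yz0: "y0 \<in> M" "z0 \<in> M" "y0 \<noteq> z0" using two by blast
  have in_T: "d y z \<in> T" if "y \<in> M" "z \<in> M" for y z unfolding T_def using that by force
  then have "d y0 z0 \<le> Sup T" using yz0 bdd by (intro cSup_upper) auto
  moreover have "0 < d y0 z0" using yz0 by simp
  ultimately have "0 < Sup T" by linarith
  then have "Sup T / 2 < Sup T" by simp
  moreover have "T \<noteq> {}" using in_T yz0 by blast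
  ultimately obtain v where "v \<in> T" "Sup T / 2 < v" using less_cSupD[of T "Sup T / 2"] by blast
  then obtain y z where yz: "y \<in> M" "z \<in> M" "Sup T / 2 < d y z" unfolding T_def by auto
  have full: "mball x0 r = M" if "\<And>w. w \<in> M \<Longrightarrow> d x0 w < r" for r using that x0 by auto
  have "d x0 w < 8 * d y z" if "w \<in> M" for w
    using cSup_upper[OF in_T[OF x0 that] bdd] yz(3) \<open>0 < Sup T\<close> by linarith
  moreover have "d x0 w < R" if w: "w \<in> M" for w
    using small[OF x0 w] nonneg[of x0 w] by linarith
  ultimately have "mball x0 (8 * d y z) = mball x0 R" using full by metis
  then show ?thesis using yz \<open>0 < Sup T\<close> by (intro that[of "8 * d y z" y z]) auto
qed

lemma null_by_decay:
  fixes D c :: real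
  assumes n: "doubling_borel C n" and x0: "x0 \<in> M" and c: "0 \<le> c" "c < 1"
    and E: "E \<in> sets (borel_of mtopology)"
    and le: "\<And>R N. 0 < R \<Longrightarrow> measure n (E \<inter> mball x0 R) \<le> D * c ^ N * measure n (mball x0 R)"
  shows "emeasure n E = 0"
proof -
  have EM: "E \<subseteq> M" using sets.sets_into_space[OF E] by simp
  have zero: "emeasure n (E \<inter> mball x0 (real (Suc k))) = 0" for k
  proof -
    have "(\<lambda>N. D * c ^ N * measure n (mball x0 (real (Suc k)))) \<longlonglongrightarrow> D * 0 * measure n (mball x0 (real (Suc k)))"
      using c by (intro tendsto_intros LIMSEQ_realpow_zero) auto
    moreover have "measure n (E \<inter> mball x0 (real (Suc k))) \<le> D * c ^ N * measure n (mball x0 (real (Suc k)))" for N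
      using le by simp
    ultimately have "measure n (E \<inter> mball x0 (real (Suc k))) \<le> D * 0 * measure n (mball x0 (real (Suc k)))"
      by (intro LIMSEQ_le_const) auto
    then have "measure n (E \<inter> mball x0 (real (Suc k))) = 0" using measure_nonneg[of n] by (metis mult_zero_left mult_zero_right order_antisym)
    then show ?thesis using doubling_emeasure[OF n, of "E \<inter> mball x0 (real (Suc k))" x0 "real (Suc k)"] by simp
  qed
  have "E \<subseteq> (\<Union>k. E \<inter> mball x0 (real (Suc k)))"
  proof
    fix x assume x: "x \<in> E"
    obtain k where "d x0 x < real k" using reals_Archimedean2 by blast
    then have "x \<in> E \<inter> mball x0 (real (Suc k))" using x x0 EM by auto
    then show "x \<in> (\<Union>k. E \<inter> mball x0 (real (Suc k)))" by blast
  qed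
  moreover have "emeasure n (\<Union>k. E \<inter> mball x0 (real (Suc k))) = 0"
    using zero E doubling_sets[OF n] by (intro emeasure_UN_eq_0) auto
  ultimately show ?thesis
    using emeasure_mono[of E "\<Union>k. E \<inter> mball x0 (real (Suc k))" n] E doubling_sets[OF n] by auto
qed

text \<open>
  Choose \<open>U\<close> by outer regularity for \<open>\<tau>\<close>.  Then \<open>\<tau>\<close> is small on the part of \<open>U\<close> outside \<open>E\<close>, and so is \<open>n\<close>.
\<close>

lemma small_open_neighbourhood:
  assumes n: "sets n = sets (borel_of mtopology)" and \<tau>: "doubling_borel C' \<tau>" "outer_regular \<tau>"
    and E: "E \<in> sets (borel_of mtopology)" and zero: "emeasure n E = 0"
    and le: "\<And>A. A \<in> sets (borel_of mtopology) \<Longrightarrow> emeasure n A \<le> ennreal k * emeasure \<tau> A" and k: "0 \<le> k" and e: "0 < e"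
  shows "\<exists>U. openin mtopology U \<and> E \<inter> mball x R \<subseteq> U \<and> emeasure n U \<le> ennreal e"
proof -
  define A where "A = E \<inter> mball x R"
  have A: "A \<in> sets (borel_of mtopology)" "A \<subseteq> mball x R" unfolding A_def using E by auto
  have "0 < e / (k + 1)" using e k by simp
  then have "measure \<tau> A < measure \<tau> A + e / (k + 1)" by simp
  then obtain U where U: "openin mtopology U" "A \<subseteq> U" "U \<subseteq> mball x R" "measure \<tau> U < measure \<tau> A + e / (k + 1)"
    using outer_regular_open[OF \<tau> A] by blast
  have Ub: "U \<in> sets (borel_of mtopology)" using U openin_imp_borel by blast
  have "measure \<tau> (U - A) = measure \<tau> U - measure \<tau> A"
    using A Ub U doubling_finite[OF \<tau>(1) U(3)] by (intro measure_Diff) (auto simp: doubling_sets[OF \<tau>(1)] less_top)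
  then have "measure \<tau> (U - A) \<le> e / (k + 1)" using U by simp
  then have "measure \<tau> (U - A) * (k + 1) \<le> e" using k by (simp add: pos_le_divide_eq)
  then have "k * measure \<tau> (U - A) + measure \<tau> (U - A) \<le> e" by (simp add: algebra_simps)
  then have small: "k * measure \<tau> (U - A) \<le> e"
    using measure_nonneg[of \<tau> "U - A"] by linarith
  have "emeasure n U \<le> emeasure n (U - A) + emeasure n A"
    using A Ub n by (metis Diff_partition U(2) emeasure_subadditive sets.Diff sup_commute)
  also have "emeasure n A \<le> emeasure n E" unfolding A_def using E n by (intro emeasure_mono) auto
  also have "emeasure n E = 0" by (rule zero)
  also have "emeasure n (U - A) + 0 \<le> ennreal k * emeasure \<tau> (U - A)" using A Ub le by simp
  also have "\<dots> = ennreal (k * measure \<tau> (U - A))"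
    using k U by (subst doubling_emeasure[OF \<tau>(1), of _ x R]) (auto simp: ennreal_mult)
  also have "\<dots> \<le> ennreal e" using small by (rule ennreal_leI)
  finally show ?thesis using U unfolding A_def by (intro exI[of _ U]) auto
qed

end

context qs_poincare_space
begin

text \<open>
  For the first inequality the comparison \<open>small_measure_misses_image\<close> is turned around by taking
  complements: if \<open>E\<close> fills almost all of the \<open>m\<close>-measure of a ball, then an open neighbourhood of the rest has
  small \<open>m\<close>-measure and misses a fixed proportion of \<open>\<nu>\<close>, which therefore lies in \<open>E\<close>.
\<close>

lemma A_infinity_both:
  obtains \<sigma> c D where "0 < \<sigma>" "\<sigma> < 1" "0 \<le> c" "c < 1" "0 \<le> D"
    "\<And>x0 R E N. x0 \<in> M \<Longrightarrow> 0 < R \<Longrightarrow> E \<in> sets (borel_of mtopology) \<Longrightarrow> E \<subseteq> mball x0 R \<Longrightarrow>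
       measure \<nu> E < \<sigma> ^ Suc N * measure \<nu> (mball x0 R) \<Longrightarrow> measure m E \<le> D * c ^ N * measure m (mball x0 R)"
    "\<And>x0 R E N. x0 \<in> M \<Longrightarrow> 0 < R \<Longrightarrow> E \<in> sets (borel_of mtopology) \<Longrightarrow> E \<subseteq> mball x0 R \<Longrightarrow>
       measure m E < \<sigma> ^ Suc N * measure m (mball x0 R) \<Longrightarrow> measure \<nu> E \<le> D * c ^ N * measure \<nu> (mball x0 R)"
proof -
  obtain a where a: "0 < a" "a < 1" and key:
    "\<And>x0 R y z F. x0 \<in> M \<Longrightarrow> y \<in> M \<Longrightarrow> z \<in> M \<Longrightarrow> 0 < R \<Longrightarrow> R \<le> d y z \<Longrightarrow> openin mtopology F \<Longrightarrow>
       measure m (F \<inter> mball x0 R) \<le> a * measure m (mball x0 R) \<Longrightarrow>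
       measure \<nu> (F \<inter> mball x0 R) \<le> (1 - a) * measure \<nu> (mball x0 R)"
    by (rule small_measure_misses_image) (rule that)
  define D where "D = max C C\<nu>"
  have dm: "doubling_borel D m" and dn: "doubling_borel D \<nu>"
    using doubling_borel_mono[OF doubling, of D] doubling_borel_mono[OF nu, of D] by (auto simp: D_def)
  have D1: "1 \<le> D" using C_ge_1 by (simp add: D_def)
  have key1: "measure \<nu> (F \<inter> mball x R) \<le> (1 - a / 2) * measure \<nu> (mball x R)"
    if "x \<in> M" "y \<in> M" "z \<in> M" "0 < R" "R \<le> d y z" "openin mtopology F"
      "measure m (F \<inter> mball x R) \<le> (a / 2) * measure m (mball x R)" for x R y z F
  proof -
    have "(a / 2) * measure m (mball x R) \<le> a * measure m (mball x R)" using a by (intro mult_right_mono) auto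
    then have "measure \<nu> (F \<inter> mball x R) \<le> (1 - a) * measure \<nu> (mball x R)"
      using that by (intro key[of x y z]) auto
    also have "\<dots> \<le> (1 - a / 2) * measure \<nu> (mball x R)" using a by (intro mult_right_mono) auto
    finally show ?thesis .
  qed
  have key2: "measure m (E \<inter> mball x R) \<le> (1 - a / 2) * measure m (mball x R)"
    if x: "x \<in> M" and yz: "y \<in> M" "z \<in> M" and R: "0 < R" "R \<le> d y z" and E: "openin mtopology E"
      and small: "measure \<nu> (E \<inter> mball x R) \<le> (a / 2) * measure \<nu> (mball x R)" for x R y z E
  proof (rule ccontr)
    define B where "B = mball x R"
    assume "\<not> ?thesis"
    then have big: "(1 - a / 2) * measure m B < measure m (E \<inter> B)" by (simp add: B_def)
    have Bb: "B \<in> sets (borel_of mtopology)" "E \<in> sets (borel_of mtopology)"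
      unfolding B_def using E openin_imp_borel by auto
    have pos: "0 < measure m B" "0 < measure \<nu> B"
      unfolding B_def using doubling_pos[OF doubling x R(1)] doubling_pos[OF nu x R(1)] by auto
    have "measure m (B - E \<inter> B) = measure m B - measure m (E \<inter> B)"
      using Bb doubling_finite[OF doubling, of B x R]
      by (intro measure_Diff) (auto simp: doubling_sets[OF doubling] less_top B_def)
    also have "B - E \<inter> B = B - E" by blast
    finally have "measure m (B - E) < a / 2 * measure m B" using big by (simp add: algebra_simps)
    also have "\<dots> \<le> a * measure m B" using a by (intro mult_right_mono) auto
    finally obtain F where F: "openin mtopology F" "B - E \<subseteq> F" "F \<subseteq> B" "measure m F < a * measure m B"
      using outer_regular_open[OF doubling outer, of "B - E" x R] Bb unfolding B_def by blast
    then have "F \<inter> B = F" by blast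
    then have "measure \<nu> F \<le> (1 - a) * measure \<nu> B"
      using key[OF x yz R F(1)] F(4) unfolding B_def by simp
    moreover have "measure \<nu> B \<le> measure \<nu> (F \<union> (E \<inter> B))"
      using F Bb openin_imp_borel[OF F(1)] by (intro doubling_mono[OF nu, of _ _ x R]) (auto simp: B_def)
    moreover have "\<dots> \<le> measure \<nu> F + measure \<nu> (E \<inter> B)"
      using F Bb openin_imp_borel[OF F(1)] by (intro measure_Un_le) auto
    ultimately have "a * measure \<nu> B \<le> measure \<nu> (E \<inter> B)" by (simp add: algebra_simps)
    also have "\<dots> \<le> a / 2 * measure \<nu> B" using small by (simp add: B_def)
    finally show False using a pos by simp
  qed
  have a2: "0 < a / 2" "a / 2 < 1" "0 \<le> 1 - a / 2" "1 - a / 2 < 1" using a by auto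
  define \<sigma> where "\<sigma> = (a / 2) / D ^ 5"
  have "1 \<le> D ^ 5" using D1 by (rule one_le_power)
  then have "a / 2 < D ^ 5" "0 < D ^ 5" using a by linarith+
  then have \<sigma>: "0 < \<sigma>" "\<sigma> < 1" unfolding \<sigma>_def using a by (simp_all only: pos_divide_less_eq zero_less_divide_iff) auto
  define c where "c = 1 - (1 - (1 - a / 2)) / D ^ 3"
  have "1 \<le> D ^ 3" using D1 by (rule one_le_power)
  then have "1 - (1 - a / 2) \<le> D ^ 3" "0 < D ^ 3" using a by linarith+
  then have "0 < (1 - (1 - a / 2)) / D ^ 3" "(1 - (1 - a / 2)) / D ^ 3 \<le> 1" using a by (simp_all only: pos_divide_le_eq zero_less_divide_iff) auto
  then have c: "0 \<le> c" "c < 1" unfolding c_def by linarith+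
  show ?thesis
  proof (rule that[of \<sigma> c D])
    fix x0 and R :: real and E and N :: nat
    assume x0: "x0 \<in> M" and R: "0 < R" and E: "E \<in> sets (borel_of mtopology)" "E \<subseteq> mball x0 R"
    obtain R' y z where R': "0 < R'" "y \<in> M" "z \<in> M" "R' \<le> 8 * d y z" and eq: "mball x0 R' = mball x0 R"
      by (rule ball_with_comparable_distance[OF two_points R x0]) (rule that)
    note E' = E(2)[folded eq]
    show "measure m E \<le> D * c ^ N * measure m (mball x0 R)"
      if small: "measure \<nu> E < \<sigma> ^ Suc N * measure \<nu> (mball x0 R)"
    proof -
      have H: "measure m (F \<inter> mball x r) \<le> (1 - a / 2) * measure m (mball x r)"
        if "x \<in> M" "0 < r" "r \<le> d y z" "openin mtopology F" "measure \<nu> (F \<inter> mball x r) \<le> a / 2 * measure \<nu> (mball x r)" for x r F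
        using key2[OF that(1) R'(2,3) that(2-5)] .
      show ?thesis
        using A_infinity_decay[OF dn dm nu_outer a2 x0 R'(1,4) H E(1) E', of N] small
        unfolding \<sigma>_def[symmetric] c_def[symmetric] eq by simp
    qed
    show "measure \<nu> E \<le> D * c ^ N * measure \<nu> (mball x0 R)"
      if small: "measure m E < \<sigma> ^ Suc N * measure m (mball x0 R)"
    proof -
      have H: "measure \<nu> (F \<inter> mball x r) \<le> (1 - a / 2) * measure \<nu> (mball x r)"
        if "x \<in> M" "0 < r" "r \<le> d y z" "openin mtopology F" "measure m (F \<inter> mball x r) \<le> a / 2 * measure m (mball x r)" for x r F
        using key1[OF that(1) R'(2,3) that(2-5)] .
      show ?thesis
        using A_infinity_decay[OF dm dn outer a2 x0 R'(1,4) H E(1) E', of N] small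
        unfolding \<sigma>_def[symmetric] c_def[symmetric] eq by simp
    qed
  qed (use \<sigma> c D1 in auto)
qed

lemma nu_null_iff:
  assumes E: "E \<in> sets (borel_of mtopology)"
  shows "emeasure \<nu> E = 0 \<longleftrightarrow> emeasure m E = 0"
proof -
  obtain \<sigma> c D where \<sigma>: "0 < \<sigma>" "\<sigma> < 1" and c: "0 \<le> c" "c < 1" and D: "0 \<le> D"
    and 1: "\<And>x0 R E N. x0 \<in> M \<Longrightarrow> 0 < R \<Longrightarrow> E \<in> sets (borel_of mtopology) \<Longrightarrow> E \<subseteq> mball x0 R \<Longrightarrow>
       measure \<nu> E < \<sigma> ^ Suc N * measure \<nu> (mball x0 R) \<Longrightarrow> measure m E \<le> D * c ^ N * measure m (mball x0 R)"
    and 2: "\<And>x0 R E N. x0 \<in> M \<Longrightarrow> 0 < R \<Longrightarrow> E \<in> sets (borel_of mtopology) \<Longrightarrow> E \<subseteq> mball x0 R \<Longrightarrow>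
       measure m E < \<sigma> ^ Suc N * measure m (mball x0 R) \<Longrightarrow> measure \<nu> E \<le> D * c ^ N * measure \<nu> (mball x0 R)"
    by (rule A_infinity_both) (rule that)
  obtain x0 where x0: "x0 \<in> M" using two_points by blast
  have zero: "measure n (E \<inter> mball x0 R) < \<sigma> ^ Suc N * measure n (mball x0 R)"
    if n: "doubling_borel C' n" "emeasure n E = 0" and R: "0 < R" for n C' N R
  proof -
    have "emeasure n (E \<inter> mball x0 R) \<le> emeasure n E" using E doubling_sets[OF n(1)] by (intro emeasure_mono) auto
    then have "measure n (E \<inter> mball x0 R) = 0" using n(2) by (simp add: measure_def)
    moreover have "0 < measure n (mball x0 R)" using doubling_pos[OF n(1) x0 R] .
    ultimately show ?thesis using \<sigma> by simp
  qed
  show ?thesis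
  proof
    assume z: "emeasure \<nu> E = 0"
    show "emeasure m E = 0"
      using E by (intro null_by_decay[OF doubling x0 c, where D=D] 1[OF x0] zero[OF nu z]) auto
  next
    assume z: "emeasure m E = 0"
    show "emeasure \<nu> E = 0"
      using E by (intro null_by_decay[OF nu x0 c, where D=D] 2[OF x0] zero[OF doubling z]) auto
  qed
qed

text \<open>
  The density of the pullback measure; almost everywhere it is the generalised Jacobian.
\<close>

definition w :: "'a \<Rightarrow> ennreal" where "w = RN_deriv m \<nu>"

lemma sigma_finite_m: "sigma_finite_measure m"
  by (rule doubling_sigma_finite[OF doubling])

lemma abs_cont: "absolutely_continuous m \<nu>"
  unfolding absolutely_continuous_def null_sets_def
  using nu_null_iff by (auto simp: doubling_sets[OF doubling])

lemma w_measurable [measurable]: "w \<in> borel_measurable m"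
  by (simp add: w_def)

lemma density_w: "density m w = \<nu>"
  unfolding w_def
  by (rule sigma_finite_measure.density_RN_deriv[OF sigma_finite_m abs_cont]) (simp add: doubling_sets[OF doubling])

lemma nu_eq_integral: "E \<in> sets (borel_of mtopology) \<Longrightarrow> emeasure \<nu> E = (\<integral>\<^sup>+x\<in>E. w x \<partial>m)"
  unfolding density_w[symmetric] by (simp add: emeasure_density doubling_sets[OF doubling])

lemma AE_w_finite: "AE x in m. w x < \<infinity>"
  using sigma_finite_measure.RN_deriv_finite[OF sigma_finite_m doubling_sigma_finite[OF nu] abs_cont]
  by (simp add: w_def doubling_sets[OF doubling] less_top)

lemma AE_w_pos: "AE x in m. 0 < w x"
proof -
  have Z: "{x \<in> space m. w x = 0} \<in> sets m" by measurable
  then have "emeasure \<nu> {x \<in> space m. w x = 0} = (\<integral>\<^sup>+x\<in>{x \<in> space m. w x = 0}. w x \<partial>m)"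
    by (intro nu_eq_integral) (simp add: doubling_sets[OF doubling])
  also have "\<dots> = (\<integral>\<^sup>+x. 0 \<partial>m)" by (intro nn_integral_cong) (auto simp: indicator_def)
  finally have "emeasure m {x \<in> space m. w x = 0} = 0"
    using nu_null_iff[of "{x \<in> space m. w x = 0}"] Z by (simp add: doubling_sets[OF doubling])
  then show ?thesis using Z by (intro AE_I[of _ _ "{x \<in> space m. w x = 0}"]) (auto simp: zero_less_iff_neq_zero)
qed

text \<open>
  Compare \<open>w\<close> with its average \<open>V / b\<close> over the ball.  Where \<open>w\<close> is larger, the logarithm of the quotient \<open>v\<close> is
  at most \<open>v\<close>, which has average one.  Where it is smaller, the logarithm is at most a constant plus \<open>- ln \<sigma>\<close>
  times the number of sublevel sets \<open>F N\<close> that contain the point, and the measures of these sets decay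
  geometrically.
\<close>

lemma log_oscillation_on_balls:
  obtains K2 where "0 \<le> K2" "\<And>x0 R. x0 \<in> M \<Longrightarrow> 0 < R \<Longrightarrow>
     (\<integral>\<^sup>+x\<in>mball x0 R. ennreal \<bar>ln (enn2real (w x)) - ln (measure \<nu> (mball x0 R) / measure m (mball x0 R))\<bar> \<partial>m)
       \<le> ennreal (K2 * measure m (mball x0 R))"
proof -
  obtain \<sigma> c D where \<sigma>: "0 < \<sigma>" "\<sigma> < 1" and c: "0 \<le> c" "c < 1" and D: "0 \<le> D"
    and decay: "\<And>x0 R E N. x0 \<in> M \<Longrightarrow> 0 < R \<Longrightarrow> E \<in> sets (borel_of mtopology) \<Longrightarrow> E \<subseteq> mball x0 R \<Longrightarrow>
       measure \<nu> E < \<sigma> ^ Suc N * measure \<nu> (mball x0 R) \<Longrightarrow> measure m E \<le> D * c ^ N * measure m (mball x0 R)"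
    by (rule A_infinity_both) (rule that)
  define lam where "lam = - ln \<sigma>"
  have lam: "0 < lam" using \<sigma> by (simp add: lam_def)
  define K2 where "K2 = 1 + 2 * lam + lam * D * (1 / (1 - c))"
  show ?thesis
  proof (rule that[of K2])
    show "0 \<le> K2" unfolding K2_def using lam D c by simp
    fix x0 and R :: real assume x0: "x0 \<in> M" and R: "0 < R"
    define B where "B = mball x0 R"
    define V where "V = measure \<nu> B"
    define b where "b = measure m B"
    have V: "0 < V" unfolding V_def B_def using doubling_pos[OF nu x0 R] .
    have b: "0 < b" unfolding b_def B_def using doubling_pos[OF doubling x0 R] .
    have Bm: "B \<in> sets m" unfolding B_def by (simp add: doubling_sets[OF doubling])
    \<comment> \<open>The second \<open>Suc\<close> gains a factor \<open>\<sigma> < 1\<close>, since the decay estimate requires a strict inequality.\<close>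
    define F where "F N = {x \<in> B. w x < ennreal (\<sigma> ^ Suc (Suc N) * (V / b))}" for N
    have Fm: "F N \<in> sets m" for N
    proof -
      have "F N = {x \<in> space m. w x < ennreal (\<sigma> ^ Suc (Suc N) * (V / b))} \<inter> B"
        unfolding F_def B_def by (auto simp: doubling_space[OF doubling])
      moreover have "{x \<in> space m. w x < ennreal (\<sigma> ^ Suc (Suc N) * (V / b))} \<in> sets m" by measurable
      ultimately show ?thesis using Bm by simp
    qed
    have FB: "F N \<subseteq> B" for N unfolding F_def by blast
    have mF: "measure m (F N) \<le> D * c ^ N * b" for N
      unfolding b_def B_def
    proof (rule decay[OF x0 R])
      show Fb: "F N \<in> sets (borel_of mtopology)" using Fm doubling_sets[OF doubling] by simp
      show "F N \<subseteq> mball x0 R" using FB by (simp add: B_def)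
      have "emeasure \<nu> (F N) \<le> (\<integral>\<^sup>+x. ennreal (\<sigma> ^ Suc (Suc N) * (V / b)) * indicator B x \<partial>m)"
        unfolding nu_eq_integral[OF Fb] by (intro nn_integral_mono) (auto simp: F_def indicator_def)
      also have "\<dots> = ennreal (\<sigma> ^ Suc (Suc N) * (V / b)) * ennreal b"
        using Bm doubling_emeasure[OF doubling, of B x0 R] by (simp add: nn_integral_cmult_indicator B_def b_def)
      also have "\<dots> = ennreal (\<sigma> ^ Suc (Suc N) * V)" using \<sigma> V b by (simp add: ennreal_mult[symmetric])
      finally have "measure \<nu> (F N) \<le> \<sigma> ^ Suc (Suc N) * V"
        using doubling_emeasure[OF nu, of "F N" x0 R] FB V \<sigma> by (simp add: B_def)
      also have "\<dots> < \<sigma> ^ Suc N * V" using V \<sigma> by simp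
      finally show "measure \<nu> (F N) < \<sigma> ^ Suc N * measure \<nu> (mball x0 R)" by (simp add: V_def B_def)
    qed
    have pointwise: "ennreal \<bar>ln (enn2real (w x)) - ln (V / b)\<bar> * indicator B x
       \<le> ennreal (b / V) * (w x * indicator B x) + ennreal (2 * lam) * indicator B x + (\<Sum>N. ennreal lam * indicator (F N) x)"
      if wx: "0 < w x" "w x < \<infinity>" for x
    proof (cases "x \<in> B")
      case True
      define y where "y = enn2real (w x)"
      have y: "0 < y" "w x = ennreal y" using wx by (auto simp: y_def enn2real_positive_iff less_top)
      define v where "v = y / (V / b)"
      have v: "0 < v" using y V b by (simp add: v_def)
      have lnv: "ln y - ln (V / b) = ln v" unfolding v_def using y V b ln_divide_pos[of y "V / b"] by simp
      have vw: "ennreal v = ennreal (b / V) * w x" using y V b by (simp add: v_def ennreal_mult[symmetric] mult.commute)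
      show ?thesis
      proof (cases "1 \<le> v")
        case True
        then have "ennreal \<bar>ln v\<bar> \<le> ennreal v" using ln_le_minus_one[OF v] by (intro ennreal_leI) simp
        also have "\<dots> = ennreal (b / V) * w x" by (rule vw)
        also have "\<dots> \<le> ennreal (b / V) * w x + (ennreal (2 * lam) + (\<Sum>N. ennreal lam * indicator (F N) x))"
          by simp
        finally show ?thesis using \<open>x \<in> B\<close> by (simp add: y_def[symmetric] lnv add.assoc)
      next
        case False
        have "(\<lambda>n. \<sigma> ^ Suc (Suc n)) \<longlonglongrightarrow> 0"
          using \<sigma> LIMSEQ_realpow_zero[of \<sigma>] by (intro LIMSEQ_Suc) auto
        then obtain n0 where "\<sigma> ^ Suc (Suc n0) < v"
          using order_tendstoD(2)[OF _ v] eventually_happens'[OF sequentially_bot] by blast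
        then have ex: "\<sigma> ^ Suc (Suc n0) \<le> v" by simp
        define n where "n = (LEAST n. \<sigma> ^ Suc (Suc n) \<le> v)"
        have n: "\<sigma> ^ Suc (Suc n) \<le> v" unfolding n_def using ex by (rule LeastI)
        have less: "v < \<sigma> ^ Suc (Suc N)" if "N < n" for N
          using not_less_Least[of N "\<lambda>n. \<sigma> ^ Suc (Suc n) \<le> v"] that unfolding n_def by simp
        have inF: "x \<in> F N" if "N < n" for N
        proof -
          have "y < \<sigma> ^ Suc (Suc N) * (V / b)" using less[OF that] V b unfolding v_def by (simp add: field_simps)
          then show ?thesis unfolding F_def using \<open>x \<in> B\<close> y by (simp add: ennreal_lessI)
        qed
        have "ln (\<sigma> ^ Suc (Suc n)) \<le> ln v" using n \<sigma> by (intro ln_mono) auto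
        then have "- ln v \<le> real (Suc (Suc n)) * lam" using \<sigma> by (simp only: ln_realpow lam_def)
        then have "\<bar>ln v\<bar> \<le> 2 * lam + real n * lam" using False v by (simp add: algebra_simps)
        then have "ennreal \<bar>ln v\<bar> \<le> ennreal (2 * lam + real n * lam)" by (rule ennreal_leI)
        also have "\<dots> = ennreal (2 * lam) + of_nat n * ennreal lam"
          using lam by (simp add: ennreal_plus ennreal_mult ennreal_of_nat_eq_real_of_nat)
        also have "of_nat n * ennreal lam = (\<Sum>N<n. ennreal lam * indicator (F N) x)" using inF by simp
        also have "\<dots> \<le> (\<Sum>N. ennreal lam * indicator (F N) x)" by (intro sum_le_suminf) auto
        finally have "ennreal \<bar>ln v\<bar> \<le> ennreal (2 * lam) + (\<Sum>N. ennreal lam * indicator (F N) x)" by (simp add: add_left_mono)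
        also have "\<dots> \<le> ennreal (b / V) * w x + (ennreal (2 * lam) + (\<Sum>N. ennreal lam * indicator (F N) x))" by simp
        finally show ?thesis using \<open>x \<in> B\<close> by (simp add: y_def[symmetric] lnv add.assoc)
      qed
    qed simp
    have "(\<integral>\<^sup>+x\<in>B. ennreal \<bar>ln (enn2real (w x)) - ln (V / b)\<bar> \<partial>m)
       \<le> (\<integral>\<^sup>+x. ennreal (b / V) * (w x * indicator B x) + ennreal (2 * lam) * indicator B x + (\<Sum>N. ennreal lam * indicator (F N) x) \<partial>m)"
      using AE_w_pos AE_w_finite by (intro nn_integral_mono_AE, eventually_elim) (rule pointwise)
    also have "\<dots> = ennreal (b / V) * emeasure \<nu> B + ennreal (2 * lam) * emeasure m B + (\<Sum>N. ennreal lam * emeasure m (F N))"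
    proof -
      note [measurable] = Bm Fm
      have "(\<integral>\<^sup>+x. ennreal (b / V) * (w x * indicator B x) + ennreal (2 * lam) * indicator B x + (\<Sum>N. ennreal lam * indicator (F N) x) \<partial>m)
        = (\<integral>\<^sup>+x. ennreal (b / V) * (w x * indicator B x) + ennreal (2 * lam) * indicator B x \<partial>m)
          + (\<integral>\<^sup>+x. (\<Sum>N. ennreal lam * indicator (F N) x) \<partial>m)"
        by (rule nn_integral_add) measurable
      also have "(\<integral>\<^sup>+x. ennreal (b / V) * (w x * indicator B x) + ennreal (2 * lam) * indicator B x \<partial>m)
        = (\<integral>\<^sup>+x. ennreal (b / V) * (w x * indicator B x) \<partial>m) + (\<integral>\<^sup>+x. ennreal (2 * lam) * indicator B x \<partial>m)"
        by (rule nn_integral_add) measurable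
      also have "(\<integral>\<^sup>+x. ennreal (b / V) * (w x * indicator B x) \<partial>m) = ennreal (b / V) * emeasure \<nu> B"
        using Bm by (subst nn_integral_cmult) (simp_all add: nu_eq_integral doubling_sets[OF doubling])
      also have "(\<integral>\<^sup>+x. ennreal (2 * lam) * indicator B x \<partial>m) = ennreal (2 * lam) * emeasure m B"
        using Bm by (rule nn_integral_cmult_indicator)
      also have "(\<integral>\<^sup>+x. (\<Sum>N. ennreal lam * indicator (F N) x) \<partial>m) = (\<Sum>N. \<integral>\<^sup>+x. ennreal lam * indicator (F N) x \<partial>m)"
        by (rule nn_integral_suminf) measurable
      also have "\<dots> = (\<Sum>N. ennreal lam * emeasure m (F N))"
        using Fm by (simp only: nn_integral_cmult_indicator)
      finally show ?thesis .
    qed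
    also have "\<dots> \<le> ennreal b + ennreal (2 * lam * b) + ennreal (lam * D * b * (1 / (1 - c)))"
    proof (intro add_mono)
      show "ennreal (b / V) * emeasure \<nu> B \<le> ennreal b"
        using V b doubling_emeasure[OF nu, of B x0 R] by (simp add: B_def V_def ennreal_mult[symmetric])
      show "ennreal (2 * lam) * emeasure m B \<le> ennreal (2 * lam * b)"
        using lam doubling_emeasure[OF doubling, of B x0 R] by (simp add: B_def b_def ennreal_mult)
      have "(\<Sum>N. ennreal lam * emeasure m (F N)) \<le> (\<Sum>N. ennreal (lam * D * b * c ^ N))"
      proof (intro suminf_le summableI)
        fix N
        have "lam * measure m (F N) \<le> lam * (D * c ^ N * b)" using mF lam by (intro mult_left_mono) auto
        then have "ennreal (lam * measure m (F N)) \<le> ennreal (lam * D * b * c ^ N)" by (intro ennreal_leI) (simp add: algebra_simps)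
        then show "ennreal lam * emeasure m (F N) \<le> ennreal (lam * D * b * c ^ N)"
          using lam FB doubling_emeasure[OF doubling, of "F N" x0 R] by (simp add: B_def ennreal_mult)
      qed
      also have "\<dots> = ennreal (lam * D * b * (1 / (1 - c)))"
        using lam D b c by (intro suminf_ennreal_eq sums_mult geometric_sums) auto
      finally show "(\<Sum>N. ennreal lam * emeasure m (F N)) \<le> ennreal (lam * D * b * (1 / (1 - c)))" .
    qed
    also have "\<dots> = ennreal (b + 2 * lam * b + lam * D * b * (1 / (1 - c)))"
      using b lam D c by (simp add: ennreal_plus)
    also have "b + 2 * lam * b + lam * D * b * (1 / (1 - c)) = K2 * b" by (simp add: K2_def algebra_simps)
    finally show "(\<integral>\<^sup>+x\<in>mball x0 R. ennreal \<bar>ln (enn2real (w x)) - ln (measure \<nu> (mball x0 R) / measure m (mball x0 R))\<bar> \<partial>m)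
       \<le> ennreal (K2 * measure m (mball x0 R))" by (simp add: B_def V_def b_def)
  qed
qed

end

section \<open>Lebesgue differentiation of the pullback measure\<close>

context qs_poincare_space
begin

text \<open>
  \<open>AE_density_zero\<close> applies because the truncated difference \<open>w - q\<close> is the density of a measure that vanishes on
  \<open>{x. w x \<le> q}\<close> and is at most \<open>\<nu>\<close>, which is outer regular.
\<close>

lemma AE_density_above:
  assumes q: "0 \<le> q"
  shows "AE x in m. w x \<le> ennreal q \<longrightarrow> (\<forall>c>0. \<exists>\<delta>>0. \<forall>r. 0 < r \<and> r < \<delta> \<longrightarrow>
     emeasure (density m (\<lambda>x. w x - ennreal q)) (mball x r) \<le> ennreal c * emeasure m (mball x r))"
proof -
  define n where "n = density m (\<lambda>x. w x - ennreal q)"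
  define E where "E = {x \<in> space m. w x \<le> ennreal q}"
  have "E \<in> sets m" unfolding E_def by measurable
  then have E: "E \<in> sets (borel_of mtopology)" by (simp add: doubling_sets[OF doubling])
  have n: "sets n = sets (borel_of mtopology)" by (simp add: n_def doubling_sets[OF doubling])
  have zero: "emeasure n E = 0"
  proof -
    have "emeasure n E = (\<integral>\<^sup>+x\<in>E. (w x - ennreal q) \<partial>m)"
      unfolding n_def using \<open>E \<in> sets m\<close> by (intro emeasure_density) auto
    also have "\<dots> = (\<integral>\<^sup>+x. 0 \<partial>m)"
      by (intro nn_integral_cong) (auto simp: E_def indicator_def intro!: diff_eq_0_ennreal intro: le_less_trans[OF _ ennreal_less_top])
    finally show ?thesis by simp
  qed
  have le: "emeasure n A \<le> ennreal 1 * emeasure \<nu> A" if A: "A \<in> sets (borel_of mtopology)" for A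
  proof -
    have "emeasure n A = (\<integral>\<^sup>+x\<in>A. (w x - ennreal q) \<partial>m)"
      unfolding n_def using A by (intro emeasure_density) (auto simp: doubling_sets[OF doubling])
    also have "\<dots> \<le> (\<integral>\<^sup>+x\<in>A. w x \<partial>m)"
      by (intro nn_integral_mono mult_right_mono diff_le_self_ennreal) auto
    finally show ?thesis using A by (simp add: nu_eq_integral)
  qed
  have "AE x in m. x \<in> E \<longrightarrow> (\<forall>c>0. \<exists>\<delta>>0. \<forall>r. 0 < r \<and> r < \<delta> \<longrightarrow>
     emeasure n (mball x r) \<le> ennreal c * emeasure m (mball x r))"
    by (rule AE_density_zero[OF doubling n small_open_neighbourhood[OF n nu nu_outer E zero le zero_le_one]])
  moreover have "AE x in m. x \<in> space m" by (rule AE_space)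
  ultimately show ?thesis unfolding n_def[symmetric] by eventually_elim (auto simp: E_def)
qed

text \<open>
  The counterpart for the truncated difference \<open>q - w\<close>, the density of a measure that vanishes on \<open>{x. q \<le> w x}\<close>
  and is at most \<open>q\<close> times \<open>m\<close>.
\<close>

lemma AE_density_below:
  assumes q: "0 \<le> q"
  shows "AE x in m. ennreal q \<le> w x \<longrightarrow> (\<forall>c>0. \<exists>\<delta>>0. \<forall>r. 0 < r \<and> r < \<delta> \<longrightarrow>
     emeasure (density m (\<lambda>x. ennreal q - w x)) (mball x r) \<le> ennreal c * emeasure m (mball x r))"
proof -
  define n where "n = density m (\<lambda>x. ennreal q - w x)"
  define E where "E = {x \<in> space m. ennreal q \<le> w x}"
  have "E \<in> sets m" unfolding E_def by measurable
  then have E: "E \<in> sets (borel_of mtopology)" by (simp add: doubling_sets[OF doubling])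
  have n: "sets n = sets (borel_of mtopology)" by (simp add: n_def doubling_sets[OF doubling])
  have zero: "emeasure n E = 0"
  proof -
    have "emeasure n E = (\<integral>\<^sup>+x\<in>E. (ennreal q - w x) \<partial>m)"
      unfolding n_def using \<open>E \<in> sets m\<close> by (intro emeasure_density) auto
    also have "\<dots> = (\<integral>\<^sup>+x. 0 \<partial>m)"
      by (intro nn_integral_cong) (auto simp: E_def indicator_def diff_eq_0_ennreal)
    finally show ?thesis by simp
  qed
  have le: "emeasure n A \<le> ennreal q * emeasure m A" if A: "A \<in> sets (borel_of mtopology)" for A
  proof -
    have "emeasure n A = (\<integral>\<^sup>+x\<in>A. (ennreal q - w x) \<partial>m)"
      unfolding n_def using A by (intro emeasure_density) (auto simp: doubling_sets[OF doubling])
    also have "\<dots> \<le> (\<integral>\<^sup>+x. ennreal q * indicator A x \<partial>m)"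
      by (intro nn_integral_mono mult_right_mono diff_le_self_ennreal) auto
    finally show ?thesis using A by (simp add: nn_integral_cmult_indicator doubling_sets[OF doubling])
  qed
  have "AE x in m. x \<in> E \<longrightarrow> (\<forall>c>0. \<exists>\<delta>>0. \<forall>r. 0 < r \<and> r < \<delta> \<longrightarrow>
     emeasure n (mball x r) \<le> ennreal c * emeasure m (mball x r))"
    by (rule AE_density_zero[OF doubling n small_open_neighbourhood[OF n doubling outer E zero le q]])
  moreover have "AE x in m. x \<in> space m" by (rule AE_space)
  ultimately show ?thesis unfolding n_def[symmetric] by eventually_elim (auto simp: E_def)
qed

lemma nu_le_above:
  assumes A: "A \<in> sets (borel_of mtopology)" "A \<subseteq> mball x r" and q: "0 \<le> q" and c: "0 \<le> c"
    and le: "emeasure (density m (\<lambda>x. w x - ennreal q)) (mball x r) \<le> ennreal c * emeasure m (mball x r)"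
  shows "measure \<nu> A \<le> q * measure m A + c * measure m (mball x r)"
proof -
  have Am: "A \<in> sets m" "mball x r \<in> sets m" using A by (auto simp: doubling_sets[OF doubling])
  have "emeasure \<nu> A = (\<integral>\<^sup>+x\<in>A. w x \<partial>m)" using A by (simp add: nu_eq_integral)
  also have "\<dots> \<le> (\<integral>\<^sup>+x. (w x - ennreal q) * indicator A x + ennreal q * indicator A x \<partial>m)"
  proof (rule nn_integral_mono)
    fix x
    have "w x \<le> (w x - ennreal q) + ennreal q"
      by (metis add.commute diff_add_cancel_ennreal diff_eq_0_ennreal ennreal_less_top ennreal_minus_le_iff le_cases order_refl)
    then show "w x * indicator A x \<le> (w x - ennreal q) * indicator A x + ennreal q * indicator A x"
      by (simp add: indicator_def)
  qed
  also have "\<dots> = (\<integral>\<^sup>+x\<in>A. (w x - ennreal q) \<partial>m) + ennreal q * emeasure m A"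
    using Am by (subst nn_integral_add) (auto simp: nn_integral_cmult_indicator)
  also have "(\<integral>\<^sup>+x\<in>A. (w x - ennreal q) \<partial>m) = emeasure (density m (\<lambda>x. w x - ennreal q)) A"
    using Am by (intro emeasure_density[symmetric]) auto
  also have "\<dots> \<le> emeasure (density m (\<lambda>x. w x - ennreal q)) (mball x r)"
    using A Am by (intro emeasure_mono) auto
  also note le
  finally have "emeasure \<nu> A \<le> ennreal c * emeasure m (mball x r) + ennreal q * emeasure m A" by simp
  then have "ennreal (measure \<nu> A) \<le> ennreal (c * measure m (mball x r) + q * measure m A)"
    using q c by (simp add: doubling_emeasure[OF nu A(2)] doubling_emeasure[OF doubling A(2)]
       doubling_emeasure[OF doubling, of "mball x r" x r] ennreal_plus ennreal_mult)
  then show ?thesis using q c by (simp add: ennreal_le_iff del: ennreal_plus)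
qed

lemma nu_ge_below:
  assumes A: "A \<in> sets (borel_of mtopology)" "A \<subseteq> mball x r" and q: "0 \<le> q" and c: "0 \<le> c"
    and le: "emeasure (density m (\<lambda>x. ennreal q - w x)) (mball x r) \<le> ennreal c * emeasure m (mball x r)"
  shows "q * measure m A \<le> measure \<nu> A + c * measure m (mball x r)"
proof -
  have Am: "A \<in> sets m" "mball x r \<in> sets m" using A by (auto simp: doubling_sets[OF doubling])
  have "ennreal q * emeasure m A = (\<integral>\<^sup>+x. ennreal q * indicator A x \<partial>m)"
    using Am by (simp add: nn_integral_cmult_indicator)
  also have "\<dots> \<le> (\<integral>\<^sup>+x. (ennreal q - w x) * indicator A x + w x * indicator A x \<partial>m)"
  proof (rule nn_integral_mono)
    fix x
    have "ennreal q \<le> (ennreal q - w x) + w x"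
      by (metis add.commute diff_add_cancel_ennreal ennreal_minus_le_iff order_refl)
    then show "ennreal q * indicator A x \<le> (ennreal q - w x) * indicator A x + w x * indicator A x"
      by (simp add: indicator_def)
  qed
  also have "\<dots> = (\<integral>\<^sup>+x\<in>A. (ennreal q - w x) \<partial>m) + emeasure \<nu> A"
    using Am A by (subst nn_integral_add) (auto simp: nu_eq_integral)
  also have "(\<integral>\<^sup>+x\<in>A. (ennreal q - w x) \<partial>m) = emeasure (density m (\<lambda>x. ennreal q - w x)) A"
    using Am by (intro emeasure_density[symmetric]) auto
  also have "\<dots> \<le> emeasure (density m (\<lambda>x. ennreal q - w x)) (mball x r)"
    using A Am by (intro emeasure_mono) auto
  also note le
  finally have "ennreal q * emeasure m A \<le> ennreal c * emeasure m (mball x r) + emeasure \<nu> A" by simp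
  then have "ennreal (q * measure m A) \<le> ennreal (c * measure m (mball x r) + measure \<nu> A)"
    using q c by (simp add: doubling_emeasure[OF nu A(2)] doubling_emeasure[OF doubling A(2)]
       doubling_emeasure[OF doubling, of "mball x r" x r] ennreal_plus ennreal_mult)
  then show ?thesis using q c by (simp add: ennreal_le_iff del: ennreal_plus)
qed

text \<open>
  Differentiation along all Borel subsets of small balls, with an error relative to the ball: a set that
  fills a fixed proportion of the ball then has the right quotient in the limit.  Approximate \<open>w x\<close> by rational
  numbers from above and below.
\<close>

lemma AE_differentiation:
  "AE x in m. \<forall>e>0. \<exists>\<delta>>0. \<forall>r A. 0 < r \<longrightarrow> r < \<delta> \<longrightarrow> A \<in> sets (borel_of mtopology) \<longrightarrow> A \<subseteq> mball x r \<longrightarrow>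
     \<bar>measure \<nu> A - enn2real (w x) * measure m A\<bar> \<le> e * measure m (mball x r)"
proof -
  define P where "P q x \<longleftrightarrow> (\<forall>c>0. \<exists>\<delta>>0. \<forall>r. 0 < r \<and> r < \<delta> \<longrightarrow>
     emeasure (density m (\<lambda>x. w x - ennreal q)) (mball x r) \<le> ennreal c * emeasure m (mball x r))" for q x
  define P' where "P' q x \<longleftrightarrow> (\<forall>c>0. \<exists>\<delta>>0. \<forall>r. 0 < r \<and> r < \<delta> \<longrightarrow>
     emeasure (density m (\<lambda>x. ennreal q - w x)) (mball x r) \<le> ennreal c * emeasure m (mball x r))" for q x
  have "countable (\<rat> \<inter> {0..} :: real set)" using countable_rat by (rule countable_subset[rotated]) auto
  then have "AE x in m. \<forall>q\<in>\<rat> \<inter> {0..}. (w x \<le> ennreal q \<longrightarrow> P q x) \<and> (ennreal q \<le> w x \<longrightarrow> P' q x)"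
    using AE_density_above AE_density_below unfolding P_def P'_def by (subst AE_ball_countable) auto
  then show ?thesis using AE_w_finite
  proof eventually_elim
    fix x assume rat: "\<forall>q\<in>\<rat> \<inter> {0..}. (w x \<le> ennreal q \<longrightarrow> P q x) \<and> (ennreal q \<le> w x \<longrightarrow> P' q x)"
      and fin: "w x < \<infinity>"
    define W where "W = enn2real (w x)"
    have W: "0 \<le> W" "w x = ennreal W" using fin by (auto simp: W_def less_top)
    show "\<forall>e>0. \<exists>\<delta>>0. \<forall>r A. 0 < r \<longrightarrow> r < \<delta> \<longrightarrow> A \<in> sets (borel_of mtopology) \<longrightarrow> A \<subseteq> mball x r \<longrightarrow>
       \<bar>measure \<nu> A - enn2real (w x) * measure m A\<bar> \<le> e * measure m (mball x r)"
      unfolding W_def[symmetric]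
    proof (intro allI impI)
      fix e :: real assume e: "0 < e"
      have "W < W + e / 2" using e by simp
      then obtain q where q: "q \<in> \<rat>" "W < q" "q < W + e / 2" using Rats_dense_in_real by blast
      then have "P q x" using rat W by (simp add: ennreal_leI)
      then obtain \<delta>1 where \<delta>1: "0 < \<delta>1" "\<And>r. 0 < r \<Longrightarrow> r < \<delta>1 \<Longrightarrow>
          emeasure (density m (\<lambda>x. w x - ennreal q)) (mball x r) \<le> ennreal (e / 2) * emeasure m (mball x r)"
        unfolding P_def using half_gt_zero[OF e] by blast
      have "\<exists>\<delta>2>0. \<forall>r A. 0 < r \<longrightarrow> r < \<delta>2 \<longrightarrow> A \<in> sets (borel_of mtopology) \<longrightarrow> A \<subseteq> mball x r \<longrightarrow>
          W * measure m A \<le> measure \<nu> A + e * measure m (mball x r)"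
      proof (cases "W = 0")
        case True
        then show ?thesis using e by (intro exI[of _ 1]) auto
      next
        case False
        then have "max 0 (W - e / 2) < W" using W e by simp
        then obtain q' where q': "q' \<in> \<rat>" "max 0 (W - e / 2) < q'" "q' < W" using Rats_dense_in_real by blast
        then have "P' q' x" using rat W by (simp add: ennreal_leI)
        then obtain \<delta>2 where \<delta>2: "0 < \<delta>2" "\<And>r. 0 < r \<Longrightarrow> r < \<delta>2 \<Longrightarrow>
          emeasure (density m (\<lambda>x. ennreal q' - w x)) (mball x r) \<le> ennreal (e / 2) * emeasure m (mball x r)"
          unfolding P'_def using half_gt_zero[OF e] by blast
        have "W * measure m A \<le> measure \<nu> A + e * measure m (mball x r)"
          if r: "0 < r" "r < \<delta>2" and A: "A \<in> sets (borel_of mtopology)" "A \<subseteq> mball x r" for r A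
        proof -
          have 1: "q' * measure m A \<le> measure \<nu> A + e / 2 * measure m (mball x r)"
            using q' e by (intro nu_ge_below[OF A _ _ \<delta>2(2)[OF r]]) auto
          have "W * measure m A \<le> (q' + e / 2) * measure m A" using q' by (intro mult_right_mono) auto
          moreover have "e / 2 * measure m A \<le> e / 2 * measure m (mball x r)"
            using e A by (intro mult_left_mono doubling_mono[OF doubling A(2)]) (auto simp: doubling_sets[OF doubling])
          ultimately show ?thesis using 1 by (simp add: algebra_simps)
        qed
        with \<delta>2(1) show ?thesis by blast
      qed
      then obtain \<delta>2 where \<delta>2: "0 < \<delta>2" "\<And>r A. 0 < r \<Longrightarrow> r < \<delta>2 \<Longrightarrow> A \<in> sets (borel_of mtopology) \<Longrightarrow> A \<subseteq> mball x r \<Longrightarrow>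
          W * measure m A \<le> measure \<nu> A + e * measure m (mball x r)" by blast
      have "\<bar>measure \<nu> A - W * measure m A\<bar> \<le> e * measure m (mball x r)"
        if r: "0 < r" "r < min \<delta>1 \<delta>2" and A: "A \<in> sets (borel_of mtopology)" "A \<subseteq> mball x r" for r A
      proof -
        have "measure \<nu> A \<le> q * measure m A + e / 2 * measure m (mball x r)"
          using q W e r by (intro nu_le_above[OF A _ _ \<delta>1(2)]) auto
        moreover have "q * measure m A \<le> (W + e / 2) * measure m A" using q by (intro mult_right_mono) auto
        moreover have "e / 2 * measure m A \<le> e / 2 * measure m (mball x r)"
          using e A by (intro mult_left_mono doubling_mono[OF doubling A(2)]) (auto simp: doubling_sets[OF doubling])
        ultimately have "measure \<nu> A - W * measure m A \<le> e * measure m (mball x r)" by (simp add: algebra_simps)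
        moreover have "W * measure m A \<le> measure \<nu> A + e * measure m (mball x r)" using r A by (intro \<delta>2(2)) auto
        ultimately show ?thesis by linarith
      qed
      then show "\<exists>\<delta>>0. \<forall>r A. 0 < r \<longrightarrow> r < \<delta> \<longrightarrow> A \<in> sets (borel_of mtopology) \<longrightarrow> A \<subseteq> mball x r \<longrightarrow>
         \<bar>measure \<nu> A - W * measure m A\<bar> \<le> e * measure m (mball x r)"
        using \<delta>1(1) \<delta>2(1) by (intro exI[of _ "min \<delta>1 \<delta>2"]) auto
    qed
  qed
qed

end

section \<open>Mean oscillation and measures on subalgebras\<close>

lemma mean_oscillation_le:
  assumes A: "A \<in> sets \<mu>" "emeasure \<mu> A < \<infinity>" "0 < measure \<mu> A" and g: "g \<in> borel_measurable \<mu>"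
    and K: "0 \<le> K" and le: "(\<integral>\<^sup>+x\<in>A. ennreal \<bar>g x - L\<bar> \<partial>\<mu>) \<le> ennreal (K * measure \<mu> A)"
  shows "set_integrable \<mu> A g" "mean_oscillation \<mu> A g \<le> 2 * K"
proof -
  have const: "set_integrable \<mu> A (\<lambda>_. k)" for k :: real
    using A unfolding set_integrable_def by (simp add: less_top)
  have constv: "(LINT x:A|\<mu>. k) = k * measure \<mu> A" for k :: real
    using A by (simp add: set_lebesgue_integral_def less_top)
  have eq: "(\<integral>\<^sup>+x. ennreal (norm (indicator A x *\<^sub>R (g x - L))) \<partial>\<mu>) = (\<integral>\<^sup>+x\<in>A. ennreal \<bar>g x - L\<bar> \<partial>\<mu>)"
    by (intro nn_integral_cong) (auto simp: indicator_def)
  have int: "set_integrable \<mu> A (\<lambda>x. g x - L)"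
    unfolding set_integrable_def
  proof (rule integrableI_bounded)
    show "(\<lambda>x. indicator A x *\<^sub>R (g x - L)) \<in> borel_measurable \<mu>" using g A by measurable
    show "(\<integral>\<^sup>+x. ennreal (norm (indicator A x *\<^sub>R (g x - L))) \<partial>\<mu>) < \<infinity>"
      unfolding eq using le by (rule le_less_trans) simp
  qed
  then have "set_integrable \<mu> A (\<lambda>x. (g x - L) + L)" using const by (rule set_integral_add(1))
  then show gint: "set_integrable \<mu> A g" by simp
  have absint: "set_integrable \<mu> A (\<lambda>x. \<bar>g x - L\<bar>)" using int by (rule set_integrable_abs)
  have I: "(LINT x:A|\<mu>. \<bar>g x - L\<bar>) \<le> K * measure \<mu> A"
  proof -
    have "(LINT x:A|\<mu>. \<bar>g x - L\<bar>) = enn2real (\<integral>\<^sup>+x. ennreal (indicator A x *\<^sub>R \<bar>g x - L\<bar>) \<partial>\<mu>)"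
      unfolding set_lebesgue_integral_def using g A by (intro integral_eq_nn_integral) auto
    also have "(\<integral>\<^sup>+x. ennreal (indicator A x *\<^sub>R \<bar>g x - L\<bar>) \<partial>\<mu>) = (\<integral>\<^sup>+x\<in>A. ennreal \<bar>g x - L\<bar> \<partial>\<mu>)"
      by (intro nn_integral_cong) (auto simp: indicator_def)
    also have "enn2real \<dots> \<le> K * measure \<mu> A"
      using le K by (intro enn2real_leI) auto
    finally show ?thesis .
  qed
  define a where "a = average \<mu> A g"
  have "(LINT x:A|\<mu>. g x - L) = (LINT x:A|\<mu>. g x) - L * measure \<mu> A"
    using set_integral_diff(2)[OF gint const] constv by simp
  then have "a - L = (LINT x:A|\<mu>. g x - L) / measure \<mu> A"
    using A(3) by (simp add: a_def average_def field_simps)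
  moreover have "\<bar>LINT x:A|\<mu>. g x - L\<bar> \<le> (LINT x:A|\<mu>. \<bar>g x - L\<bar>)"
    using set_integral_norm_bound[OF int] by simp
  ultimately have aL: "\<bar>a - L\<bar> \<le> K"
    using I A(3) by (simp add: abs_divide pos_divide_le_eq)
  have "(LINT x:A|\<mu>. \<bar>g x - a\<bar>) \<le> (LINT x:A|\<mu>. \<bar>g x - L\<bar> + K)"
  proof (rule set_integral_mono)
    show "set_integrable \<mu> A (\<lambda>x. \<bar>g x - a\<bar>)" by (intro set_integrable_abs set_integral_diff(1) gint const)
    show "set_integrable \<mu> A (\<lambda>x. \<bar>g x - L\<bar> + K)" by (intro set_integral_add(1) absint const)
  qed (use aL in linarith)
  also have "\<dots> = (LINT x:A|\<mu>. \<bar>g x - L\<bar>) + K * measure \<mu> A"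
    using set_integral_add(2)[OF absint const] constv by simp
  also have "\<dots> \<le> 2 * K * measure \<mu> A" using I by simp
  finally show "mean_oscillation \<mu> A g \<le> 2 * K"
    unfolding mean_oscillation_def a_def[symmetric] average_def[of \<mu> A "\<lambda>y. \<bar>g y - a\<bar>"]
    using A(3) by (simp add: pos_divide_le_eq)
qed

text \<open>
  Open sets of the open subspace are open in the whole space.  This is applied to very weak gradients, which are
  Borel functions on a ball only.
\<close>

lemma measurable_restrict_space_subtopology:
  assumes U: "openin T U" and h: "h \<in> measurable (borel_of (subtopology T U)) N"
  shows "h \<in> measurable (restrict_space (borel_of T) U) N"
proof -
  have UT: "U \<subseteq> topspace T" using U by (rule openin_subset)
  have "(\<lambda>x. x) \<in> measurable (restrict_space (borel_of T) U) (borel_of (subtopology T U))"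
    unfolding borel_of_def[of "subtopology T U"]
  proof (rule measurable_measure_of)
    show "{V. openin (subtopology T U) V} \<subseteq> Pow (topspace (subtopology T U))" using openin_subset by blast
    show "(\<lambda>x. x) \<in> space (restrict_space (borel_of T) U) \<rightarrow> topspace (subtopology T U)"
      using UT by (auto simp: space_restrict_space)
    fix V assume "V \<in> {V. openin (subtopology T U) V}"
    then have "openin T V" "V \<subseteq> U" using U openin_open_subtopology by auto
    then show "(\<lambda>x. x) -` V \<inter> space (restrict_space (borel_of T) U) \<in> sets (restrict_space (borel_of T) U)"
      using UT openin_imp_borel[OF U] openin_imp_borel[of T V]
      by (subst sets_restrict_space_iff) (auto simp: space_restrict_space Int_absorb2 Int_absorb1)
  qed
  from measurable_compose[OF this h] show ?thesis by simp
qed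

lemma ennreal_powr_measurable: "(\<lambda>a. ennreal_powr a s) \<in> borel_measurable borel"
  unfolding ennreal_powr_def by measurable

lemma set_lebesgue_integral_subalgebra:
  fixes u :: "'a \<Rightarrow> real"
  assumes "(\<lambda>x. indicator B x *\<^sub>R u x) \<in> borel_measurable N" "subalgebra \<mu> N" "\<And>E. E \<in> sets N \<Longrightarrow> emeasure N E = emeasure \<mu> E"
  shows "(LINT x:B|N. u x) = (LINT x:B|\<mu>. u x)"
  unfolding set_lebesgue_integral_def using assms by (intro integral_subalgebra) (auto simp: subalgebra_def)

lemma mean_oscillation_subalgebra:
  assumes B: "B \<in> sets N" and u: "(\<lambda>x. indicator B x *\<^sub>R u x) \<in> borel_measurable N"
    and sub: "subalgebra \<mu> N" "\<And>E. E \<in> sets N \<Longrightarrow> emeasure N E = emeasure \<mu> E"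
  shows "mean_oscillation N B u = mean_oscillation \<mu> B u"
proof -
  have mB: "measure N B = measure \<mu> B" using sub(2)[OF B] by (simp add: measure_def)
  have avg: "average N B u = average \<mu> B u"
    unfolding average_def using set_lebesgue_integral_subalgebra[OF u sub] mB by simp
  define a where "a = average \<mu> B u"
  have "(\<lambda>x. \<bar>indicator B x *\<^sub>R u x - a\<bar> * indicator B x) \<in> borel_measurable N" using u B by measurable
  also have "(\<lambda>x. \<bar>indicator B x *\<^sub>R u x - a\<bar> * indicator B x) = (\<lambda>x. indicator B x *\<^sub>R \<bar>u x - a\<bar>)"
    by (auto simp: indicator_def)
  finally have "(LINT x:B|N. \<bar>u x - a\<bar>) = (LINT x:B|\<mu>. \<bar>u x - a\<bar>)"
    using sub by (intro set_lebesgue_integral_subalgebra) auto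
  then show ?thesis unfolding mean_oscillation_def avg a_def[symmetric] average_def[of _ _ "\<lambda>y. \<bar>u y - a\<bar>"] mB by simp
qed

context Metric_space
begin

text \<open>
  The inequality involves Borel functions and Borel sets only, so it passes to the restriction of \<open>\<mu>\<close> to
  the Borel sets.
\<close>

lemma weak_poincare_subalgebra:
  assumes wp: "weak_poincare M d \<mu> p" and N: "sets N = sets (borel_of mtopology)"
    and sub: "subalgebra \<mu> N" "\<And>E. E \<in> sets N \<Longrightarrow> emeasure N E = emeasure \<mu> E"
  shows "weak_poincare M d N p"
proof -
  obtain Cp C0 where Cp: "1 \<le> Cp" and C0: "1 \<le> C0" and
    PI: "\<forall>x\<in>M. \<forall>r>0. \<forall>u g.
         continuous_map (subtopology mtopology (mball x (C0 * r))) euclideanreal u \<and>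
         bounded (u ` mball x (C0 * r)) \<and> very_weak_gradient M d (mball x (C0 * r)) u g \<longrightarrow>
         ennreal (mean_oscillation \<mu> (mball x r) u) \<le>
           ennreal Cp * diam_of d (mball x r) *
           ennreal_powr ((\<integral>\<^sup>+ y\<in>mball x (C0 * r). ennreal_powr (g y) p \<partial>\<mu>) / emeasure \<mu> (mball x (C0 * r))) (1 / p)"
    using wp unfolding weak_poincare_def Let_def by (elim exE conjE) (rule that)
  have ball: "mball x r \<in> sets N" for x r by (simp add: N)
  have "ennreal (mean_oscillation N (mball x r) u) \<le>
           ennreal Cp * diam_of d (mball x r) *
           ennreal_powr ((\<integral>\<^sup>+ y\<in>mball x (C0 * r). ennreal_powr (g y) p \<partial>N) / emeasure N (mball x (C0 * r))) (1 / p)"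
    if x: "x \<in> M" and r: "0 < r"
      and u: "continuous_map (subtopology mtopology (mball x (C0 * r))) euclideanreal u"
      and bd: "bounded (u ` mball x (C0 * r))" and vg: "very_weak_gradient M d (mball x (C0 * r)) u g" for x r u g
  proof -
    define U where "U = mball x (C0 * r)"
    have U: "openin mtopology U" "U \<inter> space (borel_of mtopology) \<in> sets (borel_of mtopology)"
      unfolding U_def by (auto simp: Int_absorb2 mball_subset_mspace)
    have sub_ball: "mball x r \<subseteq> U" unfolding U_def using C0 r by (intro mball_subset_concentric) simp
    have "u \<in> borel_measurable (borel_of (subtopology mtopology U))"
      using u unfolding U_def by (intro continuous_map_borel_measurable) auto
    then have "u \<in> borel_measurable (restrict_space (borel_of mtopology) U)"
      by (rule measurable_restrict_space_subtopology[OF U(1)])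
    then have "(\<lambda>y. indicator U y *\<^sub>R u y) \<in> borel_measurable N"
      unfolding measurable_cong_sets[OF N refl] borel_measurable_restrict_space_iff[OF U(2)] .
    then have "(\<lambda>y. indicator (mball x r) y *\<^sub>R (indicator U y *\<^sub>R u y)) \<in> borel_measurable N"
      using ball by measurable
    also have "(\<lambda>y. indicator (mball x r) y *\<^sub>R (indicator U y *\<^sub>R u y)) = (\<lambda>y. indicator (mball x r) y *\<^sub>R u y)"
    proof
      fix y
      have "y \<in> mball x r \<Longrightarrow> y \<in> U" using sub_ball by blast
      then show "indicator (mball x r) y *\<^sub>R (indicator U y *\<^sub>R u y) = indicator (mball x r) y *\<^sub>R u y"
        by (cases "y \<in> mball x r") (simp_all del: in_mball)
    qed
    finally have osc: "mean_oscillation N (mball x r) u = mean_oscillation \<mu> (mball x r) u"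
      by (rule mean_oscillation_subalgebra[OF ball _ sub])
    have "g \<in> borel_measurable (borel_of (subtopology mtopology U))"
      using vg unfolding very_weak_gradient_def U_def by blast
    then have "(\<lambda>y. ennreal_powr (g y) p) \<in> borel_measurable (borel_of (subtopology mtopology U))"
      by (rule measurable_compose[OF _ ennreal_powr_measurable])
    then have "(\<lambda>y. ennreal_powr (g y) p) \<in> borel_measurable (restrict_space (borel_of mtopology) U)"
      by (rule measurable_restrict_space_subtopology[OF U(1)])
    then have "(\<lambda>y. ennreal_powr (g y) p * indicator U y) \<in> borel_measurable N"
      unfolding measurable_cong_sets[OF N refl] borel_measurable_restrict_space_iff_ennreal[OF U(2)] .
    then have "(\<integral>\<^sup>+ y\<in>U. ennreal_powr (g y) p \<partial>N) = (\<integral>\<^sup>+ y\<in>U. ennreal_powr (g y) p \<partial>\<mu>)"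
      using sub by (intro nn_integral_subalgebra) (auto simp: subalgebra_def)
    moreover have "emeasure N U = emeasure \<mu> U" unfolding U_def by (rule sub(2)[OF ball])
    ultimately show ?thesis
      using PI[rule_format, OF x r conjI[OF u conjI[OF bd vg]]] osc unfolding U_def by simp
  qed
  then show ?thesis unfolding weak_poincare_def Let_def
    using Cp C0 by (intro exI[of _ Cp] exI[of _ C0]) blast
qed

end

section \<open>Snowflakes of quasimetrics\<close>

locale snowflake = Metric_space +
  fixes \<rho> :: "'a \<Rightarrow> 'a \<Rightarrow> real" and \<epsilon> c :: real
  assumes rho_nonneg: "\<And>x y. x \<in> M \<Longrightarrow> y \<in> M \<Longrightarrow> 0 \<le> \<rho> x y"
    and rho_zero: "\<And>x y. x \<in> M \<Longrightarrow> y \<in> M \<Longrightarrow> \<rho> x y = 0 \<longleftrightarrow> x = y"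
    and eps: "0 < \<epsilon>" and c: "1 \<le> c"
    and comparable: "\<And>x y. x \<in> M \<Longrightarrow> y \<in> M \<Longrightarrow> \<rho> x y powr \<epsilon> \<le> c * d x y \<and> d x y \<le> c * \<rho> x y powr \<epsilon>"
begin

lemma qball_subset_mball:
  assumes "x \<in> M" "0 < r" shows "qball M \<rho> x r \<subseteq> mball x (c * r powr \<epsilon>)"
proof
  fix y assume "y \<in> qball M \<rho> x r"
  then have y: "y \<in> M" "\<rho> x y < r" by (auto simp: qball_def)
  then have "\<rho> x y powr \<epsilon> < r powr \<epsilon>" using assms rho_nonneg eps by (intro powr_less_mono2) auto
  then have "c * \<rho> x y powr \<epsilon> < c * r powr \<epsilon>" using c by simp
  then show "y \<in> mball x (c * r powr \<epsilon>)" using comparable[of x y] assms y by simp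
qed

lemma mball_subset_qball:
  assumes "x \<in> M" "0 < r" shows "mball x (r powr \<epsilon> / c) \<subseteq> qball M \<rho> x r"
proof
  fix y assume y: "y \<in> mball x (r powr \<epsilon> / c)"
  then have "c * d x y < r powr \<epsilon>" using c by (simp add: field_simps)
  then have "\<rho> x y powr \<epsilon> < r powr \<epsilon>" using comparable[of x y] assms y by auto
  then have "\<rho> x y < r" using assms eps powr_mono2[of \<epsilon> r "\<rho> x y"] by linarith
  then show "y \<in> qball M \<rho> x r" using y by (simp add: qball_def)
qed

lemma mball_subset_qball':
  assumes "x \<in> M" "0 < s" shows "mball x s \<subseteq> qball M \<rho> x ((c * s) powr (1 / \<epsilon>))"
  using mball_subset_qball[of x "(c * s) powr (1 / \<epsilon>)"] assms c eps by (simp add: powr_powr)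

lemma qtopology_eq: "qtopology M \<rho> = mtopology"
proof -
  have "openin (qtopology M \<rho>) U \<longleftrightarrow> openin mtopology U" for U
    unfolding openin_qtopology openin_mtopology
  proof (intro conj_cong refl iffI allI impI ballI)
    fix x assume U: "U \<subseteq> M" and *: "\<forall>x\<in>U. \<exists>r>0. qball M \<rho> x r \<subseteq> U" and x: "x \<in> U"
    then obtain r where r: "r > 0" "qball M \<rho> x r \<subseteq> U" by blast
    then have "mball x (r powr \<epsilon> / c) \<subseteq> U" using mball_subset_qball[of x r] U x by blast
    then show "\<exists>r>0. mball x r \<subseteq> U" using r c by (intro exI[of _ "r powr \<epsilon> / c"]) auto
  next
    fix x assume U: "U \<subseteq> M" and *: "\<forall>x. x \<in> U \<longrightarrow> (\<exists>r>0. mball x r \<subseteq> U)" and x: "x \<in> U"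
    then obtain r where r: "r > 0" "mball x r \<subseteq> U" by blast
    have "c * ((r / c) powr (1 / \<epsilon>)) powr \<epsilon> = r" using r c eps by (simp add: powr_powr)
    then have "qball M \<rho> x ((r / c) powr (1 / \<epsilon>)) \<subseteq> U"
      using qball_subset_mball[of x "(r / c) powr (1 / \<epsilon>)"] r c U x by auto
    then show "\<exists>r>0. qball M \<rho> x r \<subseteq> U" using r c by (intro exI[of _ "(r / c) powr (1 / \<epsilon>)"]) auto
  qed
  then show ?thesis by (simp add: topology_eq)
qed

text \<open>
  \<open>\<zeta>\<close> is the conjugate of \<open>\<eta>\<close> under the power, with the constants of the comparison.  From argument one
  onwards \<open>\<eta>\<close> is replaced by at least one, to include the case \<open>a = b\<close>, which forces \<open>1 \<le> \<theta>\<close>.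
\<close>

lemma snowflake_quasisymmetric:
  assumes inv: "\<And>x. x \<in> M \<Longrightarrow> f x \<in> M" "inj_on f M"
    and mono: "strict_mono_on {0..} \<eta>" and homeo: "homeomorphism {0..} {0..} \<eta> \<eta>'"
    and qs: "\<And>\<theta> x a b. 0 \<le> \<theta> \<Longrightarrow> x \<in> M \<Longrightarrow> a \<in> M \<Longrightarrow> b \<in> M \<Longrightarrow> x \<noteq> a \<Longrightarrow> x \<noteq> b \<Longrightarrow> a \<noteq> b \<Longrightarrow>
       \<rho> x a / \<rho> x b \<le> \<theta> \<Longrightarrow> \<rho> (f x) (f a) / \<rho> (f x) (f b) \<le> \<eta> \<theta>"
  obtains \<zeta> :: "real \<Rightarrow> real" where "\<And>e. 0 < e \<Longrightarrow> \<exists>\<theta>>0. \<zeta> \<theta> \<le> e"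
    "\<And>x a b \<theta>. x \<in> M \<Longrightarrow> a \<in> M \<Longrightarrow> b \<in> M \<Longrightarrow> 0 < \<theta> \<Longrightarrow> d x a \<le> \<theta> * d x b \<Longrightarrow>
       d (f x) (f a) \<le> \<zeta> \<theta> * d (f x) (f b)"
proof -
  define E where "E t = (if t < 1 then \<eta> t else max 1 (\<eta> t))" for t
  define \<zeta> where "\<zeta> \<theta> = c ^ 2 * E ((c ^ 2 * \<theta>) powr (1 / \<epsilon>)) powr \<epsilon>" for \<theta>
  have range: "\<eta> ` {0..} = {0..}" using homeo by (simp add: homeomorphism_def)
  have nn: "0 \<le> \<eta> t" if "0 \<le> t" for t using range that by (metis atLeast_iff image_eqI)
  have eta0: "\<eta> 0 = 0"
  proof -
    obtain s where s: "0 \<le> s" "\<eta> s = 0" using range by (metis atLeast_iff imageE order_refl)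
    show ?thesis
    proof (cases "s = 0")
      case False
      then have "\<eta> 0 < \<eta> s" using s mono by (intro strict_mono_onD[OF mono]) auto
      then show ?thesis using s nn[of 0] by simp
    qed (use s in simp)
  qed
  show ?thesis
  proof (rule that[of \<zeta>])
    fix e :: real assume e: "0 < e"
    have half: "0 < \<eta> (1/2)" using strict_mono_onD[OF mono, of 0 "1/2"] eta0 by simp
    define v where "v = min ((e / c ^ 2) powr (1 / \<epsilon>)) (\<eta> (1/2))"
    have v: "0 < v" using e c half by (simp add: v_def)
    then obtain s where s: "0 \<le> s" "\<eta> s = v" using range by (metis atLeast_iff imageE less_imp_le)
    have "s \<noteq> 0" using s v eta0 by auto
    then have sp: "0 < s" using s by simp
    have "s < 1"
    proof (rule ccontr)
      assume "\<not> s < 1"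
      then have "\<eta> (1/2) < \<eta> s" using strict_mono_onD[OF mono, of "1/2" s] by simp
      then show False using s by (simp add: v_def)
    qed
    define \<theta> where "\<theta> = s powr \<epsilon> / c ^ 2"
    have "(c ^ 2 * \<theta>) powr (1 / \<epsilon>) = s" unfolding \<theta>_def using sp c eps by (simp add: powr_powr)
    then have "\<zeta> \<theta> = c ^ 2 * v powr \<epsilon>" unfolding \<zeta>_def E_def using \<open>s < 1\<close> s by simp
    also have "\<dots> \<le> c ^ 2 * ((e / c ^ 2) powr (1 / \<epsilon>)) powr \<epsilon>"
      using v eps by (intro mult_left_mono powr_mono2) (auto simp: v_def)
    also have "\<dots> = e" using e c eps by (simp add: powr_powr)
    finally show "\<exists>\<theta>>0. \<zeta> \<theta> \<le> e" using sp c by (intro exI[of _ \<theta>]) (auto simp: \<theta>_def)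
  next
    fix x a b :: 'a and \<theta> :: real
    assume x: "x \<in> M" and a: "a \<in> M" and b: "b \<in> M" and \<theta>: "0 < \<theta>" and le: "d x a \<le> \<theta> * d x b"
    define T where "T = (c ^ 2 * \<theta>) powr (1 / \<epsilon>)"
    have T: "0 < T" "T powr \<epsilon> = c ^ 2 * \<theta>" unfolding T_def using c \<theta> eps by (auto simp: powr_powr)
    have E0: "0 \<le> E T" unfolding E_def using nn[of T] T by auto
    have z: "\<zeta> \<theta> = c ^ 2 * E T powr \<epsilon>" by (simp add: \<zeta>_def T_def)
    consider "x = a" | "x \<noteq> a" "a = b" | "x \<noteq> a" "a \<noteq> b" by blast
    then show "d (f x) (f a) \<le> \<zeta> \<theta> * d (f x) (f b)"
    proof cases
      case 1
      then have "d (f x) (f a) = 0" using inv(1)[OF a] by simp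
      then show ?thesis unfolding \<zeta>_def by simp
    next
      case 2
      then have "0 < d x b" using x b by simp
      then have "1 \<le> \<theta>" using le unfolding \<open>a = b\<close> by (simp add: mult_le_cancel_right1)
      moreover have "1 \<le> c ^ 2" using c by (rule one_le_power)
      ultimately have "1 \<le> c ^ 2 * \<theta>" using mult_mono[of 1 "c ^ 2" 1 \<theta>] by simp
      then have "1 \<le> T" unfolding T_def using eps by (intro ge_one_powr_ge_zero) auto
      then have "1 \<le> E T powr \<epsilon>" unfolding E_def using eps by (intro ge_one_powr_ge_zero) auto
      then have "1 \<le> \<zeta> \<theta>" unfolding z using \<open>1 \<le> c ^ 2\<close> mult_mono[of 1 "c ^ 2" 1 "E T powr \<epsilon>"] by simp
      then have "1 * d (f x) (f b) \<le> \<zeta> \<theta> * d (f x) (f b)" by (rule mult_right_mono) simp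
      then show ?thesis using 2 by simp
    next
      case 3
      have "0 < d x a" using x a 3 by simp
      then have xb: "x \<noteq> b" using le \<theta> b by auto
      have rb: "0 < \<rho> x b" using rho_nonneg[OF x b] rho_zero[OF x b] xb by linarith
      have fb: "f x \<noteq> f b" using inv xb x b by (auto simp: inj_on_def)
      have rfb: "0 < \<rho> (f x) (f b)" using rho_nonneg[of "f x" "f b"] rho_zero[of "f x" "f b"] fb inv x b by force
      have rfa: "0 \<le> \<rho> (f x) (f a)" using rho_nonneg inv x a by blast
      have "\<rho> x a powr \<epsilon> \<le> c * d x a" using comparable x a by blast
      also have "\<dots> \<le> c * (\<theta> * d x b)" using le c by (intro mult_left_mono) auto
      also have "\<dots> \<le> c * (\<theta> * (c * \<rho> x b powr \<epsilon>))"
        using comparable[OF x b] \<theta> c by (intro mult_left_mono) auto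
      also have "\<dots> = (T * \<rho> x b) powr \<epsilon>" using T rb by (simp add: powr_mult power2_eq_square)
      finally have "\<rho> x a \<le> T * \<rho> x b"
        using powr_less_mono2[of \<epsilon> "T * \<rho> x b" "\<rho> x a"] eps T(1) rb mult_nonneg_nonneg[of T "\<rho> x b"] by linarith
      then have "\<rho> x a / \<rho> x b \<le> T" using rb by (simp add: pos_divide_le_eq)
      then have "\<rho> (f x) (f a) / \<rho> (f x) (f b) \<le> \<eta> T"
        using T x a b 3 xb by (intro qs) auto
      also have "\<dots> \<le> E T" unfolding E_def by simp
      finally have "\<rho> (f x) (f a) \<le> E T * \<rho> (f x) (f b)" using rfb by (simp add: pos_divide_le_eq)
      then have "\<rho> (f x) (f a) powr \<epsilon> \<le> (E T * \<rho> (f x) (f b)) powr \<epsilon>"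
        using rfa eps by (intro powr_mono2) auto
      also have "\<dots> = E T powr \<epsilon> * \<rho> (f x) (f b) powr \<epsilon>" using E0 rfb by (simp add: powr_mult)
      also have "\<dots> \<le> E T powr \<epsilon> * (c * d (f x) (f b))"
        using comparable inv x b by (intro mult_left_mono) auto
      finally have "c * \<rho> (f x) (f a) powr \<epsilon> \<le> c * (E T powr \<epsilon> * (c * d (f x) (f b)))"
        using c by (intro mult_left_mono) auto
      moreover have "d (f x) (f a) \<le> c * \<rho> (f x) (f a) powr \<epsilon>" using comparable inv x a by blast
      ultimately show ?thesis unfolding z by (simp add: power2_eq_square algebra_simps)
    qed
  qed
qed

text \<open>
  Balls of \<open>d\<close> of radius \<open>r\<close> are comparable to quasiballs of radius \<open>r powr (1 / \<epsilon>)\<close>.  For the upper bound at radii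
  above the diameter, which the regularity of \<open>\<rho>\<close> does not cover, the whole space is compared
  with a quasiball of half the diameter by doubling.
\<close>

lemma snowflake_regular:
  fixes \<mu> :: "'a measure"
  assumes reg: "alpha_regular M \<rho> \<mu> \<alpha>" and \<alpha>: "0 < \<alpha>" and two: "\<exists>y\<in>M. \<exists>z\<in>M. y \<noteq> z"
    and A1: "1 \<le> A1" and dbl: "\<And>x r. x \<in> M \<Longrightarrow> 0 < r \<Longrightarrow> emeasure \<mu> (qball M \<rho> x (2 * r)) \<le> ennreal A1 * emeasure \<mu> (qball M \<rho> x r)"
    and sets: "\<And>x r. x \<in> M \<Longrightarrow> 0 < r \<Longrightarrow> qball M \<rho> x r \<in> sets \<mu>" "\<And>x r. mball x r \<in> sets \<mu>"
  obtains K where "1 \<le> K"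
    "\<And>x r. x \<in> M \<Longrightarrow> 0 < r \<Longrightarrow> emeasure \<mu> (mball x r) \<le> ennreal (K * r powr (\<alpha> / \<epsilon>))"
    "\<And>x y z r. x \<in> M \<Longrightarrow> y \<in> M \<Longrightarrow> z \<in> M \<Longrightarrow> 0 < r \<Longrightarrow> r \<le> d y z \<Longrightarrow>
       ennreal (r powr (\<alpha> / \<epsilon>)) \<le> ennreal K * emeasure \<mu> (mball x r)"
proof -
  obtain \<kappa> where \<kappa>: "1 \<le> \<kappa>" and reg': "\<And>x r. x \<in> M \<Longrightarrow> 0 < r \<Longrightarrow> ennreal r < diam_of \<rho> M \<Longrightarrow>
        ennreal (inverse \<kappa> * r powr \<alpha>) \<le> emeasure \<mu> (qball M \<rho> x r) \<and>
        emeasure \<mu> (qball M \<rho> x r) \<le> ennreal (\<kappa> * r powr \<alpha>)"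
    using reg unfolding alpha_regular_def by blast
  define Q where "Q = \<alpha> / \<epsilon>"
  have Q: "0 < Q" using \<alpha> eps by (simp add: Q_def)
  have pow: "(t powr (1 / \<epsilon>)) powr \<alpha> = t powr Q" for t :: real unfolding Q_def by (simp add: powr_powr)
  define K where "K = max (A1 ^ 2 * \<kappa> * c powr Q) (\<kappa> * c powr Q * 2 powr \<alpha>)"
  have cQ: "1 \<le> c powr Q" using c Q by (intro ge_one_powr_ge_zero) auto
  have "1 \<le> A1 ^ 2" using A1 by (rule one_le_power)
  then have "1 * 1 \<le> A1 ^ 2 * \<kappa>" using \<kappa> by (intro mult_mono) auto
  then have "1 * 1 \<le> A1 ^ 2 * \<kappa> * c powr Q" using cQ by (intro mult_mono) auto
  then have AK: "1 \<le> A1 ^ 2 * \<kappa> * c powr Q" by simp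
  have dist_le: "ennreal (\<rho> y z) \<le> diam_of \<rho> M" if "y \<in> M" "z \<in> M" for y z
    unfolding diam_of_def using that by (intro SUP_upper2[of y] SUP_upper2[of z]) auto
  show ?thesis
  proof (rule that[of K])
    show "1 \<le> K" using AK by (simp add: K_def)
    fix x and s :: real assume x: "x \<in> M" and s: "0 < s"
    define r where "r = (c * s) powr (1 / \<epsilon>)"
    have r: "0 < r" using c s by (simp add: r_def)
    have "emeasure \<mu> (mball x s) \<le> emeasure \<mu> (qball M \<rho> x r)"
      unfolding r_def using mball_subset_qball'[OF x s] sets(1)[OF x r] unfolding r_def by (intro emeasure_mono)
    also have "\<dots> \<le> ennreal (A1 ^ 2 * \<kappa> * r powr \<alpha>)"
    proof (cases "ennreal r < diam_of \<rho> M")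
      case True
      then have "emeasure \<mu> (qball M \<rho> x r) \<le> ennreal (\<kappa> * r powr \<alpha>)" using reg' x r by blast
      also have "1 * (\<kappa> * r powr \<alpha>) \<le> A1 ^ 2 * (\<kappa> * r powr \<alpha>)"
        using \<open>1 \<le> A1 ^ 2\<close> \<kappa> by (intro mult_right_mono) auto
      then have "ennreal (\<kappa> * r powr \<alpha>) \<le> ennreal (A1 ^ 2 * \<kappa> * r powr \<alpha>)" by (intro ennreal_leI) (simp add: mult.assoc)
      finally show ?thesis .
    next
      case False
      define D where "D = enn2real (diam_of \<rho> M)"
      have "diam_of \<rho> M \<le> ennreal r" using False by simp
      then have fin: "diam_of \<rho> M = ennreal D" "D \<le> r"
        unfolding D_def using r enn2real_mono[of "diam_of \<rho> M" "ennreal r"]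
        by (auto simp: less_top[symmetric] top_unique ennreal_enn2real_if)
      obtain y z where yz: "y \<in> M" "z \<in> M" "y \<noteq> z" using two by blast
      then have "0 < \<rho> y z" using rho_nonneg[of y z] rho_zero[of y z] by force
      then have Dp: "0 < D" using dist_le[OF yz(1,2)] unfolding fin(1)
        by (metis D_def ennreal_le_iff enn2real_nonneg less_le_trans)
      have "qball M \<rho> x r \<subseteq> qball M \<rho> x (2 * (2 * (D / 2)))"
      proof
        fix y assume "y \<in> qball M \<rho> x r"
        then have y: "y \<in> M" by (simp add: qball_def)
        then have "\<rho> x y \<le> D" using dist_le[OF x y] Dp unfolding fin(1) by (simp add: ennreal_le_iff)
        then show "y \<in> qball M \<rho> x (2 * (2 * (D / 2)))" using y Dp by (simp add: qball_def)
      qed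
      then have "emeasure \<mu> (qball M \<rho> x r) \<le> emeasure \<mu> (qball M \<rho> x (2 * (2 * (D / 2))))"
        using Dp x by (intro emeasure_mono sets(1)) auto
      also have "\<dots> \<le> ennreal A1 * emeasure \<mu> (qball M \<rho> x (2 * (D / 2)))" using x Dp by (intro dbl) auto
      also have "\<dots> \<le> ennreal A1 * (ennreal A1 * emeasure \<mu> (qball M \<rho> x (D / 2)))"
        using x Dp by (intro mult_left_mono dbl) auto
      also have "\<dots> \<le> ennreal A1 * (ennreal A1 * ennreal (\<kappa> * (D / 2) powr \<alpha>))"
        using x Dp fin(1) by (intro mult_left_mono reg'[THEN conjunct2]) (auto simp: ennreal_less_iff)
      also have "\<dots> \<le> ennreal A1 * (ennreal A1 * ennreal (\<kappa> * r powr \<alpha>))"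
        using Dp fin(2) \<kappa> \<alpha> by (intro mult_left_mono ennreal_leI powr_mono2) auto
      also have "\<dots> = ennreal (A1 ^ 2 * \<kappa> * r powr \<alpha>)"
        using A1 \<kappa> by (simp add: ennreal_mult[symmetric] power2_eq_square mult.assoc)
      finally show ?thesis .
    qed
    also have "\<dots> \<le> ennreal (K * s powr Q)"
    proof (rule ennreal_leI)
      have "A1 ^ 2 * \<kappa> * r powr \<alpha> = A1 ^ 2 * \<kappa> * c powr Q * s powr Q"
        unfolding r_def pow using c s by (simp add: powr_mult)
      also have "\<dots> \<le> K * s powr Q" by (intro mult_right_mono) (auto simp: K_def)
      finally show "A1 ^ 2 * \<kappa> * r powr \<alpha> \<le> K * s powr Q" .
    qed
    finally show "emeasure \<mu> (mball x s) \<le> ennreal (K * s powr (\<alpha> / \<epsilon>))" by (simp add: Q_def)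
  next
    fix x y z :: 'a and s :: real assume x: "x \<in> M" and yz: "y \<in> M" "z \<in> M" and s: "0 < s" "s \<le> d y z"
    define r0 where "r0 = (s / c) powr (1 / \<epsilon>)"
    have r0: "0 < r0" "r0 powr \<epsilon> = s / c" unfolding r0_def using s c eps by (auto simp: powr_powr)
    have "s \<le> c * \<rho> y z powr \<epsilon>" using comparable[OF yz] s by simp
    then have "r0 powr \<epsilon> \<le> \<rho> y z powr \<epsilon>" unfolding r0 using c by (simp add: field_simps)
    then have "r0 \<le> \<rho> y z"
      using powr_less_mono2[of \<epsilon> "\<rho> y z" r0] eps rho_nonneg[OF yz] by linarith
    define r where "r = r0 / 2"
    have r: "0 < r" "r < \<rho> y z" using r0 \<open>r0 \<le> \<rho> y z\<close> by (auto simp: r_def)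
    have "ennreal r < diam_of \<rho> M"
      using less_le_trans[OF ennreal_lessI dist_le[OF yz]] r by simp
    then have lo: "ennreal (inverse \<kappa> * r powr \<alpha>) \<le> emeasure \<mu> (qball M \<rho> x r)" using reg' x r by blast
    have "r powr \<epsilon> \<le> s / c" using powr_mono2[of \<epsilon> r r0] r0 eps by (simp add: r_def)
    then have "c * r powr \<epsilon> \<le> s" using c by (simp add: field_simps)
    then have sub: "qball M \<rho> x r \<subseteq> mball x s"
      using qball_subset_mball[OF x r(1)] mball_subset_concentric[of "c * r powr \<epsilon>" s x] by blast
    have "s powr Q = c powr Q * (s / c) powr Q" using s c by (simp add: powr_divide)
    also have "(s / c) powr Q = r0 powr \<alpha>" unfolding r0_def pow ..
    also have "r0 powr \<alpha> = 2 powr \<alpha> * r powr \<alpha>" unfolding r_def using r0 by (simp add: powr_divide)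
    finally have "s powr Q = (\<kappa> * c powr Q * 2 powr \<alpha>) * (inverse \<kappa> * r powr \<alpha>)" using \<kappa> by simp
    also have "\<dots> \<le> K * (inverse \<kappa> * r powr \<alpha>)" using \<kappa> by (intro mult_right_mono) (auto simp: K_def)
    finally have "ennreal (s powr Q) \<le> ennreal (K * (inverse \<kappa> * r powr \<alpha>))" by (rule ennreal_leI)
    also have "\<dots> = ennreal K * ennreal (inverse \<kappa> * r powr \<alpha>)"
      using AK \<kappa> by (intro ennreal_mult) (auto simp: K_def)
    also have "\<dots> \<le> ennreal K * emeasure \<mu> (mball x s)"
      using lo sub by (intro mult_left_mono order_trans[OF lo] emeasure_mono sets) auto
    finally show "ennreal (s powr (\<alpha> / \<epsilon>)) \<le> ennreal K * emeasure \<mu> (mball x s)" by (simp add: Q_def)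
  qed
qed

end

section \<open>The generalised Jacobian\<close>

text \<open>
  The metric theory concerns the Borel part \<open>m\<close> of \<open>\<mu>\<close>, while quasiballs, which need not be Borel, are measured
  by \<open>\<mu>\<close> itself.
\<close>

locale jacobian_setting = qs_poincare_space + snowflake +
  fixes \<mu> :: "'a measure"
  assumes space_mu: "space \<mu> = M"
    and borel_sub: "sets (borel_of mtopology) \<subseteq> sets \<mu>"
    and m_eq: "\<And>E. E \<in> sets (borel_of mtopology) \<Longrightarrow> emeasure m E = emeasure \<mu> E"
    and qball_sets: "\<And>x r. x \<in> M \<Longrightarrow> 0 < r \<Longrightarrow> qball M \<rho> x r \<in> sets \<mu>"
    and qball_measurable: "\<And>x r. x \<in> M \<Longrightarrow> 0 < r \<Longrightarrow> mu_measurable mtopology \<mu> (qball M \<rho> x r)"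
begin

lemma AE_mu: assumes "AE x in m. P x" shows "AE x in \<mu>. P x"
proof -
  obtain N where N: "{x \<in> space m. \<not> P x} \<subseteq> N" "emeasure m N = 0" "N \<in> sets m"
    using AE_E[OF assms] by blast
  have Nb: "N \<in> sets (borel_of mtopology)" using N(3) doubling_sets[OF doubling] by simp
  show ?thesis
    using N Nb borel_sub m_eq[OF Nb] by (intro AE_I[of _ _ N]) (auto simp: space_mu doubling_space[OF doubling])
qed

lemma qcball_eq_Inter:
  "qcball M \<rho> x r = (\<Inter>n. qball M \<rho> x (r + 1 / real (Suc n)))"
proof (intro equalityI subsetI)
  fix y assume "y \<in> qcball M \<rho> x r"
  moreover have "0 < 1 / real (Suc n)" for n by simp
  ultimately have "y \<in> M" "\<rho> x y < r + 1 / real (Suc n)" for n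
    by (auto simp: qcball_def intro: le_less_trans less_add_same_cancel1[THEN iffD2] simp del: of_nat_Suc)
  then show "y \<in> (\<Inter>n. qball M \<rho> x (r + 1 / real (Suc n)))" by (simp add: qball_def del: of_nat_Suc)
next
  fix y assume y: "y \<in> (\<Inter>n. qball M \<rho> x (r + 1 / real (Suc n)))"
  have "\<rho> x y \<le> r"
  proof (rule ccontr)
    assume "\<not> \<rho> x y \<le> r"
    then have "0 < \<rho> x y - r" by simp
    then obtain n where n: "1 / real (Suc n) < \<rho> x y - r" using nat_approx_posE by blast
    have "y \<in> qball M \<rho> x (r + 1 / real (Suc n))" using y by blast
    then show False using n by (simp add: qball_def del: of_nat_Suc)
  qed
  moreover have "y \<in> M" using y by (auto simp: qball_def)
  ultimately show "y \<in> qcball M \<rho> x r" by (simp add: qcball_def)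
qed

lemma qball_subset_qcball: "qball M \<rho> x r \<subseteq> qcball M \<rho> x r"
  by (auto simp: qball_def qcball_def)

text \<open>
  A closed quasiball is a countable intersection of open ones, each of which is Borel up to a null set.
\<close>

lemma qcball_sandwich:
  assumes x: "x \<in> M" and r: "0 < r"
  obtains A B where "qcball M \<rho> x r \<in> sets \<mu>" "A \<in> sets (borel_of mtopology)" "B \<in> sets (borel_of mtopology)"
    "A \<subseteq> qcball M \<rho> x r" "qcball M \<rho> x r \<subseteq> B" "emeasure m (B - A) = 0"
proof -
  let ?q = "\<lambda>n. qball M \<rho> x (r + 1 / real (Suc n))"
  have rp: "0 < r + 1 / real (Suc n)" for n using r by (intro add_pos_pos) auto
  define P where "P n A B \<longleftrightarrow> A \<in> sets (borel_of mtopology) \<and> B \<in> sets (borel_of mtopology) \<and>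
     A \<subseteq> ?q n \<and> ?q n \<subseteq> B \<and> emeasure \<mu> (B - A) = 0" for n A B
  have "\<exists>A B. P n A B" for n
    using qball_measurable[OF x rp[of n]] unfolding mu_measurable_def P_def
    by (elim bexE conjE) (intro exI conjI)
  then obtain A B where "\<And>n. P n (A n) (B n)" by metis
  then have AB: "\<And>n. A n \<in> sets (borel_of mtopology)" "\<And>n. B n \<in> sets (borel_of mtopology)"
     "\<And>n. A n \<subseteq> ?q n" "\<And>n. ?q n \<subseteq> B n" "\<And>n. emeasure \<mu> (B n - A n) = 0"
    unfolding P_def by simp_all
  have null: "(\<Inter>n. B n) - (\<Inter>n. A n) \<subseteq> (\<Union>n. B n - A n)" by blast
  have "emeasure m (\<Union>n. B n - A n) = 0"
    using AB m_eq by (intro emeasure_UN_eq_0) (auto simp: doubling_sets[OF doubling])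
  then have zero: "emeasure m ((\<Inter>n. B n) - (\<Inter>n. A n)) = 0"
    using emeasure_mono[OF null, of m] AB by (auto simp: doubling_sets[OF doubling])
  show ?thesis
  proof (rule that[of "\<Inter>n. A n" "\<Inter>n. B n"])
    show "qcball M \<rho> x r \<in> sets \<mu>"
      unfolding qcball_eq_Inter using qball_sets[OF x rp] by (intro sets.countable_INT) auto
    show "(\<Inter>n. A n) \<subseteq> qcball M \<rho> x r" "qcball M \<rho> x r \<subseteq> (\<Inter>n. B n)"
      unfolding qcball_eq_Inter using AB(3,4) by blast+
  qed (use AB zero in auto)
qed

text \<open>
  A closed quasiball lies between Borel sets \<open>A\<close> and \<open>B\<close> whose difference is null for \<open>m\<close>, hence also for \<open>\<nu>\<close>; so the
  outer measure of its image is the measure of the image of \<open>A\<close>.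
\<close>

lemma volume_ratio_borel:
  assumes x: "x \<in> M" and r: "0 < r"
  obtains A where "A \<in> sets (borel_of mtopology)" "A \<subseteq> qcball M \<rho> x r"
    "volume_ratio M \<rho> \<mu> f x r = emeasure \<nu> A / emeasure m A"
    "emeasure m (mball x (r powr \<epsilon> / c)) \<le> emeasure m A"
proof -
  obtain A B where q: "qcball M \<rho> x r \<in> sets \<mu>" and A: "A \<in> sets (borel_of mtopology)" and B: "B \<in> sets (borel_of mtopology)"
    and AB: "A \<subseteq> qcball M \<rho> x r" "qcball M \<rho> x r \<subseteq> B" and zero: "emeasure m (B - A) = 0"
    using qcball_sandwich[OF x r] .
  have Am: "A \<in> sets \<mu>" "B \<in> sets \<mu>" using A B borel_sub by auto
  have same: "emeasure n B = emeasure n A" if n: "sets n = sets (borel_of mtopology)" "emeasure n (B - A) = 0" for n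
  proof -
    have "A \<union> (B - A) = B" using AB by blast
    then show ?thesis using emeasure_Un_null_set[of A n "B - A"] A B n by (auto intro!: null_setsI)
  qed
  have mAB: "emeasure m B = emeasure m A" by (rule same[OF doubling_sets[OF doubling] zero])
  have "emeasure \<nu> (B - A) = 0" using nu_null_iff[of "B - A"] A B zero by auto
  then have nAB: "emeasure \<nu> B = emeasure \<nu> A" by (intro same) auto
  have mq: "emeasure \<mu> (qcball M \<rho> x r) = emeasure m A"
  proof (rule antisym)
    have "emeasure \<mu> (qcball M \<rho> x r) \<le> emeasure \<mu> B" using AB Am by (intro emeasure_mono)
    then show "emeasure \<mu> (qcball M \<rho> x r) \<le> emeasure m A" using mAB m_eq[OF B] by simp
    have "emeasure \<mu> A \<le> emeasure \<mu> (qcball M \<rho> x r)" using AB q by (intro emeasure_mono)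
    then show "emeasure m A \<le> emeasure \<mu> (qcball M \<rho> x r)" using m_eq[OF A] by simp
  qed
  have outer_borel: "outer_measure_of \<mu> (f ` E) = emeasure \<nu> E" if "E \<in> sets (borel_of mtopology)" for E
    using image_borel[OF that] borel_sub by (subst outer_measure_of_eq) (auto simp: emeasure_nu[OF that] m_eq)
  have "outer_measure_of \<mu> (f ` qcball M \<rho> x r) = emeasure \<nu> A"
  proof (rule antisym)
    have "outer_measure_of \<mu> (f ` qcball M \<rho> x r) \<le> outer_measure_of \<mu> (f ` B)"
      using AB by (intro outer_measure_of_mono image_mono)
    then show "outer_measure_of \<mu> (f ` qcball M \<rho> x r) \<le> emeasure \<nu> A" using outer_borel[OF B] nAB by simp
    have "outer_measure_of \<mu> (f ` A) \<le> outer_measure_of \<mu> (f ` qcball M \<rho> x r)"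
      using AB by (intro outer_measure_of_mono image_mono)
    then show "emeasure \<nu> A \<le> outer_measure_of \<mu> (f ` qcball M \<rho> x r)" using outer_borel[OF A] by simp
  qed
  then have vr: "volume_ratio M \<rho> \<mu> f x r = emeasure \<nu> A / emeasure m A"
    by (simp add: volume_ratio_def pullback_measure_def mq)
  have "mball x (r powr \<epsilon> / c) \<subseteq> B"
    using mball_subset_qball[OF x r] AB(2) qball_subset_qcball by blast
  then have "emeasure m (mball x (r powr \<epsilon> / c)) \<le> emeasure m B"
    using B by (intro emeasure_mono) (auto simp: doubling_sets[OF doubling])
  then show ?thesis using mAB A AB vr by (intro that[of A]) auto
qed

lemma ball_comparison_constant:
  obtains D where "1 \<le> D" "\<And>x r. x \<in> M \<Longrightarrow> 0 < r \<Longrightarrow>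
     measure m (mball x (c * (2 * r) powr \<epsilon>)) \<le> D * measure m (mball x (r powr \<epsilon> / c))"
proof -
  obtain k :: nat where k: "c * 2 powr \<epsilon> * c < 2 ^ k" using real_arch_pow[of 2 "c * 2 powr \<epsilon> * c"] by auto
  show ?thesis
  proof (rule that[of "C ^ k"])
    show "1 \<le> C ^ k" using C_ge_1 by (rule one_le_power)
    fix x and r :: real assume x: "x \<in> M" and r: "0 < r"
    have "c * (2 * r) powr \<epsilon> = (c * 2 powr \<epsilon> * c) * (r powr \<epsilon> / c)" using c r by (simp add: powr_mult)
    also have "\<dots> \<le> 2 ^ k * (r powr \<epsilon> / c)" using k r c by (intro mult_right_mono) auto
    finally have "mball x (c * (2 * r) powr \<epsilon>) \<subseteq> mball x (2 ^ k * (r powr \<epsilon> / c))" by (rule mball_subset_concentric)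
    then show "measure m (mball x (c * (2 * r) powr \<epsilon>)) \<le> C ^ k * measure m (mball x (r powr \<epsilon> / c))"
      using x r c by (intro doubling_engulf[OF doubling]) auto
  qed
qed

text \<open>
  By \<open>volume_ratio_borel\<close> the quotient is that of a Borel subset of a ball of \<open>d\<close>, of which it fills at least
  the proportion \<open>1 / D\<close>.
\<close>

lemma volume_ratio_tendsto:
  "AE x in \<mu>. (volume_ratio M \<rho> \<mu> f x \<longlongrightarrow> w x) (at_right 0)"
proof -
  obtain D where D: "1 \<le> D" and cmp: "\<And>x r. x \<in> M \<Longrightarrow> 0 < r \<Longrightarrow>
     measure m (mball x (c * (2 * r) powr \<epsilon>)) \<le> D * measure m (mball x (r powr \<epsilon> / c))"
    by (rule ball_comparison_constant) (rule that)
  have "AE x in m. x \<in> M" using AE_space[of m] by (simp add: doubling_space[OF doubling])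
  then have "AE x in m. (volume_ratio M \<rho> \<mu> f x \<longlongrightarrow> w x) (at_right 0)"
    using AE_w_finite AE_differentiation
  proof eventually_elim
    fix x assume x: "x \<in> M" and fin: "w x < \<infinity>" and
      diff: "\<forall>e>0. \<exists>\<delta>>0. \<forall>r A. 0 < r \<longrightarrow> r < \<delta> \<longrightarrow> A \<in> sets (borel_of mtopology) \<longrightarrow> A \<subseteq> mball x r \<longrightarrow>
     \<bar>measure \<nu> A - enn2real (w x) * measure m A\<bar> \<le> e * measure m (mball x r)"
    define W where "W = enn2real (w x)"
    have W: "w x = ennreal W" using fin by (simp add: W_def less_top)
    define v where "v r = enn2real (volume_ratio M \<rho> \<mu> f x r)" for r
    have close: "\<exists>b>0. \<forall>r>0. r < b \<longrightarrow> volume_ratio M \<rho> \<mu> f x r = ennreal (v r) \<and> \<bar>v r - W\<bar> \<le> e" if e: "0 < e" for e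
    proof -
      have "0 < e / D" using e D by simp
      then obtain \<delta> where \<delta>: "0 < \<delta>" "\<And>r A. 0 < r \<Longrightarrow> r < \<delta> \<Longrightarrow> A \<in> sets (borel_of mtopology) \<Longrightarrow> A \<subseteq> mball x r \<Longrightarrow>
         \<bar>measure \<nu> A - W * measure m A\<bar> \<le> e / D * measure m (mball x r)"
        using diff unfolding W_def by blast
      \<comment> \<open>The closed quasiball of radius \<open>r\<close> lies in the open one of radius \<open>2 * r\<close>, hence in the ball of \<open>d\<close> of
        radius \<open>c * (2 * r) powr \<epsilon>\<close>, and this is below \<open>\<delta>\<close> when \<open>r < b\<close>.\<close>
      define b where "b = (\<delta> / c) powr (1 / \<epsilon>) / 2"
      have b: "0 < b" using \<delta> c by (simp add: b_def)
      have "volume_ratio M \<rho> \<mu> f x r = ennreal (v r) \<and> \<bar>v r - W\<bar> \<le> e" if r: "0 < r" "r < b" for r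
      proof -
        define R where "R = c * (2 * r) powr \<epsilon>"
        have R: "0 < R" using r c by (simp add: R_def)
        have "(2 * r) powr \<epsilon> < ((\<delta> / c) powr (1 / \<epsilon>)) powr \<epsilon>"
          using r eps unfolding b_def by (intro powr_less_mono2) auto
        also have "\<dots> = \<delta> / c" using \<delta> c eps by (simp add: powr_powr)
        finally have R\<delta>: "R < \<delta>" unfolding R_def using c by (simp add: field_simps)
        obtain A where A: "A \<in> sets (borel_of mtopology)" "A \<subseteq> qcball M \<rho> x r"
          and vr: "volume_ratio M \<rho> \<mu> f x r = emeasure \<nu> A / emeasure m A"
          and lo: "emeasure m (mball x (r powr \<epsilon> / c)) \<le> emeasure m A"
          using volume_ratio_borel[OF x r(1)] .
        have "qcball M \<rho> x r \<subseteq> qball M \<rho> x (2 * r)" using r by (auto simp: qball_def qcball_def)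
        also have "\<dots> \<subseteq> mball x R" unfolding R_def using x r by (intro qball_subset_mball) auto
        finally have AR: "A \<subseteq> mball x R" using A by blast
        have lo': "measure m (mball x (r powr \<epsilon> / c)) \<le> measure m A"
          using lo doubling_emeasure[OF doubling AR] doubling_emeasure[OF doubling, of "mball x (r powr \<epsilon> / c)" x "r powr \<epsilon> / c"]
          by (simp add: ennreal_le_iff)
        have "0 < measure m (mball x (r powr \<epsilon> / c))" using doubling_pos[OF doubling x] r c by simp
        then have mA: "0 < measure m A" using lo' by simp
        have vr': "volume_ratio M \<rho> \<mu> f x r = ennreal (measure \<nu> A / measure m A)"
          unfolding vr doubling_emeasure[OF doubling AR] doubling_emeasure[OF nu AR] using mA by (intro divide_ennreal) auto
        then have v: "v r = measure \<nu> A / measure m A" using mA by (simp add: v_def)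
        have "measure m (mball x R) \<le> D * measure m (mball x (r powr \<epsilon> / c))" unfolding R_def using x r by (intro cmp)
        also have "\<dots> \<le> D * measure m A" using lo' D by (intro mult_left_mono) auto
        finally have "e / D * measure m (mball x R) \<le> e / D * (D * measure m A)" using e D by (intro mult_left_mono) auto
        then have "\<bar>measure \<nu> A - W * measure m A\<bar> \<le> e * measure m A"
          using \<delta>(2)[OF R R\<delta> A(1) AR] D by simp
        moreover have "v r - W = (measure \<nu> A - W * measure m A) / measure m A" using mA v by (simp add: field_simps)
        ultimately have "\<bar>v r - W\<bar> \<le> e" using mA by (simp add: abs_divide pos_divide_le_eq)
        then show ?thesis using vr' v by simp
      qed
      with b show ?thesis by blast
    qed
    have "(v \<longlongrightarrow> W) (at_right 0)"
    proof (rule tendstoI)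
      fix e :: real assume "0 < e"
      then obtain b where "b > 0" "\<And>r. 0 < r \<Longrightarrow> r < b \<Longrightarrow> \<bar>v r - W\<bar> \<le> e / 2" using close[of "e / 2"] by auto
      then show "eventually (\<lambda>r. dist (v r) W < e) (at_right 0)"
        using \<open>0 < e\<close> unfolding eventually_at_right_field dist_real_def by (intro exI[of _ b]) fastforce
    qed
    then have "((\<lambda>r. ennreal (v r)) \<longlongrightarrow> w x) (at_right 0)" unfolding W by (rule tendsto_ennrealI)
    moreover have "eventually (\<lambda>r. ennreal (v r) = volume_ratio M \<rho> \<mu> f x r) (at_right 0)"
      unfolding eventually_at_right_field using close[of 1] by auto
    ultimately show "(volume_ratio M \<rho> \<mu> f x \<longlongrightarrow> w x) (at_right 0)" by (rule Lim_transform_eventually)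
  qed
  then show ?thesis by (rule AE_mu)
qed

lemma m_integral_eq_mu:
  assumes "g \<in> borel_measurable m" shows "(\<integral>\<^sup>+x. g x \<partial>m) = (\<integral>\<^sup>+x. g x \<partial>\<mu>)"
  using assms borel_sub m_eq
  by (intro nn_integral_subalgebra) (auto simp: space_mu doubling_space[OF doubling] doubling_sets[OF doubling])

text \<open>
  A quasiball fills a fixed proportion of a ball of \<open>d\<close>, so an oscillation bound on balls implies one on quasiballs.
\<close>

lemma log_w_in_BMO: "in_BMO M \<rho> \<mu> (\<lambda>x. ln (enn2real (w x)))"
proof -
  define g where "g x = ln (enn2real (w x))" for x
  have gm: "g \<in> borel_measurable m" unfolding g_def by measurable
  then have g\<mu>: "g \<in> borel_measurable \<mu>"
    using borel_sub unfolding measurable_def by (auto simp: space_mu doubling_space[OF doubling] doubling_sets[OF doubling])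
  obtain K2 where K2: "0 \<le> K2" and osc: "\<And>x0 R. x0 \<in> M \<Longrightarrow> 0 < R \<Longrightarrow>
     (\<integral>\<^sup>+x\<in>mball x0 R. ennreal \<bar>ln (enn2real (w x)) - ln (measure \<nu> (mball x0 R) / measure m (mball x0 R))\<bar> \<partial>m)
       \<le> ennreal (K2 * measure m (mball x0 R))"
    by (rule log_oscillation_on_balls) (rule that)
  obtain D where D: "1 \<le> D" and cmp: "\<And>x r. x \<in> M \<Longrightarrow> 0 < r \<Longrightarrow>
     measure m (mball x (c * (2 * r) powr \<epsilon>)) \<le> D * measure m (mball x (r powr \<epsilon> / c))"
    by (rule ball_comparison_constant) (rule that)
  have main: "set_integrable \<mu> (qball M \<rho> x r) g \<and> mean_oscillation \<mu> (qball M \<rho> x r) g \<le> 2 * (K2 * D)"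
    if x: "x \<in> M" and r: "0 < r" for x r
  proof -
    define A where "A = qball M \<rho> x r"
    define R where "R = c * (2 * r) powr \<epsilon>"
    have R: "0 < R" using c r by (simp add: R_def)
    define L where "L = ln (measure \<nu> (mball x R) / measure m (mball x R))"
    have A: "A \<in> sets \<mu>" unfolding A_def by (rule qball_sets[OF x r])
    have "A \<subseteq> qball M \<rho> x (2 * r)" unfolding A_def using r by (auto simp: qball_def)
    also have "\<dots> \<subseteq> mball x R" unfolding R_def using x r by (intro qball_subset_mball) auto
    finally have AR: "A \<subseteq> mball x R" .
    have ball: "mball x s \<in> sets \<mu>" "emeasure m (mball x s) = emeasure \<mu> (mball x s)" for s using borel_sub m_eq by auto
    have "emeasure \<mu> A \<le> emeasure \<mu> (mball x R)" using AR ball by (intro emeasure_mono)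
    then have fin: "emeasure \<mu> A < \<infinity>" using doubling_finite_ball[OF doubling, of x R] ball by (metis le_less_trans)
    have "emeasure m (mball x (r powr \<epsilon> / c)) \<le> emeasure \<mu> A"
      unfolding A_def ball using mball_subset_qball[OF x r] qball_sets[OF x r] by (intro emeasure_mono)
    also have "\<dots> = ennreal (measure \<mu> A)" using fin by (intro emeasure_eq_ennreal_measure) auto
    finally have lo: "measure m (mball x (r powr \<epsilon> / c)) \<le> measure \<mu> A"
      using doubling_emeasure[OF doubling, of "mball x (r powr \<epsilon> / c)" x "r powr \<epsilon> / c"] by (simp add: ennreal_le_iff)
    have "0 < measure m (mball x (r powr \<epsilon> / c))" using doubling_pos[OF doubling x] r c by simp
    then have pos: "0 < measure \<mu> A" using lo by simp
    have "measure m (mball x R) \<le> D * measure m (mball x (r powr \<epsilon> / c))" unfolding R_def using x r by (intro cmp)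
    also have "\<dots> \<le> D * measure \<mu> A" using lo D by (intro mult_left_mono) auto
    finally have le: "K2 * measure m (mball x R) \<le> K2 * D * measure \<mu> A" using K2 by (simp add: mult.assoc mult_left_mono)
    have "(\<integral>\<^sup>+y\<in>A. ennreal \<bar>g y - L\<bar> \<partial>\<mu>) \<le> (\<integral>\<^sup>+y\<in>mball x R. ennreal \<bar>g y - L\<bar> \<partial>\<mu>)"
      using AR by (intro nn_integral_mono mult_left_mono) (auto simp: indicator_def)
    also have "\<dots> = (\<integral>\<^sup>+y\<in>mball x R. ennreal \<bar>g y - L\<bar> \<partial>m)"
    proof (rule m_integral_eq_mu[symmetric])
      have "mball x R \<in> sets m" by (simp add: doubling_sets[OF doubling])
      then show "(\<lambda>y. ennreal \<bar>g y - L\<bar> * indicator (mball x R) y) \<in> borel_measurable m" using gm by measurable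
    qed
    also have "\<dots> \<le> ennreal (K2 * measure m (mball x R))" unfolding g_def L_def by (rule osc[OF x R])
    also have "\<dots> \<le> ennreal (K2 * D * measure \<mu> A)" using le by (rule ennreal_leI)
    finally show ?thesis
      using mean_oscillation_le[OF A fin pos g\<mu>, of "K2 * D" L] K2 D unfolding A_def by simp
  qed
  then show ?thesis unfolding in_BMO_def g_def[symmetric] using g\<mu> by blast
qed

lemma jacobian_conclusion:
  "(AE x in \<mu>. \<exists>L<\<infinity>. (volume_ratio M \<rho> \<mu> f x \<longlongrightarrow> L) (at_right 0)) \<and> log_in_BMO M \<rho> \<mu> (gen_jacobian M \<rho> \<mu> f)"
proof
  show "AE x in \<mu>. \<exists>L<\<infinity>. (volume_ratio M \<rho> \<mu> f x \<longlongrightarrow> L) (at_right 0)"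
    using volume_ratio_tendsto AE_mu[OF AE_w_finite] by eventually_elim blast
  have "AE x in \<mu>. 0 < gen_jacobian M \<rho> \<mu> f x \<and> gen_jacobian M \<rho> \<mu> f x < \<infinity> \<and>
      ln (enn2real (w x)) = ln (enn2real (gen_jacobian M \<rho> \<mu> f x))"
    using volume_ratio_tendsto AE_mu[OF AE_w_finite] AE_mu[OF AE_w_pos]
  proof eventually_elim
    fix x assume "(volume_ratio M \<rho> \<mu> f x \<longlongrightarrow> w x) (at_right 0)" "w x < \<infinity>" "0 < w x"
    moreover from this(1) have "gen_jacobian M \<rho> \<mu> f x = w x"
      unfolding gen_jacobian_def by (intro tendsto_Lim) auto
    ultimately show "0 < gen_jacobian M \<rho> \<mu> f x \<and> gen_jacobian M \<rho> \<mu> f x < \<infinity> \<and>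
      ln (enn2real (w x)) = ln (enn2real (gen_jacobian M \<rho> \<mu> f x))" by simp
  qed
  then show "log_in_BMO M \<rho> \<mu> (gen_jacobian M \<rho> \<mu> f)"
    unfolding log_in_BMO_def using log_w_in_BMO by blast
qed

end

text \<open>
  A space with one point has to be treated separately: its diameter is zero, so regularity says nothing.
\<close>

lemma one_point_jacobian:
  assumes hom: "homogeneous_type X \<rho> \<mu>" and f: "f ` X = X" and one: "\<And>y z. y \<in> X \<Longrightarrow> z \<in> X \<Longrightarrow> y = z"
  shows "(AE x in \<mu>. \<exists>L<\<infinity>. (volume_ratio X \<rho> \<mu> f x \<longlongrightarrow> L) (at_right 0)) \<and>
         log_in_BMO X \<rho> \<mu> (gen_jacobian X \<rho> \<mu> f)"
proof -
  obtain x0 where x0: "x0 \<in> X" using hom unfolding homogeneous_type_def by blast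
  have X: "X = {x0}" using x0 one by blast
  have rho0: "\<rho> x0 x0 = 0" using hom x0 unfolding homogeneous_type_def quasimetric_on_def by blast
  have space: "space \<mu> = X" using hom unfolding homogeneous_type_def doubling_measure_def by blast
  have qb: "qball X \<rho> x0 r = {x0}" if "0 < r" for r using that X rho0 by (auto simp: qball_def)
  have qc: "qcball X \<rho> x0 r = {x0}" if "0 < r" for r using that X rho0 by (auto simp: qcball_def)
  obtain A1 where A1: "1 \<le> A1" and "\<forall>x\<in>X. \<forall>r>0.
        0 < emeasure \<mu> (qball X \<rho> x (2 * r)) \<and>
        emeasure \<mu> (qball X \<rho> x (2 * r)) \<le> ennreal A1 * emeasure \<mu> (qball X \<rho> x r) \<and>
        ennreal A1 * emeasure \<mu> (qball X \<rho> x r) < \<infinity>"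
    using hom unfolding homogeneous_type_def doubling_measure_def by blast
  then have "0 < emeasure \<mu> (qball X \<rho> x0 (2 * 1)) \<and>
        emeasure \<mu> (qball X \<rho> x0 (2 * 1)) \<le> ennreal A1 * emeasure \<mu> (qball X \<rho> x0 1) \<and>
        ennreal A1 * emeasure \<mu> (qball X \<rho> x0 1) < \<infinity>" using x0 zero_less_one by blast
  then have v: "0 < emeasure \<mu> {x0}" "emeasure \<mu> {x0} < \<infinity>" using qb by (auto intro: le_less_trans)
  have sets: "{x0} \<in> sets \<mu>" using sets.top[of \<mu>] X space by simp
  have vr: "volume_ratio X \<rho> \<mu> f x0 r = 1" if "0 < r" for r
  proof -
    have "f ` {x0} = {x0}" using f X by simp
    then show ?thesis
      unfolding volume_ratio_def pullback_measure_def qc[OF that]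
      using v sets by (simp add: outer_measure_of_eq ennreal_divide_self less_top)
  qed
  have "eventually (\<lambda>r. 1 = volume_ratio X \<rho> \<mu> f x0 r) (at_right 0)"
    using vr unfolding eventually_at_right_field by (intro exI[of _ 1]) auto
  then have lim: "(volume_ratio X \<rho> \<mu> f x0 \<longlongrightarrow> 1) (at_right 0)"
    by (rule Lim_transform_eventually[OF tendsto_const])
  then have J: "gen_jacobian X \<rho> \<mu> f x0 = 1" unfolding gen_jacobian_def by (intro tendsto_Lim) auto
  have "in_BMO X \<rho> \<mu> (\<lambda>x. 0)"
    unfolding in_BMO_def mean_oscillation_def average_def set_integrable_def set_lebesgue_integral_def
    by (auto intro: exI[of _ 0])
  moreover have "AE x in \<mu>. 0 < gen_jacobian X \<rho> \<mu> f x \<and> gen_jacobian X \<rho> \<mu> f x < \<infinity> \<and> 0 = ln (enn2real (gen_jacobian X \<rho> \<mu> f x))"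
    using J X space by (intro AE_I2) auto
  ultimately have "log_in_BMO X \<rho> \<mu> (gen_jacobian X \<rho> \<mu> f)" unfolding log_in_BMO_def by blast
  moreover have "AE x in \<mu>. \<exists>L<\<infinity>. (volume_ratio X \<rho> \<mu> f x \<longlongrightarrow> L) (at_right 0)"
    using lim X space by (intro AE_I2 exI[of _ 1]) auto
  ultimately show ?thesis by blast
qed

theorem corollary1p3:
  fixes X :: "'a set" and \<rho> d :: "'a \<Rightarrow> 'a \<Rightarrow> real" and \<mu> :: "'a measure"
    and \<alpha> \<epsilon> p :: real and \<eta> :: "real \<Rightarrow> real" and f :: "'a \<Rightarrow> 'a"
  assumes "homogeneous_type X \<rho> \<mu>"
    and "locally_finite_measure (qtopology X \<rho>) \<mu>"
    and "borel_regular (qtopology X \<rho>) \<mu>"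
    and "qtopology X \<rho> closure_of measure_support (qtopology X \<rho>) \<mu> = X"
    and "locally_compact_space (qtopology X \<rho>)"
    and "\<alpha> > 1" and "alpha_regular X \<rho> \<mu> \<alpha>"
    and "0 < \<epsilon>" and "\<epsilon> \<le> 1"
    and "comparable_on X d (\<lambda>x y. \<rho> x y powr \<epsilon>)"
    and "metric_measure_space X d \<mu>"
    and "1 \<le> p" and "p < \<alpha> / \<epsilon>" and "weak_poincare X d \<mu> p"
    and "quasisymmetric_map X \<rho> \<eta> f"
  shows "(AE x in \<mu>. \<exists>L<\<infinity>. (volume_ratio X \<rho> \<mu> f x \<longlongrightarrow> L) (at_right 0)) \<and>
         log_in_BMO X \<rho> \<mu> (gen_jacobian X \<rho> \<mu> f)"
proof -
  have hm: "homeomorphic_map (qtopology X \<rho>) (qtopology X \<rho>) f"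
    using assms(15) unfolding quasisymmetric_map_def by blast
  have fX: "f ` X = X" "inj_on f X"
    using hm unfolding homeomorphic_eq_everything_map by auto
  show ?thesis
  proof (cases "\<exists>y\<in>X. \<exists>z\<in>X. y \<noteq> z")
    case False
    then show ?thesis using one_point_jacobian[OF assms(1) fX(1)] by blast
  next
    case two: True
    interpret Metric_space X d using assms(11) unfolding metric_measure_space_def by blast
    obtain c where c: "1 \<le> c" and cmp: "\<And>x y. x \<in> X \<Longrightarrow> y \<in> X \<Longrightarrow> inverse c * \<rho> x y powr \<epsilon> \<le> d x y \<and> d x y \<le> c * \<rho> x y powr \<epsilon>"
      using assms(10) unfolding comparable_on_def by blast
    have quasi: "\<And>x y. x \<in> X \<Longrightarrow> y \<in> X \<Longrightarrow> 0 \<le> \<rho> x y \<and> (\<rho> x y = 0 \<longleftrightarrow> x = y)"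
      using assms(1) unfolding homogeneous_type_def quasimetric_on_def by blast
    interpret snowflake X d \<rho> \<epsilon> c
    proof
      fix x y assume "x \<in> X" "y \<in> X"
      then show "\<rho> x y powr \<epsilon> \<le> c * d x y \<and> d x y \<le> c * \<rho> x y powr \<epsilon>"
        using cmp[of x y] c by (simp add: field_simps)
    qed (use quasi c assms(8) in auto)
    note top = qtopology_eq
    have d\<rho>: "doubling_measure X \<rho> \<mu>" using assms(1) unfolding homogeneous_type_def by blast
    have dd: "doubling_measure X d \<mu>" using assms(11) unfolding metric_measure_space_def by blast
    have space: "space \<mu> = X" and bsub: "sets (borel_of mtopology) \<subseteq> sets \<mu>"
      and qsets: "\<And>x r. x \<in> X \<Longrightarrow> 0 < r \<Longrightarrow> qball X \<rho> x r \<in> sets \<mu> \<and> mu_measurable mtopology \<mu> (qball X \<rho> x r)"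
      using d\<rho> unfolding doubling_measure_def top by blast+
    obtain A1 where A1: "1 \<le> A1" and dbl\<rho>: "\<And>x r. x \<in> X \<Longrightarrow> 0 < r \<Longrightarrow>
        emeasure \<mu> (qball X \<rho> x (2 * r)) \<le> ennreal A1 * emeasure \<mu> (qball X \<rho> x r)"
      using d\<rho> unfolding doubling_measure_def by blast
    obtain A2 where A2: "1 \<le> A2" and dbl: "\<And>x r. x \<in> X \<Longrightarrow> 0 < r \<Longrightarrow>
        0 < emeasure \<mu> (qball X d x (2 * r)) \<and>
        emeasure \<mu> (qball X d x (2 * r)) \<le> ennreal A2 * emeasure \<mu> (qball X d x r) \<and>
        ennreal A2 * emeasure \<mu> (qball X d x r) < \<infinity>"
      using dd unfolding doubling_measure_def by blast
    define m where "m = restr_to_subalg \<mu> (borel_of mtopology)"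
    have sub: "subalgebra \<mu> (borel_of mtopology)" using bsub space by (simp add: subalgebra_def)
    have sets_m: "sets m = sets (borel_of mtopology)" unfolding m_def by (rule sets_restr_to_subalg[OF sub])
    have m_eq: "emeasure m E = emeasure \<mu> E" if "E \<in> sets (borel_of mtopology)" for E
      unfolding m_def by (rule emeasure_restr_to_subalg[OF sub that])
    have subm: "subalgebra \<mu> m" using sets_m bsub sets_eq_imp_space_eq[OF sets_m] space by (simp add: subalgebra_def)
    have doubling: "doubling_borel A2 m"
      unfolding doubling_borel_def
    proof (intro conjI ballI allI impI sets_m)
      fix x and r :: real assume x: "x \<in> X" and r: "0 < r"
      have b: "emeasure m (mball x s) = emeasure \<mu> (qball X d x s)" for s
        using m_eq[OF mball_borel] qball_eq_mball[OF x] by simp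
      show "0 < emeasure m (mball x r)" using dbl[OF x, of "r / 2"] r unfolding b by simp
      show "emeasure m (mball x (2 * r)) \<le> ennreal A2 * emeasure m (mball x r)" using dbl[OF x r] unfolding b by simp
      have "1 * emeasure \<mu> (qball X d x r) \<le> ennreal A2 * emeasure \<mu> (qball X d x r)"
        using A2 by (intro mult_right_mono) (auto simp flip: ennreal_1 intro: ennreal_leI)
      then show "emeasure m (mball x r) < \<infinity>" using dbl[OF x r] unfolding b by (auto intro: le_less_trans)
    qed
    have outer: "outer_regular m"
      unfolding outer_regular_def
    proof
      fix E assume E: "E \<in> sets (borel_of mtopology)"
      have "emeasure \<mu> E = (INF U\<in>{U. openin mtopology U \<and> E \<subseteq> U}. emeasure \<mu> U)"
        using assms(3) E unfolding borel_regular_def top by blast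
      also have "\<dots> = (INF U\<in>{U. openin mtopology U \<and> E \<subseteq> U}. emeasure m U)"
        by (intro INF_cong refl m_eq[symmetric]) (auto intro: openin_imp_borel)
      finally show "emeasure m E = (INF U\<in>{U. openin mtopology U \<and> E \<subseteq> U}. emeasure m U)" using m_eq[OF E] by simp
    qed
    have ball_sets: "mball x r \<in> sets \<mu>" for x r using bsub by auto
    have \<alpha>: "0 < \<alpha>" using assms(6) by simp
    obtain K where K: "1 \<le> K"
      and up: "\<And>x r. x \<in> X \<Longrightarrow> 0 < r \<Longrightarrow> emeasure \<mu> (mball x r) \<le> ennreal (K * r powr (\<alpha> / \<epsilon>))"
      and lo: "\<And>x y z r. x \<in> X \<Longrightarrow> y \<in> X \<Longrightarrow> z \<in> X \<Longrightarrow> 0 < r \<Longrightarrow> r \<le> d y z \<Longrightarrow>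
       ennreal (r powr (\<alpha> / \<epsilon>)) \<le> ennreal K * emeasure \<mu> (mball x r)"
      by (rule snowflake_regular[OF assms(7) \<alpha> two A1 dbl\<rho> conjunct1[OF qsets] ball_sets]) (auto intro: that)
    have poincare: "weak_poincare X d m p"
      using m_eq sets_m by (intro weak_poincare_subalgebra[OF assms(14) sets_m subm]) auto
    have "homeomorphic_map mtopology mtopology f" using hm unfolding top .
    then obtain f' where f': "homeomorphic_maps mtopology mtopology f f'" unfolding homeomorphic_map_maps by blast
    note qsm = assms(15)[unfolded quasisymmetric_map_def]
    have mono: "strict_mono_on {0..} \<eta>" by (rule qsm[THEN conjunct2, THEN conjunct1])
    obtain \<eta>' where homeo: "homeomorphism {0..} {0..} \<eta> \<eta>'"
      using qsm[THEN conjunct2, THEN conjunct2, THEN conjunct1] by (rule exE)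
    have qs: "\<rho> (f x) (f a) / \<rho> (f x) (f b) \<le> \<eta> \<theta>"
      if "0 \<le> \<theta>" "x \<in> X" "a \<in> X" "b \<in> X" "x \<noteq> a" "x \<noteq> b" "a \<noteq> b" "\<rho> x a / \<rho> x b \<le> \<theta>" for \<theta> x a b
      by (rule qsm[THEN conjunct2, THEN conjunct2, THEN conjunct2, rule_format]) (use that in simp_all)
    have fin: "\<And>x. x \<in> X \<Longrightarrow> f x \<in> X" using fX by blast
    obtain \<zeta> :: "real \<Rightarrow> real" where \<zeta>: "\<And>e. 0 < e \<Longrightarrow> \<exists>\<theta>>0. \<zeta> \<theta> \<le> e"
      "\<And>x a b \<theta>. x \<in> X \<Longrightarrow> a \<in> X \<Longrightarrow> b \<in> X \<Longrightarrow> 0 < \<theta> \<Longrightarrow> d x a \<le> \<theta> * d x b \<Longrightarrow>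
         d (f x) (f a) \<le> \<zeta> \<theta> * d (f x) (f b)"
      by (rule snowflake_quasisymmetric[OF fin fX(2) mono homeo qs]) (auto intro: that)
    interpret jacobian_setting X d m A2 K "\<alpha> / \<epsilon>" p f f' \<zeta> \<rho> \<epsilon> c \<mu>
    proof
      show "doubling_borel A2 m" "outer_regular m" "weak_poincare X d m p" by fact+
      show "homeomorphic_maps mtopology mtopology f f'" by fact
      fix x :: 'a and r :: real
      have em: "emeasure \<mu> (mball x r) = ennreal (measure m (mball x r))"
        using doubling_emeasure[OF doubling, of "mball x r" x r] m_eq[of "mball x r"] by simp
      show "measure m (mball x r) \<le> K * r powr (\<alpha> / \<epsilon>)" if "x \<in> X" "0 < r"
        using up[OF that] K unfolding em by (simp add: ennreal_le_iff)
      show "r powr (\<alpha> / \<epsilon>) \<le> K * measure m (mball x r)" if "x \<in> X" "y \<in> X" "z \<in> X" "0 < r" "r \<le> d y z" for y z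
        using lo[OF that] K unfolding em by (simp add: ennreal_le_iff ennreal_mult[symmetric])
    qed (use K assms(12,13) \<zeta> two space bsub m_eq qsets in auto)
    show ?thesis by (rule jacobian_conclusion)
  qed
qed

end
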